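(* Let $\mathcal{Y}$ be the set of all pairs $\langle f,g\rangle$ of Boolean functions $f,g:\{0,1\}^n\to\{-1,1\}$ such that $\Phi_{f,g}\le\frac{1}{100}$, and let $N=2^n$. Then the property $\mathcal{Y}$: (1) can be quantumly $\varepsilon$-tested, with bounded error, using only $O(1/\varepsilon)$ queries; but (2) requires $\Omega\left(\frac{\sqrt N}{\log N}\right)$ queries to $\varepsilon$-test classically (by randomized algorithms with bounded error), provided $\varepsilon$ is a sufficiently small positive constant.
   Context: For $f,g:\{0,1\}^n\to\{-1,1\}$, $\Phi_{f,g}:=\frac{1}{2^{3n/2}}\sum_{x,y\in\{0,1\}^n}f(x)(-1)^{x\cdot y}g(y)$. Let $\mathcal{N}_\varepsilon$ be the set of all pairs $\langle g_1,g_2\rangle$ of Boolean functions $\{0,1\}^n\to\{-1,1\}$ that differ from every $\langle f_1,f_2\rangle\in\mathcal{Y}$ on at least $\varepsilon\cdot2\cdot2^n$ of the $2\cdot2^n$ positions of the combined truth table. To $\varepsilon$-test $\mathcal{Y}$ means to decide, given query access to the truth tables of a pair of functions, whether the pair is in $\mathcal{Y}$ or in $\mathcal{N}_\varepsilon$, promised that one of these is the case. A classical query returns one function value; a quantum query multiplies each basis state indexed by a truth-table position by the $\pm1$ value at that position. Bounded error means error probability at most $1/2-c$ for a constant $c>0$ (for the upper bound, error at most $1/3$). *)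

theory Defs
  imports "HOL-Probability.Probability_Mass_Function" "Jordan_Normal_Form.Schur_Decomposition"
begin

unbundle no vec_syntax

definition cube :: "nat \<Rightarrow> bool list set" where
  "cube n = {x. length x = n}"

definition boolean_functions :: "nat \<Rightarrow> (bool list \<Rightarrow> real) set" where
  "boolean_functions n = cube n \<rightarrow>\<^sub>E {-1, 1}"

definition dot :: "bool list \<Rightarrow> bool list \<Rightarrow> nat" where
  "dot x y = (\<Sum>i<length x. of_bool (x ! i) * of_bool (y ! i))"

definition Phi :: "nat \<Rightarrow> (bool list \<Rightarrow> real) \<Rightarrow> (bool list \<Rightarrow> real) \<Rightarrow> real" where
  "Phi n f g =
     1 / 2 powr (3 * real n / 2) * (\<Sum>x\<in>cube n. \<Sum>y\<in>cube n. f x * (-1) ^ dot x y * g y)"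

definition Yes_pairs :: "nat \<Rightarrow> ((bool list \<Rightarrow> real) \<times> (bool list \<Rightarrow> real)) set" where
  "Yes_pairs n =
     {(f, g). f \<in> boolean_functions n \<and> g \<in> boolean_functions n \<and> Phi n f g \<le> 1 / 100}"

text \<open>
  A position of the combined truth table of \<open>(f, g)\<close> is \<open>Inl x\<close> (with value \<open>f x\<close>) or
  \<open>Inr y\<close> (with value \<open>g y\<close>); the combined truth table itself is \<open>case_sum f g\<close>.
\<close>

type_synonym position = "bool list + bool list"

definition positions :: "nat \<Rightarrow> position set" where
  "positions n = cube n <+> cube n"

definition Far_pairs :: "nat \<Rightarrow> real \<Rightarrow> ((bool list \<Rightarrow> real) \<times> (bool list \<Rightarrow> real)) set" where
  "Far_pairs n \<epsilon> =
     {(g1, g2). g1 \<in> boolean_functions n \<and> g2 \<in> boolean_functions n \<and>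
        (\<forall>(f1, f2) \<in> Yes_pairs n.
           real (card {p \<in> positions n. case_sum g1 g2 p \<noteq> case_sum f1 f2 p})
             \<ge> \<epsilon> * 2 * 2 ^ n)}"

text \<open>
  The last argument maps a combined truth table to the probability that the algorithm accepts it.
\<close>

definition tests_with_error ::
    "nat \<Rightarrow> real \<Rightarrow> real \<Rightarrow> ((position \<Rightarrow> real) \<Rightarrow> real) \<Rightarrow> bool" where
  "tests_with_error n \<epsilon> \<delta> acc \<longleftrightarrow>
     (\<forall>(f, g) \<in> Yes_pairs n. acc (case_sum f g) \<ge> 1 - \<delta>) \<and>
     (\<forall>(f, g) \<in> Far_pairs n \<epsilon>. 1 - acc (case_sum f g) \<ge> 1 - \<delta>)"

text \<open>
  \<open>Query p t u\<close> queries position \<open>p\<close> and continues with \<open>t\<close> if the value is \<open>1\<close>, else with \<open>u\<close>.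
\<close>

datatype 'q dtree = Output bool | Query 'q "'q dtree" "'q dtree"

primrec run_dtree :: "('q \<Rightarrow> real) \<Rightarrow> 'q dtree \<Rightarrow> bool" where
  "run_dtree h (Output b) = b"
| "run_dtree h (Query p t u) = (if h p = 1 then run_dtree h t else run_dtree h u)"

primrec depth :: "'q dtree \<Rightarrow> nat" where
  "depth (Output b) = 0"
| "depth (Query p t u) = Suc (max (depth t) (depth u))"

text \<open>
  A randomized algorithm is a probability distribution over decision trees; its number of queries
  is counted in the worst case over its random choices and the answers it receives.
\<close>

definition randomized_algorithm :: "nat \<Rightarrow> nat \<Rightarrow> position dtree pmf \<Rightarrow> bool" where
  "randomized_algorithm n T R \<longleftrightarrow>
     (\<forall>t \<in> set_pmf R. set_dtree t \<subseteq> positions n \<and> depth t \<le> T)"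

definition rand_accept_prob :: "'q dtree pmf \<Rightarrow> ('q \<Rightarrow> real) \<Rightarrow> real" where
  "rand_accept_prob R h = measure_pmf.prob R {t. run_dtree h t}"

text \<open>
  The state space is \<open>\<complex>\<^sup>d\<close> for \<open>d = qdim A\<close>. The basis state \<open>k < d\<close> is indexed by the truth-table
  position \<open>p\<close> if \<open>qlabel A k = Some p\<close> (several basis states may share \<open>p\<close>, which accounts for
  the workspace); if \<open>qlabel A k = None\<close>, a query leaves it unchanged, so that queries may be
  controlled. \<open>qunitary A 0\<close> is applied to the initial state and \<open>qunitary A t\<close> after the
  \<open>t\<close>-th query. The final state is measured in the computational basis, and \<open>qaccept A\<close> is
  the set of accepting outcomes.
\<close>

record 'q quantum_algorithm =
  qdim :: nat
  qlabel :: "nat \<Rightarrow> 'q option"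
  qunitary :: "nat \<Rightarrow> complex mat"
  qaccept :: "nat set"

definition unitary_mat :: "nat \<Rightarrow> complex mat \<Rightarrow> bool" where
  "unitary_mat d U \<longleftrightarrow>
     U \<in> carrier_mat d d \<and> mat_adjoint U * U = 1\<^sub>m d \<and> U * mat_adjoint U = 1\<^sub>m d"

definition quantum_algorithm :: "nat \<Rightarrow> nat \<Rightarrow> position quantum_algorithm \<Rightarrow> bool" where
  "quantum_algorithm n T A \<longleftrightarrow>
     qdim A > 0 \<and>
     (\<forall>k<qdim A. \<forall>p. qlabel A k = Some p \<longrightarrow> p \<in> positions n) \<and>
     (\<forall>t\<le>T. unitary_mat (qdim A) (qunitary A t))"

definition phase_query ::
    "'q quantum_algorithm \<Rightarrow> ('q \<Rightarrow> real) \<Rightarrow> complex vec \<Rightarrow> complex vec" where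
  "phase_query A h v =
     vec (qdim A)
       (\<lambda>k. (case qlabel A k of None \<Rightarrow> 1 | Some p \<Rightarrow> complex_of_real (h p)) * v $ k)"

primrec qstate :: "'q quantum_algorithm \<Rightarrow> ('q \<Rightarrow> real) \<Rightarrow> nat \<Rightarrow> complex vec" where
  "qstate A h 0 = qunitary A 0 *\<^sub>v unit_vec (qdim A) 0"
| "qstate A h (Suc t) = qunitary A (Suc t) *\<^sub>v phase_query A h (qstate A h t)"

definition quantum_accept_prob ::
    "nat \<Rightarrow> 'q quantum_algorithm \<Rightarrow> ('q \<Rightarrow> real) \<Rightarrow> real" where
  "quantum_accept_prob T A h =
     (\<Sum>k | k < qdim A \<and> k \<in> qaccept A. (cmod (qstate A h T $ k))\<^sup>2)"

end

theory Submission
  imports Defs "HOL-Probability.Probability" "HOL-Real_Asymp.Real_Asymp"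
begin

unbundle no vec_syntax

text \<open>
  Quantum part: two reflections, one of which is given by the queries and the other by the Hadamard
  transform, compose to a walk that rotates the vector of the combined truth table by the angle with
  cosine \<open>Phi\<close>. A sine-weighted superposition of \<open>O(1/\<epsilon>)\<close> powers of the walk estimates \<open>Phi\<close> up to
  \<open>O(\<epsilon>)\<close>. A far pair has \<open>Phi \<ge> 1/100 + \<epsilon>/50\<close>, since otherwise it could be brought into
  \<open>Yes_pairs\<close> by flipping the few values of \<open>g\<close> that contribute most to \<open>Phi\<close>.

  Classical part: let \<open>N = 2 ^ n\<close>. Uniformly random functions have \<open>Phi\<close> close to \<open>0\<close>. Random
  functions with biases \<open>sin (v y) / 2\<close> for \<open>g y\<close> and \<open>sin (u x) / 2\<close> for \<open>f x\<close>, where \<open>v\<close> is a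
  Gaussian vector and \<open>u\<close> its Hadamard transform, have \<open>Phi\<close> close to \<open>1/(4e)\<close> and are
  therefore far. The likelihood ratio of the values seen at a set of positions depends only on the
  Gram matrix of the corresponding linear forms, which is realised by a small perturbation of an
  orthonormal system; hence the ratio falls short of \<open>1\<close> by at most an Ising energy and the squares of
  its local fields. Both are \<open>O(\<kappa>)\<close> on average along a decision tree of depth \<open>\<kappa> * sqrt N / n\<close>, by a
  potential argument that controls all local fields through the sum of their hyperbolic cosines.
\<close>

section \<open>The Hadamard matrix\<close>

text \<open>The promise leaves a gap of order \<epsilon> in \<open>Phi\<close>, and averaging
  independent samples would need a number of queries quadratic in 1/\<epsilon> to resolve it; the
  coherent rotation makes the cost linear. The flipping argument needs at least one position to
  flip, so tables with \<open>2 * \<epsilon> * 2 ^ n \<le> 1\<close> are read completely instead.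
  The classical obstacle is adaptivity: a decision tree can chase positions correlated with what it
  has seen, so all 2N local fields have to be controlled at once, and this costs the factor n. Sines
  are used because products of them over Gaussian linear forms are finite sums of exponentials; the
  factor 1/2 keeps every factor of the likelihood ratio between 1/2 and 3/2, where its logarithm has
  bounded curvature. A one-sided bound on the ratio is enough, as the advantage of a tree is the
  average over its accepting paths of 1 minus the ratio. The constant 1/(4e) combines two halves
  with the Gaussian damping exp(-1) of two unit-variance sines.\<close>

definition hadamard :: "nat \<Rightarrow> bool list \<Rightarrow> bool list \<Rightarrow> real" where
  "hadamard n x y = (-1) ^ dot x y / sqrt (2 ^ n)"

lemma cube_0 [simp]: "cube 0 = {[]}"
  by (auto simp: cube_def)

lemma cube_Suc: "cube (Suc n) = (\<lambda>(b, x). b # x) ` (UNIV \<times> cube n)"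
  by (auto simp: cube_def length_Suc_conv image_iff)

lemma finite_cube [simp]: "finite (cube n)"
  by (induction n) (auto simp: cube_Suc)

lemma sum_cube_Suc: "sum f (cube (Suc n)) = (\<Sum>b\<in>UNIV. \<Sum>x\<in>cube n. f (b # x))"
  unfolding cube_Suc
  by (subst sum.reindex) (auto simp: inj_on_def sum.cartesian_product case_prod_unfold)

lemma card_cube [simp]: "card (cube n) = 2 ^ n"
  by (induction n) (auto simp: cube_Suc card_image inj_on_def card_cartesian_product UNIV_bool)

lemma replicate_in_cube [simp]: "replicate n b \<in> cube n"
  by (simp add: cube_def)

lemma dot_Nil [simp]: "dot [] y = 0"
  by (simp add: dot_def)

lemma dot_Cons [simp]: "dot (a # x) (b # y) = of_bool a * of_bool b + dot x y"
  by (simp add: dot_def sum.lessThan_Suc_shift del: sum.lessThan_Suc)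

lemma dot_commute: "length x = length y \<Longrightarrow> dot x y = dot y x"
  by (simp add: dot_def mult.commute)

lemma dot_zero [simp]: "dot (replicate n False) y = 0"
  by (simp add: dot_def)

lemma sum_sign_dot:
  assumes "x \<in> cube n" "z \<in> cube n"
  shows "(\<Sum>y\<in>cube n. (-1) ^ dot x y * (-1) ^ dot z y) = (if x = z then 2 ^ n else 0 :: real)"
  using assms
proof (induction n arbitrary: x z)
  case (Suc n)
  obtain a x' b z' where *: "x = a # x'" "z = b # z'" "x' \<in> cube n" "z' \<in> cube n"
    using Suc.prems by (auto simp: cube_Suc)
  have "(\<Sum>y\<in>cube (Suc n). (-1) ^ dot x y * (-1) ^ dot z y) =
      (\<Sum>c\<in>UNIV. (-1) ^ (of_bool a * of_bool c) * (-1) ^ (of_bool b * of_bool c) *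
         (\<Sum>y\<in>cube n. (-1) ^ dot x' y * (-1) ^ dot z' y :: real))"
    by (simp add: sum_cube_Suc * power_add sum_distrib_left mult_ac)
  then show ?case
    unfolding Suc.IH[OF *(3,4)] by (auto simp: * UNIV_bool)
qed (auto simp: cube_def)

lemma hadamard_commute: "x \<in> cube n \<Longrightarrow> y \<in> cube n \<Longrightarrow> hadamard n x y = hadamard n y x"
  by (simp add: hadamard_def dot_commute cube_def)

lemma sum_hadamard_hadamard:
  assumes "x \<in> cube n" "z \<in> cube n"
  shows "(\<Sum>y\<in>cube n. hadamard n x y * hadamard n z y) = (if x = z then 1 else 0)"
proof -
  have "(\<Sum>y\<in>cube n. hadamard n x y * hadamard n z y) =
      (\<Sum>y\<in>cube n. (-1) ^ dot x y * (-1) ^ dot z y) / 2 ^ n"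
    by (simp add: hadamard_def sum_divide_distrib)
  then show ?thesis using sum_sign_dot[OF assms] by simp
qed

lemma sum_hadamard_hadamard':
  assumes "x \<in> cube n" "z \<in> cube n"
  shows "(\<Sum>y\<in>cube n. hadamard n y x * hadamard n y z) = (if x = z then 1 else 0)"
  using sum_hadamard_hadamard[OF assms] by (simp add: hadamard_commute assms cong: sum.cong)

lemma hadamard_square: "(hadamard n x y)\<^sup>2 = 1 / 2 ^ n"
  by (simp add: hadamard_def power_divide power_even_eq[symmetric] flip: power_mult)

lemma abs_hadamard: "\<bar>hadamard n x y\<bar> = 1 / sqrt (2 ^ n)"
  by (simp add: hadamard_def power_abs)

lemma sum_hadamard_square:
  "(\<Sum>y\<in>cube n. (\<Sum>x\<in>cube n. a x * hadamard n x y)\<^sup>2) = (\<Sum>x\<in>cube n. (a x)\<^sup>2)"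
proof -
  have "(\<Sum>y\<in>cube n. (\<Sum>x\<in>cube n. a x * hadamard n x y)\<^sup>2) =
      (\<Sum>y\<in>cube n. \<Sum>x\<in>cube n. \<Sum>z\<in>cube n. a x * a z * (hadamard n x y * hadamard n z y))"
    by (simp add: power2_eq_square sum_product mult_ac)
  also have "\<dots> = (\<Sum>x\<in>cube n. \<Sum>y\<in>cube n. \<Sum>z\<in>cube n. a x * a z * (hadamard n x y * hadamard n z y))"
    by (rule sum.swap)
  also have "\<dots> = (\<Sum>x\<in>cube n. \<Sum>z\<in>cube n. \<Sum>y\<in>cube n. a x * a z * (hadamard n x y * hadamard n z y))"
    by (intro sum.cong refl sum.swap)
  also have "\<dots> = (\<Sum>x\<in>cube n. \<Sum>z\<in>cube n. a x * a z * (\<Sum>y\<in>cube n. hadamard n x y * hadamard n z y))"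
    by (simp add: sum_distrib_left)
  also have "\<dots> = (\<Sum>x\<in>cube n. \<Sum>z\<in>cube n. if x = z then a x * a x else 0)"
    by (intro sum.cong refl) (simp add: sum_hadamard_hadamard)
  also have "\<dots> = (\<Sum>x\<in>cube n. (a x)\<^sup>2)"
    by (simp add: power2_eq_square)
  finally show ?thesis .
qed

text \<open>The normalisation \<open>2 powr (3 * n / 2)\<close> splits into
  \<open>sqrt (2 ^ n)\<close>, which makes the sign matrix orthogonal, and \<open>2 ^ n\<close>, the
  product of the norms of two sign vectors.\<close>

lemma Phi_hadamard:
  "Phi n f g = (\<Sum>x\<in>cube n. \<Sum>y\<in>cube n. f x * hadamard n x y * g y) / 2 ^ n"
proof -
  have "2 powr (3 * real n / 2) = 2 powr real n * 2 powr (real n / 2)"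
    by (simp add: field_simps flip: powr_add)
  also have "2 powr (real n / 2) = sqrt (2 ^ n)"
    by (simp add: powr_half_sqrt_powr powr_realpow)
  finally have "2 powr (3 * real n / 2) = 2 ^ n * sqrt (2 ^ n)"
    by (simp add: powr_realpow)
  then show ?thesis
    by (simp add: Phi_def hadamard_def sum_divide_distrib mult_ac)
qed

lemma boolean_functions_square:
  assumes "f \<in> boolean_functions n" "x \<in> cube n"
  shows "(f x)\<^sup>2 = 1"
  using assms by (auto simp: boolean_functions_def PiE_def Pi_def)

lemma sum_boolean_functions_square:
  assumes "f \<in> boolean_functions n"
  shows "(\<Sum>x\<in>cube n. (f x)\<^sup>2) = 2 ^ n"
  using boolean_functions_square[OF assms] by simp

text \<open>Cauchy-Schwarz after Parseval. It serves twice: for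
  \<open>\<bar>Phi n f g\<bar> \<le> 1\<close> and, applied to differences of tables, for the
  continuity of \<open>Phi\<close> in the Hamming distance.\<close>

lemma sum_hadamard_le:
  fixes n :: nat
  shows
  "\<bar>\<Sum>x\<in>cube n. \<Sum>y\<in>cube n. f x * hadamard n x y * g y\<bar> \<le>
     sqrt (\<Sum>x\<in>cube n. (f x)\<^sup>2) * sqrt (\<Sum>y\<in>cube n. (g y)\<^sup>2)"
proof -
  have "(\<Sum>x\<in>cube n. \<Sum>y\<in>cube n. f x * hadamard n x y * g y) =
      (\<Sum>y\<in>cube n. (\<Sum>x\<in>cube n. f x * hadamard n x y) * g y)"
    by (subst sum.swap) (simp add: sum_distrib_right)
  also have "\<bar>\<dots>\<bar> \<le> L2_set (\<lambda>y. \<Sum>x\<in>cube n. f x * hadamard n x y) (cube n) * L2_set g (cube n)"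
    by (rule order_trans[OF sum_abs order_trans[OF _ L2_set_mult_ineq]]) (simp add: abs_mult)
  also have "\<dots> = sqrt (\<Sum>x\<in>cube n. (f x)\<^sup>2) * sqrt (\<Sum>y\<in>cube n. (g y)\<^sup>2)"
    by (simp add: L2_set_def sum_hadamard_square)
  finally show ?thesis .
qed

lemma abs_Phi_le_1:
  assumes "f \<in> boolean_functions n" "g \<in> boolean_functions n"
  shows "\<bar>Phi n f g\<bar> \<le> 1"
  using sum_hadamard_le[where n = n and f = f and g = g] assms
  by (simp add: Phi_hadamard sum_boolean_functions_square field_simps)

lemma finite_positions [simp]: "finite (positions n)"
  by (simp add: positions_def)

lemma sum_positions:
  "sum f (positions n) = (\<Sum>x\<in>cube n. f (Inl x)) + (\<Sum>y\<in>cube n. f (Inr y))"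
  by (simp add: positions_def sum.Plus)

lemma card_positions [simp]: "card (positions n) = 2 * 2 ^ n"
  by (simp add: positions_def card_Plus)

text \<open>Negating \<open>g\<close> negates \<open>Phi\<close>, so one of the two constant choices
  is a member. Were there no member, every pair would be far vacuously, for every
  \<epsilon>.\<close>

lemma Yes_pairs_nonempty: "Yes_pairs n \<noteq> {}"
proof -
  define f where "f = (\<lambda>x\<in>cube n. 1::real)"
  define g where "g = (\<lambda>x\<in>cube n. -1::real)"
  have *: "f \<in> boolean_functions n" "g \<in> boolean_functions n"
    by (auto simp: f_def g_def boolean_functions_def)
  have "Phi n f g = - Phi n f f"
    by (simp add: Phi_def f_def g_def sum_negf)
  then have "Phi n f g \<le> 1/100 \<or> Phi n f f \<le> 1/100" by linarith
  with * show ?thesis by (auto simp: Yes_pairs_def)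
qed

section \<open>Quantum algorithms from real symmetric involutions\<close>

text \<open>All unitaries of the construction can be taken real, symmetric and self-inverse;
  unitarity is then the single identity \<open>U * U = 1\<close>, with no adjoint to
  compute.\<close>

definition symmetric_involution :: "'b set \<Rightarrow> ('b \<Rightarrow> 'b \<Rightarrow> real) \<Rightarrow> bool" where
  "symmetric_involution B U \<longleftrightarrow>
     (\<forall>a\<in>B. \<forall>b\<in>B. U a b = U b a) \<and>
     (\<forall>a\<in>B. \<forall>c\<in>B. (\<Sum>b\<in>B. U a b * U b c) = of_bool (a = c))"

lemma symmetric_involutionI:
  assumes "\<And>a b. a \<in> B \<Longrightarrow> b \<in> B \<Longrightarrow> U a b = U b a"
    and "\<And>a c. a \<in> B \<Longrightarrow> c \<in> B \<Longrightarrow> (\<Sum>b\<in>B. U a b * U b c) = of_bool (a = c)"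
  shows "symmetric_involution B U"
  using assms unfolding symmetric_involution_def by blast

lemma symmetric_involution_commute:
  assumes "symmetric_involution B U" "a \<in> B" "b \<in> B"
  shows "U a b = U b a"
  using bspec[OF bspec[OF conjunct1[OF assms(1)[unfolded symmetric_involution_def]] assms(2)] assms(3)] .

lemma symmetric_involution_mult:
  assumes "symmetric_involution B U" "a \<in> B" "c \<in> B"
  shows "(\<Sum>b\<in>B. U a b * U b c) = of_bool (a = c)"
  using bspec[OF bspec[OF conjunct2[OF assms(1)[unfolded symmetric_involution_def]] assms(2)] assms(3)] .

lemma sum_of_bool_eq_mult:
  fixes f :: "'b \<Rightarrow> real"
  assumes "finite B" "a \<in> B"
  shows "(\<Sum>b\<in>B. of_bool (a = b) * f b) = f a"
proof -
  have "(\<Sum>b\<in>B. of_bool (a = b) * f b) = (\<Sum>b\<in>B. if a = b then f b else 0)"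
    by (intro sum.cong) auto
  then show ?thesis using assms by simp
qed

lemma symmetric_involution_id:
  assumes "finite B"
  shows "symmetric_involution B (\<lambda>a b. of_bool (a = b))"
  using assms by (intro symmetric_involutionI) (auto simp: sum_of_bool_eq_mult)

lemma symmetric_involution_hadamard: "symmetric_involution (cube n) (hadamard n)"
proof (rule symmetric_involutionI)
  fix a c assume *: "a \<in> cube n" "c \<in> cube n"
  then have "(\<Sum>b\<in>cube n. hadamard n a b * hadamard n b c) =
      (\<Sum>b\<in>cube n. hadamard n a b * hadamard n c b)"
    by (intro sum.cong refl) (simp add: hadamard_commute)
  then show "(\<Sum>b\<in>cube n. hadamard n a b * hadamard n b c) = of_bool (a = c)"
    using sum_hadamard_hadamard[OF *] by simp
qed (rule hadamard_commute)

lemma symmetric_involution_twice: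
  assumes "finite B" "symmetric_involution B U" "a \<in> B"
  shows "(\<Sum>b\<in>B. U a b * (\<Sum>c\<in>B. U b c * \<phi> c)) = \<phi> a"
proof -
  have "(\<Sum>b\<in>B. U a b * (\<Sum>c\<in>B. U b c * \<phi> c)) = (\<Sum>b\<in>B. \<Sum>c\<in>B. U a b * U b c * \<phi> c)"
    by (simp add: sum_distrib_left mult.assoc)
  also have "\<dots> = (\<Sum>c\<in>B. (\<Sum>b\<in>B. U a b * U b c) * \<phi> c)"
    by (subst sum.swap) (simp add: sum_distrib_right)
  also have "\<dots> = (\<Sum>c\<in>B. of_bool (a = c) * \<phi> c)"
    by (intro sum.cong refl) (simp add: symmetric_involution_mult[OF assms(2,3)])
  also have "\<dots> = \<phi> a"
    using assms by (simp add: sum_of_bool_eq_mult)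
  finally show ?thesis .
qed

lemma symmetric_involution_norm:
  assumes "finite B" "symmetric_involution B U"
  shows "(\<Sum>a\<in>B. (\<Sum>b\<in>B. U a b * \<phi> b)\<^sup>2) = (\<Sum>a\<in>B. (\<phi> a)\<^sup>2)"
proof -
  have "(\<Sum>a\<in>B. (\<Sum>b\<in>B. U a b * \<phi> b)\<^sup>2) = (\<Sum>a\<in>B. \<Sum>b\<in>B. U a b * \<phi> b * (\<Sum>c\<in>B. U a c * \<phi> c))"
    by (simp add: power2_eq_square sum_distrib_right)
  also have "\<dots> = (\<Sum>b\<in>B. \<Sum>a\<in>B. U a b * \<phi> b * (\<Sum>c\<in>B. U a c * \<phi> c))"
    by (rule sum.swap)
  also have "\<dots> = (\<Sum>b\<in>B. \<phi> b * (\<Sum>a\<in>B. U b a * (\<Sum>c\<in>B. U a c * \<phi> c)))"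
    unfolding sum_distrib_left[of "\<phi> _"]
    by (intro sum.cong refl) (simp add: symmetric_involution_commute[OF assms(2)] mult_ac)
  also have "\<dots> = (\<Sum>a\<in>B. (\<phi> a)\<^sup>2)"
    by (intro sum.cong refl) (simp add: symmetric_involution_twice[OF assms] power2_eq_square)
  finally show ?thesis .
qed

lemma symmetric_involution_tensor:
  assumes "symmetric_involution B U" "symmetric_involution C V"
  shows "symmetric_involution (B \<times> C) (\<lambda>(b, c) (b', c'). U b b' * V c c')"
proof (rule symmetric_involutionI; safe)
  fix b c b' c' assume *: "b \<in> B" "c \<in> C" "b' \<in> B" "c' \<in> C"
  show "U b b' * V c c' = U b' b * V c' c"
    using symmetric_involution_commute[OF assms(1) *(1,3)] symmetric_involution_commute[OF assms(2) *(2,4)]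
    by simp
  have "(\<Sum>x\<in>B \<times> C. (case x of (e, f) \<Rightarrow> U b e * V c f) * (case x of (e, f) \<Rightarrow> \<lambda>(b', c'). U e b' * V f c') (b', c')) =
      (\<Sum>e\<in>B. \<Sum>f\<in>C. (U b e * U e b') * (V c f * V f c'))"
    by (simp add: sum.cartesian_product case_prod_unfold mult_ac)
  also have "\<dots> = (\<Sum>e\<in>B. U b e * U e b') * (\<Sum>f\<in>C. V c f * V f c')"
    by (simp add: sum_product)
  finally show "(\<Sum>x\<in>B \<times> C. (case x of (e, f) \<Rightarrow> U b e * V c f) * (case x of (e, f) \<Rightarrow> \<lambda>(b', c'). U e b' * V f c') (b', c')) =
      of_bool ((b, c) = (b', c'))"
    using * by (simp add: symmetric_involution_mult[OF assms(1)] symmetric_involution_mult[OF assms(2)])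
qed

lemma sum_cartesian_of_bool:
  fixes F :: "'a \<Rightarrow> 'b \<Rightarrow> real"
  assumes "finite B" "b \<in> B"
  shows "(\<Sum>x\<in>B. \<Sum>c\<in>C. of_bool (b = x) * F x c) = (\<Sum>c\<in>C. F b c)"
proof -
  have "(\<Sum>x\<in>B. \<Sum>c\<in>C. of_bool (b = x) * F x c) = (\<Sum>x\<in>B. if b = x then \<Sum>c\<in>C. F x c else 0)"
    by (intro sum.cong) auto
  then show ?thesis using assms by simp
qed

text \<open>A controlled operation: the first register stays fixed and selects the involution
  applied to the second.\<close>

lemma symmetric_involution_block:
  assumes "finite B" "\<And>b. b \<in> B \<Longrightarrow> symmetric_involution C (V b)"
  shows "symmetric_involution (B \<times> C) (\<lambda>(b, c) (b', c'). of_bool (b = b') * V b c c')"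
proof (rule symmetric_involutionI; safe)
  fix b c b' c' assume *: "b \<in> B" "c \<in> C" "b' \<in> B" "c' \<in> C"
  show "of_bool (b = b') * V b c c' = of_bool (b' = b) * V b' c' c"
    using symmetric_involution_commute[OF assms(2)[OF *(1)] *(2,4)] by auto
  have "(\<Sum>x\<in>B \<times> C. (case x of (e, f) \<Rightarrow> of_bool (b = e) * V b c f) *
        (case x of (e, f) \<Rightarrow> \<lambda>(b', c'). of_bool (e = b') * V e f c') (b', c')) =
      (\<Sum>e\<in>B. \<Sum>f\<in>C. of_bool (b = e) * (of_bool (e = b') * (V b c f * V e f c')))"
    by (simp add: sum.cartesian_product case_prod_unfold mult_ac)
  also have "\<dots> = (\<Sum>f\<in>C. of_bool (b = b') * (V b c f * V b f c'))"
    by (rule sum_cartesian_of_bool) fact+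
  also have "\<dots> = of_bool (b = b') * of_bool (c = c')"
    unfolding sum_distrib_left[symmetric]
    using symmetric_involution_mult[OF assms(2)[OF *(1)] *(2,4)] by auto
  finally show "(\<Sum>x\<in>B \<times> C. (case x of (e, f) \<Rightarrow> of_bool (b = e) * V b c f) *
        (case x of (e, f) \<Rightarrow> \<lambda>(b', c'). of_bool (e = b') * V e f c') (b', c')) = of_bool ((b, c) = (b', c'))"
    by auto
qed

text \<open>The evolution of \<open>qstate\<close> for real amplitudes over an arbitrary finite
  basis, so that the algorithms can be built without matrix indices. The initial state is the basis
  vector \<open>b0\<close>, whence the column \<open>U 0 a b0\<close>.\<close>

primrec kernel_state ::
    "'b set \<Rightarrow> ('b \<Rightarrow> 'q option) \<Rightarrow> (nat \<Rightarrow> 'b \<Rightarrow> 'b \<Rightarrow> real) \<Rightarrow> 'b \<Rightarrow> ('q \<Rightarrow> real) \<Rightarrow> nat \<Rightarrow> 'b \<Rightarrow> real" where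
  "kernel_state B l U b0 h 0 = (\<lambda>a. U 0 a b0)"
| "kernel_state B l U b0 h (Suc t) =
     (\<lambda>a. \<Sum>b\<in>B. U (Suc t) a b * ((case l b of None \<Rightarrow> 1 | Some p \<Rightarrow> h p) * kernel_state B l U b0 h t b))"

text \<open>A quantum algorithm starts in basis state 0, so the enumeration has to send 0 to the
  chosen start; a transposition corrects an arbitrary enumeration.\<close>

lemma ex_bij_betw_nat_finite_zero:
  assumes "finite B" "b0 \<in> B"
  obtains e where "bij_betw e {..<card B} B" "e 0 = b0"
proof -
  obtain e where e: "bij_betw e {0..<card B} B"
    using ex_bij_betw_nat_finite[OF assms(1)] by blast
  obtain i where i: "i < card B" "e i = b0"
    using e assms(2) by (force simp: bij_betw_def)
  have pos: "0 < card B" using i by linarith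
  have "bij_betw (Transposition.transpose 0 i) {0..<card B} {0..<card B}"
    using pos i(1)
    by (intro bij_betw_byWitness[where f' = "Transposition.transpose 0 i"]) (auto simp: Transposition.transpose_def)
  then have "bij_betw (e \<circ> Transposition.transpose 0 i) {0..<card B} B"
    using e by (rule bij_betw_trans)
  with i that[of "e \<circ> Transposition.transpose 0 i"] show ?thesis
    by (simp add: atLeast0LessThan)
qed

lemma unitary_mat_of_symmetric_involution:
  assumes e: "bij_betw e {..<d} B" and U: "symmetric_involution B U"
  shows "unitary_mat d (mat d d (\<lambda>(i, j). complex_of_real (U (e i) (e j))))"
proof -
  let ?M = "mat d d (\<lambda>(i, j). complex_of_real (U (e i) (e j)))"
  have eB: "i < d \<Longrightarrow> e i \<in> B" for i
    using e by (auto simp: bij_betw_def)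
  have adj: "mat_adjoint ?M = ?M"
    by (rule eq_matI)
      (auto simp: mat_adjoint_def mat_of_rows_def symmetric_involution_commute[OF U] eB)
  have "?M * ?M = 1\<^sub>m d"
  proof (rule eq_matI)
    fix i j assume ij: "i < dim_row (1\<^sub>m d :: complex mat)" "j < dim_col (1\<^sub>m d :: complex mat)"
    then have "(?M * ?M) $$ (i, j) = complex_of_real (\<Sum>k<d. U (e i) (e k) * U (e k) (e j))"
      by (simp add: scalar_prod_def atLeast0LessThan)
    also have "(\<Sum>k<d. U (e i) (e k) * U (e k) (e j)) = (\<Sum>b\<in>B. U (e i) b * U b (e j))"
      by (rule sum.reindex_bij_betw[OF e])
    also have "\<dots> = of_bool (e i = e j)"
      using ij by (intro symmetric_involution_mult[OF U] eB) auto
    also have "(e i = e j) = (i = j)"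
      using e ij by (auto simp: bij_betw_def inj_on_def)
    finally show "(?M * ?M) $$ (i, j) = 1\<^sub>m d $$ (i, j)"
      using ij by (cases "i = j") simp_all
  qed auto
  with adj show ?thesis
    unfolding unitary_mat_def adj by simp
qed

text \<open>The only passage from kernels to complex matrices: amplitude estimation, the full read
  and the trivial tester are all obtained from it.\<close>

lemma ex_quantum_algorithm:
  assumes B: "finite B" "b0 \<in> B"
    and l: "\<And>b p. b \<in> B \<Longrightarrow> l b = Some p \<Longrightarrow> p \<in> positions n"
    and U: "\<And>t. t \<le> T \<Longrightarrow> symmetric_involution B (U t)"
  shows "\<exists>A. quantum_algorithm n T A \<and>
     (\<forall>h. quantum_accept_prob T A h = (\<Sum>b | b \<in> B \<and> P b. (kernel_state B l U b0 h T b)\<^sup>2))"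
proof -
  define d where "d = card B"
  obtain e where e: "bij_betw e {..<d} B" "e 0 = b0"
    using ex_bij_betw_nat_finite_zero[OF B] unfolding d_def by blast
  have d: "d > 0" using B by (auto simp: d_def card_gt_0_iff)
  have eB: "i < d \<Longrightarrow> e i \<in> B" for i
    using e by (auto simp: bij_betw_def)
  define A where "A = \<lparr>qdim = d, qlabel = l \<circ> e,
    qunitary = (\<lambda>t. mat d d (\<lambda>(i, j). complex_of_real (U t (e i) (e j)))), qaccept = {k. P (e k)}\<rparr>"
  have "quantum_algorithm n T A"
    using d l[OF eB] unitary_mat_of_symmetric_involution[OF e(1) U]
    by (auto simp: quantum_algorithm_def A_def)
  moreover have state: "qstate A h t = vec d (\<lambda>i. complex_of_real (kernel_state B l U b0 h t (e i)))" for h t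
  proof (induction t)
    case 0
    show ?case
      using d by (intro eq_vecI) (auto simp: A_def e(2))
  next
    case (Suc t)
    show ?case
    proof (rule eq_vecI)
      fix i assume "i < dim_vec (vec d (\<lambda>i. complex_of_real (kernel_state B l U b0 h (Suc t) (e i))))"
      then have i: "i < d" by simp
      have "qstate A h (Suc t) $ i =
          (\<Sum>j<d. complex_of_real (U (Suc t) (e i) (e j) *
            ((case l (e j) of None \<Rightarrow> 1 | Some p \<Rightarrow> h p) * kernel_state B l U b0 h t (e j))))"
        using i unfolding qstate.simps Suc.IH
        by (auto simp: A_def phase_query_def scalar_prod_def atLeast0LessThan intro!: sum.cong split: option.split)
      also have "\<dots> = complex_of_real (\<Sum>j<d. U (Suc t) (e i) (e j) *
            ((case l (e j) of None \<Rightarrow> 1 | Some p \<Rightarrow> h p) * kernel_state B l U b0 h t (e j)))"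
        by simp
      also have "\<dots> = complex_of_real (kernel_state B l U b0 h (Suc t) (e i))"
        unfolding kernel_state.simps by (subst sum.reindex_bij_betw[OF e(1)]) (rule refl)
      finally show "qstate A h (Suc t) $ i =
          vec d (\<lambda>i. complex_of_real (kernel_state B l U b0 h (Suc t) (e i))) $ i"
        using i by simp
    qed (simp add: A_def)
  qed
  moreover have "quantum_accept_prob T A h = (\<Sum>b | b \<in> B \<and> P b. (kernel_state B l U b0 h T b)\<^sup>2)" for h
  proof -
    have "bij_betw e {k. k < d \<and> P (e k)} {b. b \<in> B \<and> P b}"
      using e(1) by (auto simp: bij_betw_def inj_on_def)
    from sum.reindex_bij_betw[OF this, of "\<lambda>b. (kernel_state B l U b0 h T b)\<^sup>2"]
    show ?thesis
      unfolding quantum_accept_prob_def state by (simp add: A_def)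
  qed
  ultimately show ?thesis by blast
qed

section \<open>The discrete sine transform\<close>

text \<open>The Dirichlet kernel: multiplied by \<open>2 * sin (\<theta> / 2)\<close>, each cosine
  becomes a difference of consecutive sines at half-integer multiples of \<theta>.\<close>

lemma sum_cos_telescope:
  fixes \<theta> :: real
  shows "2 * sin (\<theta> / 2) * (\<Sum>j\<in>{1..<Suc M}. cos (real j * \<theta>)) = sin ((real M + 1 / 2) * \<theta>) - sin (\<theta> / 2)"
proof (induction M)
  case (Suc M)
  have "2 * sin (\<theta> / 2) * cos (real (Suc M) * \<theta>) =
      sin ((real (Suc M) + 1 / 2) * \<theta>) - sin ((real M + 1 / 2) * \<theta>)"
    using sin_diff[of "real (Suc M) * \<theta>" "\<theta> / 2"] sin_add[of "real (Suc M) * \<theta>" "\<theta> / 2"]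
    by (simp add: algebra_simps)
  with Suc show ?case
    by (simp add: algebra_simps)
qed simp

lemma sum_cos_multiple:
  assumes "0 < m" "m < 2 * M" "M > 0"
  shows "(\<Sum>j\<in>{1..<M}. cos (real j * (pi * real m / real M))) = - ((-1) ^ m + 1) / 2"
proof -
  define \<theta> where "\<theta> = pi * real m / real M"
  obtain L where L: "M = Suc L" using assms(3) by (cases M) auto
  have "0 < \<theta> / 2" "\<theta> / 2 < pi"
    using assms by (auto simp: \<theta>_def field_simps simp flip: of_nat_mult)
  then have pos: "sin (\<theta> / 2) > 0" by (rule sin_gt_zero)
  have "(real L + 1 / 2) * \<theta> = real m * pi - \<theta> / 2"
    using assms(3) by (simp add: \<theta>_def L field_simps)
  then have "2 * sin (\<theta> / 2) * (\<Sum>j\<in>{1..<M}. cos (real j * \<theta>)) = sin (real m * pi - \<theta> / 2) - sin (\<theta> / 2)"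
    using sum_cos_telescope[of \<theta> L] by (simp add: L)
  also have "\<dots> = sin (\<theta> / 2) * (- ((-1) ^ m + 1))"
    by (simp add: sin_diff algebra_simps)
  finally have "sin (\<theta> / 2) * (2 * (\<Sum>j\<in>{1..<M}. cos (real j * \<theta>))) = sin (\<theta> / 2) * (- ((-1) ^ m + 1))"
    by (simp only: mult_ac)
  then have "2 * (\<Sum>j\<in>{1..<M}. cos (real j * \<theta>)) = - ((-1) ^ m + 1)"
    using pos by (simp only: mult_cancel_left) simp
  then show ?thesis
    unfolding \<theta>_def[symmetric] by (simp add: field_simps)
qed

text \<open>The discrete sine transform of type I. Its columns are the eigenvectors of neighbour
  averaging on 1, ..., M - 1 with zero boundary values at 0 and M; the eigenvalues
  \<open>cos (pi * k / M)\<close> become the possible estimates of \<open>Phi\<close>.\<close>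

definition sine_kernel :: "nat \<Rightarrow> nat \<Rightarrow> nat \<Rightarrow> real" where
  "sine_kernel M j k = sqrt (2 / real M) * sin (pi * real j * real k / real M)"

lemma sum_sin_sin:
  assumes "k \<in> {1..<M}" "l \<in> {1..<M}" "k < l"
  shows "(\<Sum>j\<in>{1..<M}. sin (pi * real j * real k / real M) * sin (pi * real j * real l / real M)) = 0"
proof -
  have M: "M > 0" using assms by auto
  have "(\<Sum>j\<in>{1..<M}. sin (pi * real j * real k / real M) * sin (pi * real j * real l / real M)) =
      (\<Sum>j\<in>{1..<M}. (cos (real j * (pi * real (l - k) / real M)) - cos (real j * (pi * real (l + k) / real M))) / 2)"
  proof (intro sum.cong refl)
    fix j
    have "cos (real j * (pi * real (l - k) / real M)) =
        cos (pi * real j * real k / real M - pi * real j * real l / real M)"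
      using assms(3) by (subst cos_minus[symmetric]) (simp add: of_nat_diff algebra_simps diff_divide_distrib)
    moreover have "cos (real j * (pi * real (l + k) / real M)) =
        cos (pi * real j * real k / real M + pi * real j * real l / real M)"
      by (simp add: algebra_simps add_divide_distrib)
    ultimately show "sin (pi * real j * real k / real M) * sin (pi * real j * real l / real M) =
      (cos (real j * (pi * real (l - k) / real M)) - cos (real j * (pi * real (l + k) / real M))) / 2"
      by (simp only: sin_times_sin)
  qed
  also have "\<dots> = ((\<Sum>j\<in>{1..<M}. cos (real j * (pi * real (l - k) / real M))) -
      (\<Sum>j\<in>{1..<M}. cos (real j * (pi * real (l + k) / real M)))) / 2"
    by (simp add: sum_subtractf sum_divide_distrib[symmetric])
  also have "\<dots> = 0"
  proof -
    \<comment> \<open>The two cosine sums depend only on the parity of their frequency, and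
      \<open>l - k\<close> and \<open>l + k\<close> have the same parity.\<close>
    have "(-1) ^ (l - k) = ((-1) ^ (l + k) :: real)"
      using assms(3) by (subst (1 2) minus_one_power_iff) auto
    then show ?thesis
      using assms M by (subst (1 2) sum_cos_multiple) auto
  qed
  finally show ?thesis .
qed

lemma sum_sin_square:
  assumes "k \<in> {1..<M}"
  shows "(\<Sum>j\<in>{1..<M}. sin (pi * real j * real k / real M) * sin (pi * real j * real k / real M)) = real M / 2"
proof -
  have "(\<Sum>j\<in>{1..<M}. sin (pi * real j * real k / real M) * sin (pi * real j * real k / real M)) =
      (\<Sum>j\<in>{1..<M}. (1 - cos (real j * (pi * real (2 * k) / real M))) / 2)"
  proof (intro sum.cong refl)
    fix j
    have "real j * (pi * real (2 * k) / real M) = 2 * (pi * real j * real k / real M)" by simp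
    then show "sin (pi * real j * real k / real M) * sin (pi * real j * real k / real M) =
      (1 - cos (real j * (pi * real (2 * k) / real M))) / 2"
      by (simp only: cos_double_sin) (simp add: power2_eq_square)
  qed
  also have "\<dots> = (real (M - 1) - (\<Sum>j\<in>{1..<M}. cos (real j * (pi * real (2 * k) / real M)))) / 2"
    by (simp add: sum_subtractf sum_divide_distrib[symmetric])
  also have "\<dots> = real M / 2"
    using assms by (subst sum_cos_multiple) (auto simp: of_nat_diff)
  finally show ?thesis .
qed

lemma symmetric_involution_sine: "symmetric_involution {1..<M} (sine_kernel M)"
proof (rule symmetric_involutionI)
  fix k l assume *: "k \<in> {1..<M}" "l \<in> {1..<M}"
  show sym: "sine_kernel M k l = sine_kernel M l k" by (simp add: sine_kernel_def mult_ac)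
  have "(\<Sum>j\<in>{1..<M}. sine_kernel M k j * sine_kernel M j l) =
      (2 / real M) * (\<Sum>j\<in>{1..<M}. sin (pi * real j * real k / real M) * sin (pi * real j * real l / real M))"
    unfolding sum_distrib_left
  proof (intro sum.cong refl)
    fix j
    have "sine_kernel M k j * sine_kernel M j l = (sqrt (2 / real M) * sqrt (2 / real M)) *
        (sin (pi * real j * real k / real M) * sin (pi * real j * real l / real M))"
      unfolding sine_kernel_def by (simp only: mult_ac)
    also have "sqrt (2 / real M) * sqrt (2 / real M) = 2 / real M" by simp
    finally show "sine_kernel M k j * sine_kernel M j l =
      2 / real M * (sin (pi * real j * real k / real M) * sin (pi * real j * real l / real M))" .
  qed
  also have "\<dots> = of_bool (k = l)"
  proof (cases k l rule: linorder_cases)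
    case less
    then show ?thesis using sum_sin_sin[OF * less] by simp
  next
    case equal
    then show ?thesis using sum_sin_square[OF *(1)] * by simp
  next
    case greater
    then show ?thesis using sum_sin_sin[OF *(2,1) greater] by (subst sum.cong[OF refl mult.commute]) simp
  qed
  finally show "(\<Sum>j\<in>{1..<M}. sine_kernel M k j * sine_kernel M j l) = of_bool (k = l)" .
qed

lemma sine_kernel_0 [simp]: "sine_kernel M 0 k = 0" "sine_kernel M k 0 = 0"
  by (simp_all add: sine_kernel_def)

lemma sine_kernel_M:
  assumes "M > 0" shows "sine_kernel M k M = 0" "sine_kernel M M k = 0"
  using assms by (simp_all add: sine_kernel_def mult.commute[of pi])

lemma sine_kernel_cos:
  assumes "j > 0"
  shows "cos (pi * real k / real M) * sine_kernel M k j = (sine_kernel M k (j + 1) + sine_kernel M k (j - 1)) / 2"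
proof -
  have "pi * real k * real (j + 1) / real M = pi * real k * real j / real M + pi * real k / real M"
    "pi * real k * real (j - 1) / real M = pi * real k * real j / real M - pi * real k / real M"
    using assms by (simp_all add: of_nat_diff field_simps add_divide_distrib diff_divide_distrib)
  then show ?thesis
    unfolding sine_kernel_def by (simp only: sin_add sin_diff) (simp add: algebra_simps)
qed

lemma sum_shift_right:
  fixes s \<psi> :: "nat \<Rightarrow> real"
  assumes "s 0 = 0"
  shows "(\<Sum>j\<in>{1..<Suc m}. s j * \<psi> (j + 1)) = (\<Sum>j\<in>{1..<Suc m}. s (j - 1) * \<psi> j) + s m * \<psi> (Suc m)"
  by (induction m) (auto simp: assms)

text \<open>Summation by parts moves the neighbour average from the kernel to \<psi>; no boundary
  terms survive because both vanish at 0 and M.\<close>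

lemma sine_transform_cos:
  assumes "\<psi> 0 = 0" "\<psi> M = 0" "M > 0"
  shows "cos (pi * real k / real M) * (\<Sum>j\<in>{1..<M}. sine_kernel M k j * \<psi> j) =
    (\<Sum>j\<in>{1..<M}. sine_kernel M k j * ((\<psi> (j - 1) + \<psi> (j + 1)) / 2))"
proof -
  obtain m where m: "M = Suc m" using assms(3) by (cases M) auto
  have 1: "(\<Sum>j\<in>{1..<M}. sine_kernel M k j * \<psi> (j + 1)) = (\<Sum>j\<in>{1..<M}. sine_kernel M k (j - 1) * \<psi> j)"
    using sum_shift_right[of "sine_kernel M k" \<psi> m] assms by (simp add: m)
  have 2: "(\<Sum>j\<in>{1..<M}. \<psi> j * sine_kernel M k (j + 1)) = (\<Sum>j\<in>{1..<M}. \<psi> (j - 1) * sine_kernel M k j)"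
    using sum_shift_right[of \<psi> "sine_kernel M k" m] assms sine_kernel_M[OF assms(3), of k] by (simp add: m)
  have "cos (pi * real k / real M) * (\<Sum>j\<in>{1..<M}. sine_kernel M k j * \<psi> j) =
      (\<Sum>j\<in>{1..<M}. (cos (pi * real k / real M) * sine_kernel M k j) * \<psi> j)"
    by (simp add: sum_distrib_left mult.assoc)
  also have "\<dots> = (\<Sum>j\<in>{1..<M}. ((sine_kernel M k (j + 1) + sine_kernel M k (j - 1)) / 2) * \<psi> j)"
    by (intro sum.cong refl) (simp add: sine_kernel_cos)
  also have "\<dots> = ((\<Sum>j\<in>{1..<M}. \<psi> j * sine_kernel M k (j + 1)) + (\<Sum>j\<in>{1..<M}. sine_kernel M k (j - 1) * \<psi> j)) / 2"
    unfolding sum.distrib[symmetric] sum_divide_distrib by (intro sum.cong refl) (simp add: algebra_simps)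
  also have "\<dots> = ((\<Sum>j\<in>{1..<M}. \<psi> (j - 1) * sine_kernel M k j) + (\<Sum>j\<in>{1..<M}. sine_kernel M k j * \<psi> (j + 1))) / 2"
    by (simp only: 1 2)
  also have "\<dots> = (\<Sum>j\<in>{1..<M}. sine_kernel M k j * ((\<psi> (j - 1) + \<psi> (j + 1)) / 2))"
    unfolding sum.distrib[symmetric] sum_divide_distrib by (intro sum.cong refl) (simp add: algebra_simps)
  finally show ?thesis .
qed

text \<open>The transform is orthogonal and diagonalises neighbour averaging. Hence the second
  moment of the error of the measured estimate equals the residual of \<psi> as an approximate
  eigenvector for \<open>c\<close>, which can be computed before the transform.\<close>

lemma sine_transform_deviation:
  assumes "\<psi> 0 = 0" "\<psi> M = 0" "M > 0"
  shows "(\<Sum>k\<in>{1..<M}. (cos (pi * real k / real M) - c)\<^sup>2 * (\<Sum>j\<in>{1..<M}. sine_kernel M k j * \<psi> j)\<^sup>2) =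
    (\<Sum>j\<in>{1..<M}. ((\<psi> (j - 1) + \<psi> (j + 1)) / 2 - c * \<psi> j)\<^sup>2)"
proof -
  have "(cos (pi * real k / real M) - c) * (\<Sum>j\<in>{1..<M}. sine_kernel M k j * \<psi> j) =
      (\<Sum>j\<in>{1..<M}. sine_kernel M k j * ((\<psi> (j - 1) + \<psi> (j + 1)) / 2 - c * \<psi> j))" for k
    unfolding left_diff_distrib sine_transform_cos[OF assms]
    unfolding sum_distrib_left sum_subtractf[symmetric]
    by (intro sum.cong refl) (simp add: algebra_simps)
  then have "(cos (pi * real k / real M) - c)\<^sup>2 * (\<Sum>j\<in>{1..<M}. sine_kernel M k j * \<psi> j)\<^sup>2 =
      (\<Sum>j\<in>{1..<M}. sine_kernel M k j * ((\<psi> (j - 1) + \<psi> (j + 1)) / 2 - c * \<psi> j))\<^sup>2" for k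
    by (simp only: power_mult_distrib[symmetric])
  then show ?thesis
    by (simp only: symmetric_involution_norm[OF finite_atLeastLessThan symmetric_involution_sine])
qed

lemma sine_kernel_lipschitz:
  assumes "M > 0"
  shows "\<bar>sine_kernel M j k - sine_kernel M i k\<bar> \<le> sqrt (2 / real M) * (pi * real k / real M * \<bar>real j - real i\<bar>)"
proof -
  have sin_lipschitz: "\<bar>sin a - sin b\<bar> \<le> \<bar>a - b\<bar>" for a b :: real
  proof -
    have "\<bar>sin a - sin b\<bar> = 2 * \<bar>sin ((a - b) / 2)\<bar> * \<bar>cos ((a + b) / 2)\<bar>"
      by (simp add: sin_diff_sin abs_mult)
    also have "\<dots> \<le> 2 * \<bar>(a - b) / 2\<bar> * 1"
      by (intro mult_mono abs_sin_x_le_abs_x) auto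
    finally show ?thesis by simp
  qed
  have "\<bar>sine_kernel M j k - sine_kernel M i k\<bar> =
      sqrt (2 / real M) * \<bar>sin (pi * real j * real k / real M) - sin (pi * real i * real k / real M)\<bar>"
    by (simp add: sine_kernel_def right_diff_distrib[symmetric] abs_mult del: right_diff_distrib)
  also have "\<dots> \<le> sqrt (2 / real M) * \<bar>pi * real j * real k / real M - pi * real i * real k / real M\<bar>"
    by (intro mult_left_mono sin_lipschitz) auto
  also have "pi * real j * real k / real M - pi * real i * real k / real M = pi * real k / real M * (real j - real i)"
    by (simp add: algebra_simps diff_divide_distrib)
  finally show ?thesis by (simp add: abs_mult)
qed

section \<open>Amplitude estimation of Phi\<close>

text \<open>The reflection 2uu^T - 1 about the uniform unit vector u on the 2N positions, whose
  entries 2/(2N) simplify to 1/N. Between two queries it becomes the reflection about the normalised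
  truth table.\<close>

definition mean_reflection :: "nat \<Rightarrow> position \<Rightarrow> position \<Rightarrow> real" where
  "mean_reflection n p q = 1 / 2 ^ n - of_bool (p = q)"

text \<open>The Hadamard matrix as a symmetric bipartite coupling. Its quadratic form at the
  combined truth table is \<open>2 * 2 ^ n * Phi\<close>; the classical part reuses it as the
  interaction matrix of an Ising model.\<close>

fun hadamard_swap :: "nat \<Rightarrow> position \<Rightarrow> position \<Rightarrow> real" where
  "hadamard_swap n (Inl x) (Inr y) = hadamard n x y"
| "hadamard_swap n (Inr y) (Inl x) = hadamard n x y"
| "hadamard_swap n (Inl x) (Inl y) = 0"
| "hadamard_swap n (Inr x) (Inr y) = 0"

text \<open>The Hadamard transform on n + 1 bits, with \<open>Inl\<close> and \<open>Inr\<close> as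
  the values of the extra bit. Its column at \<open>Inl (replicate n False)\<close> is the uniform
  superposition on all positions.\<close>

fun hadamard_double :: "nat \<Rightarrow> position \<Rightarrow> position \<Rightarrow> real" where
  "hadamard_double n (Inl x) (Inl y) = hadamard n x y / sqrt 2"
| "hadamard_double n (Inl x) (Inr y) = hadamard n x y / sqrt 2"
| "hadamard_double n (Inr x) (Inl y) = hadamard n x y / sqrt 2"
| "hadamard_double n (Inr x) (Inr y) = - hadamard n x y / sqrt 2"

lemma positions_iff [simp]: "Inl x \<in> positions n \<longleftrightarrow> x \<in> cube n" "Inr x \<in> positions n \<longleftrightarrow> x \<in> cube n"
  by (auto simp: positions_def)

lemma positions_cases [consumes 1, case_names Inl Inr]:
  assumes "p \<in> positions n"
  obtains x where "p = Inl x" "x \<in> cube n" | y where "p = Inr y" "y \<in> cube n"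
  using assms by (auto simp: positions_def)

lemma symmetric_involution_mean_reflection: "symmetric_involution (positions n) (mean_reflection n)"
proof (rule symmetric_involutionI)
  fix p q assume *: "p \<in> positions n" "q \<in> positions n"
  show "mean_reflection n p q = mean_reflection n q p" by (auto simp: mean_reflection_def)
  have "(\<Sum>r\<in>positions n. mean_reflection n p r * mean_reflection n r q) =
      (\<Sum>r\<in>positions n. 1 / 2 ^ n * (1 / 2 ^ n) - of_bool (p = r) * (1 / 2 ^ n) - of_bool (q = r) * (1 / 2 ^ n)
         + of_bool (p = r) * of_bool (r = q))"
    by (intro sum.cong refl) (auto simp: mean_reflection_def algebra_simps)
  also have "\<dots> = of_bool (p = q)"
    unfolding sum.distrib sum_subtractf sum_of_bool_eq_mult[OF finite_positions *(1)]
      sum_of_bool_eq_mult[OF finite_positions *(2)]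
    by (auto simp: field_simps)
  finally show "(\<Sum>r\<in>positions n. mean_reflection n p r * mean_reflection n r q) = of_bool (p = q)" .
qed

lemma sum_hadamard_mult:
  "x \<in> cube n \<Longrightarrow> z \<in> cube n \<Longrightarrow> (\<Sum>y\<in>cube n. hadamard n x y * hadamard n y z) = of_bool (x = z)"
  by (rule symmetric_involution_mult[OF symmetric_involution_hadamard])

lemma symmetric_involution_hadamard_swap: "symmetric_involution (positions n) (hadamard_swap n)"
proof (rule symmetric_involutionI)
  fix p q assume *: "p \<in> positions n" "q \<in> positions n"
  show "hadamard_swap n p q = hadamard_swap n q p"
    using * by (auto elim!: positions_cases)
  show "(\<Sum>r\<in>positions n. hadamard_swap n p r * hadamard_swap n r q) = of_bool (p = q)"
    using * by (auto elim!: positions_cases simp: sum_positions sum_hadamard_hadamard sum_hadamard_hadamard'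
        split: if_splits)
qed

lemma symmetric_involution_hadamard_double: "symmetric_involution (positions n) (hadamard_double n)"
proof (rule symmetric_involutionI)
  fix p q assume *: "p \<in> positions n" "q \<in> positions n"
  show "hadamard_double n p q = hadamard_double n q p"
    using * by (auto elim!: positions_cases simp: hadamard_commute)
  have half: "x / sqrt 2 * (y / sqrt 2) = x * y / 2" for x y :: real
    by simp
  show "(\<Sum>r\<in>positions n. hadamard_double n p r * hadamard_double n r q) = of_bool (p = q)"
    using *
    by (auto elim!: positions_cases simp: sum_positions sum_hadamard_mult sum_negf
        simp flip: sum_divide_distrib)
qed

section \<open>The walk in the plane of the truth table and its transform\<close>

definition walk_step :: "nat \<Rightarrow> (position \<Rightarrow> real) \<Rightarrow> (position \<Rightarrow> real) \<Rightarrow> position \<Rightarrow> real" where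
  "walk_step n h \<phi> p = (\<Sum>q\<in>positions n. hadamard_swap n p q *
     (h q * (\<Sum>r\<in>positions n. mean_reflection n q r * (h r * \<phi> r))))"

text \<open>The start is the truth table as a unit vector, which a single query makes out of the
  uniform superposition; each step takes two more queries.\<close>

primrec walk :: "nat \<Rightarrow> (position \<Rightarrow> real) \<Rightarrow> nat \<Rightarrow> position \<Rightarrow> real" where
  "walk n h 0 = (\<lambda>p. h p / sqrt (2 * 2 ^ n))"
| "walk n h (Suc j) = walk_step n h (walk n h j)"

lemma sum_mean_reflection:
  assumes "q \<in> positions n"
  shows "(\<Sum>r\<in>positions n. mean_reflection n q r * \<phi> r) = (\<Sum>r\<in>positions n. \<phi> r) / 2 ^ n - \<phi> q"
proof -
  have "(\<Sum>r\<in>positions n. mean_reflection n q r * \<phi> r) =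
      (\<Sum>r\<in>positions n. \<phi> r / 2 ^ n - of_bool (q = r) * \<phi> r)"
    by (intro sum.cong) (auto simp: mean_reflection_def algebra_simps)
  then show ?thesis
    using assms by (simp add: sum_subtractf sum_divide_distrib sum_of_bool_eq_mult)
qed

lemma walk_step_norm:
  assumes "\<And>p. p \<in> positions n \<Longrightarrow> (h p)\<^sup>2 = 1"
  shows "(\<Sum>p\<in>positions n. (walk_step n h \<phi> p)\<^sup>2) = (\<Sum>p\<in>positions n. (\<phi> p)\<^sup>2)"
proof -
  have "(\<Sum>p\<in>positions n. (walk_step n h \<phi> p)\<^sup>2) =
      (\<Sum>q\<in>positions n. (h q * (\<Sum>r\<in>positions n. mean_reflection n q r * (h r * \<phi> r)))\<^sup>2)"
    unfolding walk_step_def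
    by (rule symmetric_involution_norm[OF finite_positions symmetric_involution_hadamard_swap])
  also have "\<dots> = (\<Sum>q\<in>positions n. (\<Sum>r\<in>positions n. mean_reflection n q r * (h r * \<phi> r))\<^sup>2)"
    by (intro sum.cong refl) (simp add: power_mult_distrib assms)
  also have "\<dots> = (\<Sum>r\<in>positions n. (h r * \<phi> r)\<^sup>2)"
    by (rule symmetric_involution_norm[OF finite_positions symmetric_involution_mean_reflection])
  also have "\<dots> = (\<Sum>p\<in>positions n. (\<phi> p)\<^sup>2)"
    by (intro sum.cong refl) (simp add: power_mult_distrib assms)
  finally show ?thesis .
qed

lemma walk_norm:
  assumes "\<And>p. p \<in> positions n \<Longrightarrow> (h p)\<^sup>2 = 1"
  shows "(\<Sum>p\<in>positions n. (walk n h j p)\<^sup>2) = 1"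
proof (induction j)
  case 0
  have "(\<Sum>p\<in>positions n. (h p / sqrt (2 * 2 ^ n))\<^sup>2) = (\<Sum>p\<in>positions n. 1 / (2 * 2 ^ n))"
    by (intro sum.cong refl) (simp add: power_divide assms)
  then show ?case by simp
qed (simp add: walk_step_norm[OF assms])

text \<open>The walk leaves the plane spanned by \<open>walk 0\<close> and \<open>walk 1\<close> invariant and rotates it by
  the angle with cosine \<open>Phi\<close>, whence the Chebyshev recurrence.\<close>

lemma walk_step_eq:
  assumes "q \<in> positions n"
  shows "walk_step n h \<phi> q = (\<Sum>r\<in>positions n. hadamard_swap n q r *
     (h r * ((\<Sum>p\<in>positions n. h p * \<phi> p) / 2 ^ n - h r * \<phi> r)))"
  unfolding walk_step_def by (intro sum.cong refl) (simp add: sum_mean_reflection)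

text \<open>The reflection about the truth table fixes the starting vector, so the first step
  reduces to \<open>hadamard_swap\<close>.\<close>

lemma walk_1:
  assumes h: "\<And>p. p \<in> positions n \<Longrightarrow> (h p)\<^sup>2 = 1" and "q \<in> positions n"
  shows "walk n h 1 q = (\<Sum>r\<in>positions n. hadamard_swap n q r * walk n h 0 r)"
proof -
  have hh: "h p * (h p * x) = x" if "p \<in> positions n" for p x
    using h[OF that] by (simp add: power2_eq_square flip: mult.assoc)
  have "(\<Sum>p\<in>positions n. h p * walk n h 0 p) = (\<Sum>p\<in>positions n. 1 / sqrt (2 * 2 ^ n))"
    by (intro sum.cong refl) (use h in \<open>simp add: power2_eq_square\<close>)
  then have "(\<Sum>p\<in>positions n. h p * walk n h 0 p) / 2 ^ n = 2 / sqrt (2 * 2 ^ n)"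
    by simp
  then show ?thesis
    using assms(2) h
    by (simp add: walk_step_eq) (intro sum.cong refl; simp add: power2_eq_square algebra_simps hh)
qed

text \<open>After normalising \<open>h\<close>, this says that \<open>Phi\<close> is the inner
  product of the first two walk vectors, that is, the cosine of the angle of rotation.\<close>

lemma walk_0_walk_1:
  assumes h: "\<And>p. p \<in> positions n \<Longrightarrow> (h p)\<^sup>2 = 1"
  shows "(\<Sum>p\<in>positions n. h p * walk n h 1 p) = sqrt (2 * 2 ^ n) * Phi n (h \<circ> Inl) (h \<circ> Inr)"
proof -
  have "(\<Sum>p\<in>positions n. h p * walk n h 1 p) =
      (\<Sum>p\<in>positions n. h p * (\<Sum>r\<in>positions n. hadamard_swap n p r * walk n h 0 r))"
    by (intro sum.cong refl) (simp only: walk_1[OF h])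
  also have "\<dots> = (\<Sum>p\<in>positions n. \<Sum>r\<in>positions n. h p * hadamard_swap n p r * h r) / sqrt (2 * 2 ^ n)"
    by (simp add: sum_distrib_left sum_divide_distrib mult.assoc)
  also have "(\<Sum>p\<in>positions n. \<Sum>r\<in>positions n. h p * hadamard_swap n p r * h r) =
      2 * (\<Sum>x\<in>cube n. \<Sum>y\<in>cube n. h (Inl x) * hadamard n x y * h (Inr y))"
  proof -
    have "(\<Sum>y\<in>cube n. \<Sum>x\<in>cube n. h (Inr y) * hadamard n x y * h (Inl x)) =
        (\<Sum>x\<in>cube n. \<Sum>y\<in>cube n. h (Inl x) * hadamard n x y * h (Inr y))"
      by (subst sum.swap) (simp add: mult_ac)
    then show ?thesis by (simp add: sum_positions)
  qed
  also have "\<dots> = 2 * 2 ^ n * Phi n (h \<circ> Inl) (h \<circ> Inr)"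
    by (simp add: Phi_hadamard)
  also have "\<dots> / sqrt (2 * 2 ^ n) = (2 * 2 ^ n / sqrt (2 * 2 ^ n)) * Phi n (h \<circ> Inl) (h \<circ> Inr)"
    by simp
  also have "2 * 2 ^ n / sqrt (2 * 2 ^ n) = sqrt (2 * 2 ^ n)"
    by (rule real_div_sqrt) simp
  finally show ?thesis .
qed

lemma walk_step_linear:
  "walk_step n h (\<lambda>p. a * \<phi> p + b * \<psi> p) q = a * walk_step n h \<phi> q + b * walk_step n h \<psi> q"
  unfolding walk_step_def by (simp add: algebra_simps sum.distrib sum_distrib_left)

lemma walk_step_cong:
  assumes "\<And>p. p \<in> positions n \<Longrightarrow> \<phi> p = \<psi> p"
  shows "walk_step n h \<phi> = walk_step n h \<psi>"
  unfolding walk_step_def using assms by (intro ext sum.cong refl) (auto intro!: sum.cong)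

text \<open>In the base case the reflection turns \<open>walk 1\<close> into
  \<open>2 * Phi * walk 0 - walk 1\<close>, and \<open>hadamard_swap\<close>, being an involution,
  exchanges \<open>walk 0\<close> and \<open>walk 1\<close>. The induction step applies the linear
  map \<open>walk_step\<close>.\<close>

lemma walk_recurrence:
  assumes h: "\<And>p. p \<in> positions n \<Longrightarrow> (h p)\<^sup>2 = 1" and "q \<in> positions n"
  shows "walk n h (Suc (Suc j)) q = 2 * Phi n (h \<circ> Inl) (h \<circ> Inr) * walk n h (Suc j) q - walk n h j q"
  using assms(2)
proof (induction j arbitrary: q)
  case 0
  let ?\<Phi> = "Phi n (h \<circ> Inl) (h \<circ> Inr)"
  have hh: "h p * (h p * x) = x" if "p \<in> positions n" for p x
    using h[OF that] by (simp add: power2_eq_square flip: mult.assoc)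
  have N: "sqrt (2 * 2 ^ n) / 2 ^ n = 2 / sqrt (2 * 2 ^ n)"
    by (simp add: field_simps)
  have "walk n h (Suc (Suc 0)) q = walk_step n h (walk n h 1) q" by simp
  also have "\<dots> = (\<Sum>r\<in>positions n. hadamard_swap n q r *
      (h r * (sqrt (2 * 2 ^ n) * ?\<Phi> / 2 ^ n - h r * walk n h 1 r)))"
    using 0 by (simp only: walk_step_eq walk_0_walk_1[OF h])
  also have "\<dots> = (\<Sum>r\<in>positions n. 2 * ?\<Phi> * (hadamard_swap n q r * walk n h 0 r) - hadamard_swap n q r * walk n h 1 r)"
  proof (intro sum.cong refl)
    fix r assume r: "r \<in> positions n"
    have "sqrt (2 * 2 ^ n) * ?\<Phi> / 2 ^ n = (sqrt (2 * 2 ^ n) / 2 ^ n) * ?\<Phi>" by simp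
    then have "h r * (sqrt (2 * 2 ^ n) * ?\<Phi> / 2 ^ n - h r * walk n h 1 r) =
        2 * ?\<Phi> * walk n h 0 r - walk n h 1 r"
      unfolding N right_diff_distrib hh[OF r] by simp
    then show "hadamard_swap n q r * (h r * (sqrt (2 * 2 ^ n) * ?\<Phi> / 2 ^ n - h r * walk n h 1 r)) =
      2 * ?\<Phi> * (hadamard_swap n q r * walk n h 0 r) - hadamard_swap n q r * walk n h 1 r"
      by (simp only:) (simp add: algebra_simps)
  qed
  also have "\<dots> = 2 * ?\<Phi> * (\<Sum>r\<in>positions n. hadamard_swap n q r * walk n h 0 r) -
      (\<Sum>r\<in>positions n. hadamard_swap n q r * (\<Sum>s\<in>positions n. hadamard_swap n r s * walk n h 0 s))"
    unfolding sum_subtractf sum_distrib_left[symmetric] using walk_1[OF h] by (simp cong: sum.cong)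
  also have "\<dots> = 2 * ?\<Phi> * walk n h 1 q - walk n h 0 q"
    using 0 by (simp only: walk_1[OF h] symmetric_involution_twice[OF finite_positions symmetric_involution_hadamard_swap])
  finally show ?case by (simp only: One_nat_def)
next
  case (Suc j)
  let ?\<Phi> = "Phi n (h \<circ> Inl) (h \<circ> Inr)"
  have "walk n h (Suc (Suc (Suc j))) q = walk_step n h (\<lambda>p. 2 * ?\<Phi> * walk n h (Suc j) p + (-1) * walk n h j p) q"
    using Suc.IH by (subst walk.simps(2)) (intro fun_cong[OF walk_step_cong], simp add: comp_def)
  then show ?case
    unfolding walk_step_linear by (simp add: comp_def)
qed

text \<open>Even times carry the reflections, odd times the swaps, and \<open>t div 2\<close> is the
  number of the step. Branch \<open>j\<close> idles after step \<open>j\<close>; at time 1 all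
  branches idle, because the first query only has to load the truth table.\<close>

definition estimation_block :: "nat \<Rightarrow> nat \<Rightarrow> nat \<Rightarrow> position \<Rightarrow> position \<Rightarrow> real" where
  "estimation_block n t j p q =
     (if 0 < t div 2 \<and> t div 2 \<le> j then if even t then mean_reflection n p q else hadamard_swap n p q
      else of_bool (p = q))"

text \<open>The counter starts in basis state 1, so the transform at time 0 puts the weight
  \<open>sine_kernel M j 1\<close> on the branch with \<open>j\<close> steps. The transform at time
  \<open>2 * M\<close> turns the counter into an estimate.\<close>

definition estimation_kernel :: "nat \<Rightarrow> nat \<Rightarrow> nat \<Rightarrow> nat \<times> position \<Rightarrow> nat \<times> position \<Rightarrow> real" where
  "estimation_kernel n M t =
     (if t = 0 then (\<lambda>(j, p) (k, q). sine_kernel M j k * hadamard_double n p q)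
      else if t = 2 * M then (\<lambda>(j, p) (k, q). sine_kernel M j k * of_bool (p = q))
      else (\<lambda>(j, p) (k, q). of_bool (j = k) * estimation_block n t j p q))"

definition estimation_state :: "nat \<Rightarrow> nat \<Rightarrow> (position \<Rightarrow> real) \<Rightarrow> nat \<Rightarrow> nat \<times> position \<Rightarrow> real" where
  "estimation_state n M = kernel_state ({1..<M} \<times> positions n) (\<lambda>(j, p). Some p)
     (estimation_kernel n M) (1, Inl (replicate n False))"

lemma symmetric_involution_estimation_block:
  "symmetric_involution (positions n) (estimation_block n t j)"
proof -
  consider "estimation_block n t j = mean_reflection n" | "estimation_block n t j = hadamard_swap n"
    | "estimation_block n t j = (\<lambda>p q. of_bool (p = q))"
    unfolding estimation_block_def[abs_def] by (cases "0 < t div 2 \<and> t div 2 \<le> j"; cases "even t") auto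
  then show ?thesis
    by cases (simp_all add: symmetric_involution_mean_reflection symmetric_involution_hadamard_swap
        symmetric_involution_id)
qed

lemma symmetric_involution_estimation_kernel:
  "symmetric_involution ({1..<M} \<times> positions n) (estimation_kernel n M t)"
  unfolding estimation_kernel_def
  by (simp only: split: if_split)
    (intro conjI impI symmetric_involution_tensor[OF symmetric_involution_sine symmetric_involution_hadamard_double]
      symmetric_involution_tensor[OF symmetric_involution_sine symmetric_involution_id[OF finite_positions]]
      symmetric_involution_block symmetric_involution_estimation_block finite_atLeastLessThan)

lemma estimation_state_block:
  assumes "0 < Suc t" "Suc t \<noteq> 2 * M" "j \<in> {1..<M}"
  shows "estimation_state n M h (Suc t) (j, p) =
    (\<Sum>q\<in>positions n. estimation_block n (Suc t) j p q * (h q * estimation_state n M h t (j, q)))"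
proof -
  have "estimation_state n M h (Suc t) (j, p) = (\<Sum>k\<in>{1..<M}. \<Sum>q\<in>positions n.
      of_bool (j = k) * (estimation_block n (Suc t) j p q * (h q * estimation_state n M h t (k, q))))"
    using assms(2)
    by (simp add: estimation_state_def estimation_kernel_def sum.cartesian_product case_prod_unfold mult_ac)
  also have "\<dots> = (\<Sum>q\<in>positions n. estimation_block n (Suc t) j p q * (h q * estimation_state n M h t (j, q)))"
    by (rule sum_cartesian_of_bool) (use assms in auto)
  finally show ?thesis .
qed

lemma estimation_state_walk:
  assumes h: "\<And>p. p \<in> positions n \<Longrightarrow> (h p)\<^sup>2 = 1" and M: "M > 1"
    and "t < M" "j \<in> {1..<M}" "p \<in> positions n"
  shows "estimation_state n M h (2 * t + 1) (j, p) = sine_kernel M j 1 * walk n h (min j t) p"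
  using assms(3-)
proof (induction t arbitrary: p)
  case 0
  have zero: "hadamard n x (replicate n False) = 1 / sqrt (2 ^ n)" if "x \<in> cube n" for x
    using hadamard_commute[OF that replicate_in_cube[of n False]] by (simp add: hadamard_def)
  have init: "estimation_state n M h 0 (j, q) = sine_kernel M j 1 / sqrt (2 * 2 ^ n)" if "q \<in> positions n" for q
    using that by (auto simp: estimation_state_def estimation_kernel_def zero real_sqrt_mult elim!: positions_cases)
  have "estimation_state n M h (2 * 0 + 1) (j, p) =
      (\<Sum>q\<in>positions n. of_bool (p = q) * (h q * estimation_state n M h 0 (j, q)))"
    using estimation_state_block[of 0 M j n h p] M 0 by (simp add: estimation_block_def)
  also have "\<dots> = h p * estimation_state n M h 0 (j, p)"
    using 0 by (simp add: sum_of_bool_eq_mult)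
  finally show ?case using init 0 by simp
next
  case (Suc t)
  have hh: "h p * (h p * x) = x" if "p \<in> positions n" for p x
    using h[OF that] by (simp add: power2_eq_square flip: mult.assoc)
  have IH: "estimation_state n M h (2 * t + 1) (j, q) = sine_kernel M j 1 * walk n h (min j t) q"
    if "q \<in> positions n" for q
    using Suc that by simp
  have 1: "estimation_state n M h (Suc (2 * t + 1)) (j, q) =
      (\<Sum>r\<in>positions n. estimation_block n (Suc (2 * t + 1)) j q r * (h r * (sine_kernel M j 1 * walk n h (min j t) r)))"
    if "q \<in> positions n" for q
    using estimation_state_block[of "2 * t + 1" M j n h q] Suc.prems IH by (simp cong: sum.cong)
  have 2: "estimation_state n M h (2 * Suc t + 1) (j, p) =
      (\<Sum>q\<in>positions n. estimation_block n (Suc (Suc (2 * t + 1))) j p q * (h q *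
        (\<Sum>r\<in>positions n. estimation_block n (Suc (2 * t + 1)) j q r * (h r * (sine_kernel M j 1 * walk n h (min j t) r)))))"
    using estimation_state_block[of "Suc (2 * t + 1)" M j n h p] Suc.prems 1 by (simp cong: sum.cong)
  have div: "Suc (2 * t + 1) div 2 = Suc t" "Suc (Suc (2 * t + 1)) div 2 = Suc t"
    "even (Suc (2 * t + 1))" "odd (Suc (Suc (2 * t + 1)))" by presburger+
  show ?case
  proof (cases "Suc t \<le> j")
    case True
    then have "estimation_block n (Suc (Suc (2 * t + 1))) j = hadamard_swap n"
      "estimation_block n (Suc (2 * t + 1)) j = mean_reflection n"
      unfolding estimation_block_def[abs_def] div using div by auto
    then have "estimation_state n M h (2 * Suc t + 1) (j, p) = walk_step n h (\<lambda>r. sine_kernel M j 1 * walk n h (min j t) r + 0 * 0) p"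
      unfolding 2 walk_step_def by simp
    also have "\<dots> = sine_kernel M j 1 * walk_step n h (walk n h (min j t)) p"
      by (subst walk_step_linear) simp
    finally show ?thesis using True by (simp add: min_def)
  next
    \<comment> \<open>An idle branch is still queried, but the two queries of a step then meet with
      nothing between them and cancel, since the values square to 1.\<close>
    case False
    then have "estimation_block n (Suc (Suc (2 * t + 1))) j = (\<lambda>p q. of_bool (p = q))"
      "estimation_block n (Suc (2 * t + 1)) j = (\<lambda>p q. of_bool (p = q))"
      unfolding estimation_block_def[abs_def] div by auto
    then have "estimation_state n M h (2 * Suc t + 1) (j, p) = sine_kernel M j 1 * walk n h (min j t) p"
      unfolding 2 using Suc.prems by (simp add: sum_of_bool_eq_mult hh cong: sum.cong)
    with False show ?thesis by (simp add: min_def)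
  qed
qed

text \<open>The query before the last transform has no partner and leaves the factor
  \<open>h p\<close>, which disappears in the square. By then every branch \<open>j < M\<close> has
  completed its \<open>j\<close> steps.\<close>

lemma estimation_state_final:
  assumes h: "\<And>p. p \<in> positions n \<Longrightarrow> (h p)\<^sup>2 = 1" and M: "M > 1"
    and "k \<in> {1..<M}" "p \<in> positions n"
  shows "(estimation_state n M h (2 * M) (k, p))\<^sup>2 =
    (\<Sum>j\<in>{1..<M}. sine_kernel M k j * (sine_kernel M j 1 * walk n h j p))\<^sup>2"
proof -
  obtain L where L: "M = Suc L" using M by (cases M) auto
  have "estimation_state n M h (2 * M) (k, p) = (\<Sum>j\<in>{1..<M}. \<Sum>q\<in>positions n.
      sine_kernel M k j * (of_bool (p = q) * (h q * estimation_state n M h (2 * L + 1) (j, q))))"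
  proof -
    have "estimation_state n M h (Suc t) (k, p) = (\<Sum>j\<in>{1..<M}. \<Sum>q\<in>positions n.
        sine_kernel M k j * (of_bool (p = q) * (h q * estimation_state n M h t (j, q))))"
      if "Suc t = 2 * M" for t
    proof -
      have "estimation_kernel n M (Suc t) = (\<lambda>(j, p) (k, q). sine_kernel M j k * of_bool (p = q))"
        using that M by (simp add: estimation_kernel_def)
      then show ?thesis
        unfolding estimation_state_def kernel_state.simps
        by (simp add: sum.cartesian_product case_prod_unfold mult_ac)
    qed
    from this[of "2 * L + 1"] L show ?thesis by simp
  qed
  also have "\<dots> = (\<Sum>j\<in>{1..<M}. sine_kernel M k j * (h p * estimation_state n M h (2 * L + 1) (j, p)))"
    using assms(4) by (simp add: sum_of_bool_eq_mult sum_distrib_left[symmetric])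
  also have "\<dots> = h p * (\<Sum>j\<in>{1..<M}. sine_kernel M k j * (sine_kernel M j 1 * walk n h j p))"
    unfolding sum_distrib_left
  proof (intro sum.cong refl)
    fix j assume j: "j \<in> {1..<M}"
    have "estimation_state n M h (2 * L + 1) (j, p) = sine_kernel M j 1 * walk n h (min j L) p"
      using j L assms by (intro estimation_state_walk) auto
    moreover have "min j L = j" using j L by auto
    ultimately show "sine_kernel M k j * (h p * estimation_state n M h (2 * L + 1) (j, p)) =
      h p * (sine_kernel M k j * (sine_kernel M j 1 * walk n h j p))" by simp
  qed
  finally show ?thesis using h[OF assms(4)] by (simp add: power_mult_distrib)
qed

text \<open>The Chebyshev recurrence cancels the main terms, and the residual contains only
  differences of weights at distance at most two. The slowly varying sine weights make these of
  order M to the power -3/2, whereas uniform weights would jump at the ends.\<close>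

lemma estimation_step_deviation:
  assumes h: "\<And>p. p \<in> positions n \<Longrightarrow> (h p)\<^sup>2 = 1" and j: "j \<in> {1..<M}"
    and \<Phi>: "\<Phi> = Phi n (h \<circ> Inl) (h \<circ> Inr)" "\<bar>\<Phi>\<bar> \<le> 1"
  shows "(\<Sum>p\<in>positions n. ((sine_kernel M (j - 1) 1 * walk n h (j - 1) p + sine_kernel M (j + 1) 1 * walk n h (j + 1) p) / 2
     - \<Phi> * (sine_kernel M j 1 * walk n h j p))\<^sup>2) \<le> 80 / real M ^ 3"
proof -
  have M: "M > 0" using j by auto
  obtain i where i: "j = Suc i" using j by (cases j) auto
  define \<alpha> where "\<alpha> = (sine_kernel M (j - 1) 1 - sine_kernel M (j + 1) 1) / 2"
  define \<beta> where "\<beta> = (sine_kernel M (j + 1) 1 - sine_kernel M j 1) * \<Phi>"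
  \<comment> \<open>A bound for the change of the weight in one step; \<alpha> spans two steps but
    is halved. The constant 80 is four times the bound 20 for \<open>2 * pi\<^sup>2\<close>.\<close>
  define B where "B = sqrt (2 / real M) * (pi / real M)"
  have B: "B\<^sup>2 \<le> 20 / real M ^ 3"
  proof -
    have "pi\<^sup>2 \<le> 3.15\<^sup>2" using pi_approx by (intro power_mono) auto
    then have "2 * pi\<^sup>2 \<le> 20" by (simp add: power2_eq_square)
    then have "2 * pi\<^sup>2 / real M ^ 3 \<le> 20 / real M ^ 3" by (intro divide_right_mono) auto
    moreover have "B\<^sup>2 = 2 * pi\<^sup>2 / real M ^ 3"
      using M by (simp add: B_def power_mult_distrib power_divide) (simp add: power2_eq_square power3_eq_cube)
    ultimately show ?thesis by simp
  qed
  have "\<bar>\<alpha>\<bar> \<le> B"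
    using sine_kernel_lipschitz[OF M, of "j - 1" 1 "j + 1"] by (simp add: \<alpha>_def B_def i)
  then have "\<alpha>\<^sup>2 \<le> B\<^sup>2" by (rule abs_le_square_iff[THEN iffD1, OF order_trans[OF _ abs_ge_self]])
  moreover have "\<bar>\<beta>\<bar> \<le> B"
  proof -
    have "\<bar>sine_kernel M (j + 1) 1 - sine_kernel M j 1\<bar> * \<bar>\<Phi>\<bar> \<le> B * 1"
      using sine_kernel_lipschitz[OF M, of "j + 1" 1 j] \<Phi>(2) by (intro mult_mono) (auto simp: B_def)
    then show ?thesis by (simp add: \<beta>_def abs_mult)
  qed
  then have "\<beta>\<^sup>2 \<le> B\<^sup>2" by (rule abs_le_square_iff[THEN iffD1, OF order_trans[OF _ abs_ge_self]])
  ultimately have \<alpha>\<beta>: "2 * \<alpha>\<^sup>2 + 2 * \<beta>\<^sup>2 \<le> 80 / real M ^ 3" using B by linarith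
  have "(\<Sum>p\<in>positions n. ((sine_kernel M (j - 1) 1 * walk n h (j - 1) p + sine_kernel M (j + 1) 1 * walk n h (j + 1) p) / 2
     - \<Phi> * (sine_kernel M j 1 * walk n h j p))\<^sup>2) \<le>
     (\<Sum>p\<in>positions n. 2 * \<alpha>\<^sup>2 * (walk n h (j - 1) p)\<^sup>2 + 2 * \<beta>\<^sup>2 * (walk n h j p)\<^sup>2)"
  proof (rule sum_mono)
    fix p assume p: "p \<in> positions n"
    have "walk n h (j + 1) p = 2 * \<Phi> * walk n h j p - walk n h (j - 1) p"
      using walk_recurrence[OF h p, where j = i] by (simp only: i \<Phi>(1)) (simp del: walk.simps)
    then have eq: "(sine_kernel M (j - 1) 1 * walk n h (j - 1) p + sine_kernel M (j + 1) 1 * walk n h (j + 1) p) / 2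
       - \<Phi> * (sine_kernel M j 1 * walk n h j p) = \<alpha> * walk n h (j - 1) p + \<beta> * walk n h j p"
      by (simp only: \<alpha>_def \<beta>_def) (simp add: field_simps del: walk.simps)
    have sq: "(x + y)\<^sup>2 \<le> 2 * x\<^sup>2 + 2 * y\<^sup>2" for x y :: real
      using zero_le_power2[of "x - y"] by (simp add: power2_eq_square algebra_simps)
    show "((sine_kernel M (j - 1) 1 * walk n h (j - 1) p + sine_kernel M (j + 1) 1 * walk n h (j + 1) p) / 2
       - \<Phi> * (sine_kernel M j 1 * walk n h j p))\<^sup>2 \<le> 2 * \<alpha>\<^sup>2 * (walk n h (j - 1) p)\<^sup>2 + 2 * \<beta>\<^sup>2 * (walk n h j p)\<^sup>2"
      unfolding eq using sq[of "\<alpha> * walk n h (j - 1) p" "\<beta> * walk n h j p"]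
      by (simp only: power_mult_distrib mult.assoc)
  qed
  also have "\<dots> = 2 * \<alpha>\<^sup>2 + 2 * \<beta>\<^sup>2"
    unfolding sum.distrib sum_distrib_left[symmetric] by (simp only: walk_norm[OF h])
  finally show ?thesis using \<alpha>\<beta> by simp
qed

lemma estimation_deviation:
  assumes h: "\<And>p. p \<in> positions n \<Longrightarrow> (h p)\<^sup>2 = 1" and M: "M > 1"
    and \<Phi>: "\<Phi> = Phi n (h \<circ> Inl) (h \<circ> Inr)" "\<bar>\<Phi>\<bar> \<le> 1"
  shows "(\<Sum>(k, p)\<in>{1..<M} \<times> positions n.
     (cos (pi * real k / real M) - \<Phi>)\<^sup>2 * (estimation_state n M h (2 * M) (k, p))\<^sup>2) \<le> 80 / (real M)\<^sup>2"
proof -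
  have M0: "M > 0" using M by simp
  have "(\<Sum>(k, p)\<in>{1..<M} \<times> positions n.
      (cos (pi * real k / real M) - \<Phi>)\<^sup>2 * (estimation_state n M h (2 * M) (k, p))\<^sup>2) =
      (\<Sum>k\<in>{1..<M}. \<Sum>p\<in>positions n. (cos (pi * real k / real M) - \<Phi>)\<^sup>2 *
         (\<Sum>j\<in>{1..<M}. sine_kernel M k j * (sine_kernel M j 1 * walk n h j p))\<^sup>2)"
    unfolding sum.cartesian_product[symmetric]
    by (intro sum.cong refl) (simp only: estimation_state_final[OF h M])
  also have "\<dots> = (\<Sum>p\<in>positions n. \<Sum>k\<in>{1..<M}. (cos (pi * real k / real M) - \<Phi>)\<^sup>2 *
         (\<Sum>j\<in>{1..<M}. sine_kernel M k j * (sine_kernel M j 1 * walk n h j p))\<^sup>2)"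
    by (rule sum.swap)
  \<comment> \<open>The boundary conditions of \<open>sine_transform_deviation\<close> hold because
    the weights \<open>sine_kernel M j 1\<close> vanish at \<open>j = 0\<close> and
    \<open>j = M\<close>.\<close>
  also have "\<dots> = (\<Sum>p\<in>positions n. \<Sum>j\<in>{1..<M}.
      ((sine_kernel M (j - 1) 1 * walk n h (j - 1) p + sine_kernel M (j + 1) 1 * walk n h (j + 1) p) / 2
        - \<Phi> * (sine_kernel M j 1 * walk n h j p))\<^sup>2)"
    by (intro sum.cong[OF refl] sine_transform_deviation M0) (simp_all add: sine_kernel_M[OF M0])
  also have "\<dots> = (\<Sum>j\<in>{1..<M}. \<Sum>p\<in>positions n.
      ((sine_kernel M (j - 1) 1 * walk n h (j - 1) p + sine_kernel M (j + 1) 1 * walk n h (j + 1) p) / 2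
        - \<Phi> * (sine_kernel M j 1 * walk n h j p))\<^sup>2)"
    by (rule sum.swap)
  also have "\<dots> \<le> (\<Sum>j\<in>{1..<M}. 80 / real M ^ 3)"
    by (intro sum_mono estimation_step_deviation h \<Phi>) auto
  also have "\<dots> \<le> real M * (80 / real M ^ 3)"
    using M by (simp add: divide_right_mono of_nat_diff)
  also have "\<dots> = 80 / (real M)\<^sup>2"
    using M by (simp add: power3_eq_cube power2_eq_square)
  finally show ?thesis .
qed

section \<open>Concentration of the measured estimate\<close>

lemma kernel_state_norm:
  assumes "finite B" "b0 \<in> B" "\<And>t. t \<le> T \<Longrightarrow> symmetric_involution B (U t)"
    and "\<And>b p. b \<in> B \<Longrightarrow> l b = Some p \<Longrightarrow> (h p)\<^sup>2 = 1" and "t \<le> T"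
  shows "(\<Sum>b\<in>B. (kernel_state B l U b0 h t b)\<^sup>2) = 1"
  using assms(5)
proof (induction t)
  case 0
  have U: "symmetric_involution B (U 0)" by (rule assms(3)) simp
  have "(\<Sum>b\<in>B. (kernel_state B l U b0 h 0 b)\<^sup>2) = (\<Sum>b\<in>B. U 0 b0 b * U 0 b b0)"
    using symmetric_involution_commute[OF U _ assms(2)] by (simp add: power2_eq_square)
  then show ?case using symmetric_involution_mult[OF U assms(2,2)] by simp
next
  case (Suc t)
  have U: "symmetric_involution B (U (Suc t))" using Suc.prems by (rule assms(3))
  have "(\<Sum>b\<in>B. (kernel_state B l U b0 h (Suc t) b)\<^sup>2) =
      (\<Sum>b\<in>B. ((case l b of None \<Rightarrow> 1 | Some p \<Rightarrow> h p) * kernel_state B l U b0 h t b)\<^sup>2)"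
    unfolding kernel_state.simps by (rule symmetric_involution_norm[OF assms(1) U])
  also have "\<dots> = (\<Sum>b\<in>B. (kernel_state B l U b0 h t b)\<^sup>2)"
    by (intro sum.cong refl) (auto simp: power_mult_distrib assms(4) split: option.split)
  finally show ?case using Suc by simp
qed

lemma weighted_Markov_square:
  fixes w d :: "'b \<Rightarrow> real"
  assumes "finite B" "S \<subseteq> B" "\<And>b. b \<in> B \<Longrightarrow> 0 \<le> w b" "\<And>b. b \<in> S \<Longrightarrow> \<delta> \<le> \<bar>d b\<bar>" "\<delta> > 0"
    and "(\<Sum>b\<in>B. (d b)\<^sup>2 * w b) \<le> V"
  shows "sum w S \<le> V / \<delta>\<^sup>2"
proof -
  have "\<delta>\<^sup>2 * sum w S = (\<Sum>b\<in>S. \<delta>\<^sup>2 * w b)" by (rule sum_distrib_left)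
  also have "\<dots> \<le> (\<Sum>b\<in>S. (d b)\<^sup>2 * w b)"
  proof (intro sum_mono mult_right_mono)
    fix b assume "b \<in> S"
    then show "\<delta>\<^sup>2 \<le> (d b)\<^sup>2" "0 \<le> w b"
      using assms(2,3,5) assms(4)[of b] by (auto simp flip: abs_le_square_iff)
  qed
  also have "\<dots> \<le> (\<Sum>b\<in>B. (d b)\<^sup>2 * w b)"
    using assms(1-3) by (intro sum_mono2) auto
  finally show ?thesis using assms(5,6) by (simp add: field_simps)
qed

lemma case_sum_boolean_functions:
  assumes "f \<in> boolean_functions n" "g \<in> boolean_functions n" "p \<in> positions n"
  shows "case_sum f g p = 1 \<or> case_sum f g p = -1" "(case_sum f g p)\<^sup>2 = 1"
proof -
  show "case_sum f g p = 1 \<or> case_sum f g p = -1"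
    using assms by (auto simp: boolean_functions_def PiE_def Pi_def elim!: positions_cases)
  then show "(case_sum f g p)\<^sup>2 = 1" by auto
qed

text \<open>Chebyshev's inequality for the measured estimate, whose second moment about
  \<open>Phi\<close> is at most \<open>80 / (real M)\<^sup>2\<close>. The algorithm depends on the
  threshold \<tau>, but neither on the pair nor on the gap \<delta>.\<close>

lemma quantum_Phi_threshold:
  assumes M: "M > 1"
  shows "\<exists>A. quantum_algorithm n (2 * M) A \<and>
    (\<forall>f\<in>boolean_functions n. \<forall>g\<in>boolean_functions n. \<forall>\<delta>>0.
       (Phi n f g \<le> \<tau> - \<delta> \<longrightarrow> 1 - 80 / (real M * \<delta>)\<^sup>2 \<le> quantum_accept_prob (2 * M) A (case_sum f g)) \<and>
       (\<tau> + \<delta> \<le> Phi n f g \<longrightarrow> quantum_accept_prob (2 * M) A (case_sum f g) \<le> 80 / (real M * \<delta>)\<^sup>2))"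
proof -
  let ?B = "{1..<M} \<times> positions n" and ?P = "\<lambda>(k, p). cos (pi * real k / real M) \<le> \<tau>"
  have b0: "(1, Inl (replicate n False)) \<in> ?B" using M by simp
  have "\<exists>A. quantum_algorithm n (2 * M) A \<and>
      (\<forall>h. quantum_accept_prob (2 * M) A h = (\<Sum>b | b \<in> ?B \<and> ?P b. (estimation_state n M h (2 * M) b)\<^sup>2))"
    unfolding estimation_state_def
    by (rule ex_quantum_algorithm[OF _ b0 _ symmetric_involution_estimation_kernel]) auto
  then obtain A where A: "quantum_algorithm n (2 * M) A"
      "\<And>h. quantum_accept_prob (2 * M) A h = (\<Sum>b | b \<in> ?B \<and> ?P b. (estimation_state n M h (2 * M) b)\<^sup>2)"
    by blast
  show ?thesis
  proof (rule exI[of _ A], intro conjI ballI allI impI A(1))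
    fix f g \<delta> assume fg: "f \<in> boolean_functions n" "g \<in> boolean_functions n" and \<delta>: "0 < (\<delta>::real)"
    let ?h = "case_sum f g" and ?w = "\<lambda>b. (estimation_state n M (case_sum f g) (2 * M) b)\<^sup>2"
    have h: "(?h p)\<^sup>2 = 1" if "p \<in> positions n" for p
      using case_sum_boolean_functions(2)[OF fg that] .
    have eq: "?h \<circ> Inl = f" "?h \<circ> Inr = g" by (simp_all add: comp_def)
    have dev: "(\<Sum>b\<in>?B. (cos (pi * real (fst b) / real M) - Phi n f g)\<^sup>2 * ?w b) \<le> 80 / (real M)\<^sup>2"
      using estimation_deviation[of n ?h M "Phi n f g"] h M abs_Phi_le_1[OF fg] by (simp add: eq case_prod_unfold)
    have total: "sum ?w ?B = 1"
      unfolding estimation_state_def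
      by (rule kernel_state_norm[OF _ b0, where T = "2 * M"])
        (use h in \<open>auto simp: symmetric_involution_estimation_kernel simp del: One_nat_def\<close>)
    have tail: "sum ?w S \<le> 80 / (real M * \<delta>)\<^sup>2"
      if "S \<subseteq> ?B" "\<And>b. b \<in> S \<Longrightarrow> \<delta> \<le> \<bar>cos (pi * real (fst b) / real M) - Phi n f g\<bar>" for S
      using weighted_Markov_square[OF _ that(1) _ that(2) \<delta> dev]
      by (simp add: power_mult_distrib)
    {
      assume Y: "Phi n f g \<le> \<tau> - \<delta>"
      have "sum ?w ?B = sum ?w {b. b \<in> ?B \<and> ?P b} + sum ?w {b. b \<in> ?B \<and> \<not> ?P b}"
        by (subst sum.union_disjoint[symmetric]) (auto intro!: sum.cong)
      moreover have "sum ?w {b. b \<in> ?B \<and> \<not> ?P b} \<le> 80 / (real M * \<delta>)\<^sup>2"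
        using Y by (intro tail) auto
      ultimately show "1 - 80 / (real M * \<delta>)\<^sup>2 \<le> quantum_accept_prob (2 * M) A ?h"
        using total A(2) by simp
    }
    {
      assume "\<tau> + \<delta> \<le> Phi n f g"
      then show "quantum_accept_prob (2 * M) A ?h \<le> 80 / (real M * \<delta>)\<^sup>2"
        unfolding A(2) by (intro tail) auto
    }
  qed
qed

section \<open>Far pairs have large Phi\<close>

text \<open>Removing a smallest element never lowers the mean, so elements can be discarded until
  \<open>k\<close> are left whose mean is still at least the overall one.\<close>

lemma ex_heavy_subset:
  fixes c :: "'a \<Rightarrow> real"
  assumes "finite A" "k \<le> card A"
  shows "\<exists>F\<subseteq>A. card F = k \<and> real k * sum c A \<le> real (card A) * sum c F"
proof -
  have "\<exists>F\<subseteq>A. card F = card A - i \<and> real (card A - i) * sum c A \<le> real (card A) * sum c F" if "i \<le> card A" for i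
    using that
  proof (induction i)
    case (Suc i)
    then obtain F where F: "F \<subseteq> A" "card F = card A - i" "real (card A - i) * sum c A \<le> real (card A) * sum c F"
      by auto
    have fin: "finite F" using F(1) assms(1) by (rule finite_subset)
    have ne: "F \<noteq> {}" using F Suc.prems by auto
    define a where "a = arg_min_on c F"
    have a: "a \<in> F" "\<And>b. b \<in> F \<Longrightarrow> c a \<le> c b"
      using arg_min_if_finite[OF fin ne, of c] by (auto simp: a_def not_less)
    define m where "m = card A - Suc i"
    have m: "card A - i = Suc m" using Suc.prems by (simp add: m_def)
    have "real (card F) * c a \<le> sum c F"
      using sum_bounded_below[of F "c a" c] a by simp
    then have "real m * sum c F \<le> real (Suc m) * sum c (F - {a})"
      using F(2) m fin a(1) by (simp add: sum_diff1 algebra_simps)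
    then have *: "real (card A) * (real m * sum c F) \<le> real (card A) * (real (Suc m) * sum c (F - {a}))"
      by (intro mult_left_mono) auto
    have "real m * (real (Suc m) * sum c A) \<le> real m * (real (card A) * sum c F)"
      using F(3) m by (intro mult_left_mono) auto
    then have "real (Suc m) * (real m * sum c A) \<le> real (card A) * (real m * sum c F)"
      by (simp only: mult_ac)
    also note *
    finally have "real (Suc m) * (real m * sum c A) \<le> real (Suc m) * (real (card A) * sum c (F - {a}))"
      by (simp only: mult_ac)
    then have "real m * sum c A \<le> real (card A) * sum c (F - {a})"
      by (rule mult_left_le_imp_le) simp
    moreover have "card (F - {a}) = m" using F(2) m a fin by simp
    ultimately show ?case using F(1) by (intro exI[of _ "F - {a}"]) (auto simp: m_def)
  qed auto
  from this[of "card A - k"] assms(2) show ?thesis by simp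
qed

lemma Far_pairs_Phi:
  assumes far: "(g1, g2) \<in> Far_pairs n \<epsilon>" and \<epsilon>: "1 < 2 * \<epsilon> * 2 ^ n" "\<epsilon> \<le> 1 / 2"
  shows "1 / 100 + \<epsilon> / 50 \<le> Phi n g1 g2"
proof -
  let ?N = "2 ^ n :: real"
  have bf: "g1 \<in> boolean_functions n" "g2 \<in> boolean_functions n"
    using far by (auto simp: Far_pairs_def)
  have dist: "\<epsilon> * 2 * ?N \<le> real (card {p \<in> positions n. case_sum g1 g2 p \<noteq> case_sum f1 f2 p})"
    if "(f1, f2) \<in> Yes_pairs n" for f1 f2
    using far that by (auto simp: Far_pairs_def)
  \<comment> \<open>The largest integer below \<open>2 * \<epsilon> * ?N\<close>: flipping so few
    values cannot lead from a far pair to \<open>Yes_pairs\<close>. As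
    \<open>2 * \<epsilon> * ?N\<close> exceeds 1, at least half of it is retained.\<close>
  define k where "k = nat \<lceil>2 * \<epsilon> * ?N\<rceil> - 1"
  have k: "real k < 2 * \<epsilon> * ?N" "\<epsilon> * ?N \<le> real k"
  proof -
    have "2 \<le> \<lceil>2 * \<epsilon> * ?N\<rceil>" using \<epsilon>(1) by linarith
    then have "int k = \<lceil>2 * \<epsilon> * ?N\<rceil> - 1" unfolding k_def by linarith
    then have "real_of_int (int k) = of_int \<lceil>2 * \<epsilon> * ?N\<rceil> - 1" by simp
    with \<open>2 \<le> \<lceil>2 * \<epsilon> * ?N\<rceil>\<close> have "real k = of_int \<lceil>2 * \<epsilon> * ?N\<rceil> - 1" "2 \<le> \<lceil>2 * \<epsilon> * ?N\<rceil>"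
      by simp_all
    then show "real k < 2 * \<epsilon> * ?N" "\<epsilon> * ?N \<le> real k"
      using \<epsilon>(1) by linarith+
  qed
  have "2 * \<epsilon> * ?N \<le> ?N" using \<epsilon>(2) by simp
  then have "real k \<le> ?N" using k(1) by linarith
  then have "real k \<le> real (2 ^ n)" by simp
  then have "k \<le> card (cube n)" by (simp only: of_nat_le_iff card_cube)
  define c where "c y = (\<Sum>x\<in>cube n. g1 x * hadamard n x y * g2 y)" for y
  obtain F where F: "F \<subseteq> cube n" "card F = k" "real k * sum c (cube n) \<le> ?N * sum c F"
    using ex_heavy_subset[OF finite_cube \<open>k \<le> card (cube n)\<close>, of c] by auto
  define g2' where "g2' y = (if y \<in> F then - g2 y else g2 y)" for y
  have bf': "g2' \<in> boolean_functions n"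
    using bf(2) F(1) by (auto simp: boolean_functions_def g2'_def PiE_def Pi_def extensional_def)
  have Phi_c: "Phi n g1 g2 = sum c (cube n) / ?N"
    unfolding Phi_hadamard c_def by (subst sum.swap) simp
  have "Phi n g1 g2' = (\<Sum>y\<in>cube n. c y - 2 * (if y \<in> F then c y else 0)) / ?N"
    unfolding Phi_hadamard c_def
    by (subst sum.swap) (auto intro!: sum.cong arg_cong2[where f = "(/)"] simp: g2'_def sum_negf)
  also have "\<dots> = Phi n g1 g2 - 2 * sum c F / ?N"
    using F(1) by (simp add: Phi_c sum_subtractf diff_divide_distrib sum_distrib_left[symmetric]
        sum.inter_restrict[symmetric] Int_absorb1)
  finally have Phi': "Phi n g1 g2' = Phi n g1 g2 - 2 * sum c F / ?N" .
  have "Phi n g1 g2' > 1 / 100"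
  proof (rule ccontr)
    assume "\<not> Phi n g1 g2' > 1 / 100"
    then have "(g1, g2') \<in> Yes_pairs n" using bf bf' by (simp add: Yes_pairs_def)
    from dist[OF this] have "\<epsilon> * 2 * ?N \<le> real (card {p \<in> positions n. case_sum g1 g2 p \<noteq> case_sum g1 g2' p})" .
    also have "\<dots> \<le> real (card (Inr ` F :: position set))"
      using F(1) finite_subset[OF F(1)] by (intro of_nat_mono card_mono) (auto simp: g2'_def elim!: positions_cases split: if_splits)
    also have "\<dots> = real k" using F(2) by (simp add: card_image)
    finally show False using k(1) by simp
  qed
  moreover have "Phi n g1 g2 > 1 / 100"
  proof (rule ccontr)
    assume "\<not> Phi n g1 g2 > 1 / 100"
    then have "(g1, g2) \<in> Yes_pairs n" using bf by (simp add: Yes_pairs_def)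
    from dist[OF this] show False using \<epsilon>(1) by simp
  qed
  \<comment> \<open>The flipped positions carry at least the fraction
    \<open>k / ?N \<ge> \<epsilon>\<close> of \<open>Phi\<close>, and a flip reverses a
    contribution. With \<open>Phi > 1 / 100\<close> the drop \<open>2 * \<epsilon> * Phi\<close> is
    at least \<epsilon>/50.\<close>
  moreover have "2 * \<epsilon> * Phi n g1 g2 \<le> 2 * sum c F / ?N"
  proof -
    have "\<epsilon> * ?N * sum c (cube n) \<le> real k * sum c (cube n)"
      using \<open>Phi n g1 g2 > 1 / 100\<close> k(2)
      by (intro mult_right_mono) (auto simp: Phi_c field_simps intro: less_imp_le order_trans[of 0 "?N / 100"])
    then have "\<epsilon> * ?N * sum c (cube n) \<le> ?N * sum c F" using F(3) by (rule order_trans)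
    then have "?N * (\<epsilon> * sum c (cube n)) \<le> ?N * sum c F" by (simp only: mult_ac)
    then have "\<epsilon> * sum c (cube n) \<le> sum c F" by (rule mult_left_le_imp_le) simp
    then show ?thesis by (simp add: Phi_c field_simps)
  qed
  moreover have "0 < \<epsilon> * (2 * ?N)" using \<epsilon>(1) by (simp add: mult_ac)
  then have "\<epsilon> > 0" by (rule zero_less_mult_pos2) simp
  then have "\<epsilon> * (1 / 100) \<le> \<epsilon> * Phi n g1 g2"
    using \<open>Phi n g1 g2 > 1 / 100\<close> by (intro mult_left_mono) auto
  ultimately show ?thesis using Phi' by simp
qed

section \<open>Reading the whole truth table\<close>

lemma symmetric_involution_permutation:
  assumes "finite C" "\<And>c. c \<in> C \<Longrightarrow> \<sigma> c \<in> C" "\<And>c. c \<in> C \<Longrightarrow> \<sigma> (\<sigma> c) = c"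
  shows "symmetric_involution C (\<lambda>a b. of_bool (\<sigma> a = b))"
proof (rule symmetric_involutionI)
  fix a b assume ab: "a \<in> C" "b \<in> C"
  then show "of_bool (\<sigma> a = b) = (of_bool (\<sigma> b = a) :: real)" using assms(3) by auto
  show "(\<Sum>c\<in>C. of_bool (\<sigma> a = c) * of_bool (\<sigma> c = b)) = (of_bool (a = b) :: real)"
    using ab assms by (simp add: sum_of_bool_eq_mult)
qed

text \<open>The Bernstein-Vazirani algorithm. Address 0 stands for no query and address
  \<open>k + 1\<close> for position \<open>e k\<close>; round \<open>k\<close> moves the address
  from 0 to \<open>k + 1\<close> if bit \<open>k\<close> of \<open>s\<close> is set, and moves it
  back after a query. A round thus takes two queries, one of them idle at address 0, and a further
  idle query precedes the last transform.\<close>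

definition read_kernel :: "nat \<Rightarrow> nat \<Rightarrow> bool list \<times> nat \<Rightarrow> bool list \<times> nat \<Rightarrow> real" where
  "read_kernel m t =
     (if t = 0 \<or> t = 2 * m + 1 then (\<lambda>(s, a) (s', a'). hadamard m s s' * of_bool (a = a'))
      else (\<lambda>(s, a) (s', a'). of_bool (s = s') *
        of_bool ((if s ! ((t - 1) div 2) then Transposition.transpose 0 (Suc ((t - 1) div 2)) a else a) = a')))"

lemma symmetric_involution_read_kernel:
  assumes "t \<le> 2 * m + 1"
  shows "symmetric_involution (cube m \<times> {..m}) (read_kernel m t)"
proof (cases "t = 0 \<or> t = 2 * m + 1")
  case True
  then show ?thesis
    unfolding read_kernel_def
    by (simp only: if_True)
      (intro symmetric_involution_tensor symmetric_involution_hadamard symmetric_involution_id finite_atMost)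
next
  case False
  then have "Suc ((t - 1) div 2) \<le> m" using assms by auto
  with False show ?thesis
    unfolding read_kernel_def
    by (simp only: if_False)
      (intro symmetric_involution_block symmetric_involution_permutation finite_cube finite_atMost;
        auto simp: Transposition.transpose_def)
qed

definition read_state ::
    "nat \<Rightarrow> (nat \<Rightarrow> position) \<Rightarrow> (position \<Rightarrow> real) \<Rightarrow> nat \<Rightarrow> bool list \<times> nat \<Rightarrow> real" where
  "read_state m e = kernel_state (cube m \<times> {..m}) (\<lambda>(s, a). if a = 0 then None else Some (e (a - 1)))
     (read_kernel m) (replicate m False, 0)"

lemma read_state_Suc:
  assumes "Suc t < 2 * m + 1" "s \<in> cube m" "a \<le> m"
  shows "read_state m e h (Suc t) (s, a) =
    (let b = (if s ! (t div 2) then Transposition.transpose 0 (Suc (t div 2)) a else a)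
     in (if b = 0 then 1 else h (e (b - 1))) * read_state m e h t (s, b))"
proof -
  define b where "b = (if s ! (t div 2) then Transposition.transpose 0 (Suc (t div 2)) a else a)"
  have "Suc (t div 2) \<le> m" using assms(1) by auto
  then have b: "b \<in> {..m}" using assms(3) by (auto simp: b_def Transposition.transpose_def)
  have k: "read_kernel m (Suc t) = (\<lambda>(s, a) (s', a'). of_bool (s = s') *
        of_bool ((if s ! (t div 2) then Transposition.transpose 0 (Suc (t div 2)) a else a) = a'))"
    unfolding read_kernel_def diff_Suc_1 using assms(1) by simp
  have "read_state m e h (Suc t) (s, a) = (\<Sum>s'\<in>cube m. \<Sum>a'\<in>{..m}. of_bool (s = s') *
      (of_bool (b = a') * ((if a' = 0 then 1 else h (e (a' - 1))) * read_state m e h t (s', a'))))"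
    unfolding read_state_def kernel_state.simps k sum.cartesian_product
    by (intro sum.cong refl) (auto simp: b_def)
  also have "\<dots> = (\<Sum>a'\<in>{..m}. of_bool (b = a') * ((if a' = 0 then 1 else h (e (a' - 1))) * read_state m e h t (s, a')))"
    by (rule sum_cartesian_of_bool) (use assms in auto)
  also have "\<dots> = (if b = 0 then 1 else h (e (b - 1))) * read_state m e h t (s, b)"
    by (rule sum_of_bool_eq_mult) (use b in auto)
  finally show ?thesis by (simp add: b_def Let_def)
qed

lemma read_state_even:
  assumes "i \<le> m" "s \<in> cube m" "a \<le> m"
  shows "read_state m e h (2 * i) (s, a) =
    of_bool (a = 0) * (\<Prod>k<i. if s ! k then h (e k) else 1) / sqrt (2 ^ m)"
  using assms(1,3)
proof (induction i arbitrary: a)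
  case 0
  have "hadamard m s (replicate m False) = 1 / sqrt (2 ^ m)"
    using hadamard_commute[OF assms(2) replicate_in_cube[of m False]] by (simp add: hadamard_def)
  then show ?case by (simp add: read_state_def read_kernel_def)
next
  case (Suc i)
  have [simp]: "Suc (i * 2) div 2 = i" by simp
  have IH: "read_state m e h (2 * i) (s, b) =
    of_bool (b = 0) * (\<Prod>k<i. if s ! k then h (e k) else 1) / sqrt (2 ^ m)" if "b \<le> m" for b
    using Suc that by simp
  have 1: "read_state m e h (Suc (2 * i)) (s, b) =
     (let c = (if s ! i then Transposition.transpose 0 (Suc i) b else b)
     in (if c = 0 then 1 else h (e (c - 1))) * read_state m e h (2 * i) (s, c))" if "b \<le> m" for b
    using read_state_Suc[of "2 * i" m s b e h] Suc.prems that assms(2) by simp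
  have 2: "read_state m e h (2 * Suc i) (s, a) =
     (let b = (if s ! i then Transposition.transpose 0 (Suc i) a else a)
     in (if b = 0 then 1 else h (e (b - 1))) * read_state m e h (Suc (2 * i)) (s, b))"
    using read_state_Suc[of "Suc (2 * i)" m s a e h] Suc.prems assms(2) by simp
  define b where "b = (if s ! i then Transposition.transpose 0 (Suc i) a else a)"
  have b: "b \<le> m" using Suc.prems by (auto simp: b_def Transposition.transpose_def)
  have "(if s ! i then Transposition.transpose 0 (Suc i) b else b) = a"
    by (simp add: b_def)
  then have "read_state m e h (2 * Suc i) (s, a) =
      (if b = 0 then 1 else h (e (b - 1))) * ((if a = 0 then 1 else h (e (a - 1))) * read_state m e h (2 * i) (s, a))"
    unfolding 2 b_def[symmetric] Let_def 1[OF b] by simp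
  also have "\<dots> = of_bool (a = 0) * (\<Prod>k<Suc i. if s ! k then h (e k) else 1) / sqrt (2 ^ m)"
    using IH[OF Suc.prems(2)] by (auto simp: b_def)
  finally show ?case .
qed

text \<open>The collected phases form the character of the bit vector of the table, and the Hadamard
  transform maps a character to its basis state. So the table is read with certainty, and the
  resulting acceptance probability is 0 or 1.\<close>

lemma read_state_final:
  assumes "\<And>k. k < m \<Longrightarrow> h (e k) = 1 \<or> h (e k) = -1" "s \<in> cube m" "a \<le> m"
  shows "read_state m e h (2 * m + 1) (s, a) = of_bool (a = 0 \<and> s = map (\<lambda>k. h (e k) = -1) [0..<m])"
proof -
  let ?d = "map (\<lambda>k. h (e k) = -1) [0..<m]"
  have d: "?d \<in> cube m" by (simp add: cube_def)
  have prod: "(\<Prod>k<m. if s' ! k then h (e k) else 1) = (-1) ^ dot s' ?d" if "s' \<in> cube m" for s'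
  proof -
    have "(\<Prod>k<m. if s' ! k then h (e k) else 1) = (\<Prod>k<m. (-1) ^ (of_bool (s' ! k) * of_bool (?d ! k)))"
      using assms(1) by (intro prod.cong refl) (auto split: if_splits)
    moreover have "length s' = m" using that by (simp add: cube_def)
    ultimately show ?thesis by (simp only: dot_def power_sum)
  qed
  have k: "read_kernel m (Suc (2 * m)) = (\<lambda>(s, a) (s', a'). hadamard m s s' * of_bool (a = a'))"
    by (simp add: read_kernel_def)
  have "read_state m e h (Suc (2 * m)) (s, a) = (\<Sum>s'\<in>cube m. \<Sum>a'\<in>{..m}.
      hadamard m s s' * (of_bool (a = a') * ((if a' = 0 then 1 else h (e (a' - 1))) * read_state m e h (2 * m) (s', a'))))"
    unfolding read_state_def kernel_state.simps k sum.cartesian_product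
    by (intro sum.cong refl) auto
  also have "\<dots> = (\<Sum>s'\<in>cube m. hadamard m s s' * (of_bool (a = 0) * hadamard m s' ?d))"
  proof (intro sum.cong refl)
    fix s' assume s': "s' \<in> cube m"
    have "(\<Sum>a'\<in>{..m}. of_bool (a = a') * ((if a' = 0 then 1 else h (e (a' - 1))) * read_state m e h (2 * m) (s', a'))) =
        (if a = 0 then 1 else h (e (a - 1))) * read_state m e h (2 * m) (s', a)"
      using assms(3) by (intro sum_of_bool_eq_mult) auto
    also have "\<dots> = of_bool (a = 0) * hadamard m s' ?d"
      using read_state_even[OF order_refl s' assms(3), of e h] prod[OF s'] by (simp add: hadamard_def)
    finally show "(\<Sum>a'\<in>{..m}.
      hadamard m s s' * (of_bool (a = a') * ((if a' = 0 then 1 else h (e (a' - 1))) * read_state m e h (2 * m) (s', a')))) =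
      hadamard m s s' * (of_bool (a = 0) * hadamard m s' ?d)"
      by (simp only: sum_distrib_left[symmetric])
  qed
  also have "\<dots> = of_bool (a = 0) * (\<Sum>s'\<in>cube m. hadamard m s s' * hadamard m s' ?d)"
    by (simp add: sum_distrib_left mult_ac)
  also have "\<dots> = of_bool (a = 0) * of_bool (s = ?d)"
    by (simp only: sum_hadamard_mult[OF assms(2) d])
  finally show ?thesis by (auto simp only: Suc_eq_plus1 of_bool_conj)
qed

lemma quantum_read_all:
  fixes S :: "(position \<Rightarrow> real) set"
  shows "\<exists>A. quantum_algorithm n (4 * 2 ^ n + 1) A \<and>
     (\<forall>h. (\<forall>p\<in>positions n. h p = 1 \<or> h p = -1) \<longrightarrow>
        quantum_accept_prob (4 * 2 ^ n + 1) A h = of_bool (\<exists>h'\<in>S. \<forall>p\<in>positions n. h p = -1 \<longleftrightarrow> h' p = -1))"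
proof -
  define m where "m = card (positions n)"
  obtain e where e: "bij_betw e {0..<m} (positions n)"
    using ex_bij_betw_nat_finite[OF finite_positions] unfolding m_def by blast
  have e': "e k \<in> positions n" if "k < m" for k using e that by (auto simp: bij_betw_def)
  let ?B = "cube m \<times> {..m}" and ?P = "\<lambda>(s, a). s \<in> (\<lambda>h'. map (\<lambda>k. h' (e k) = (-1::real)) [0..<m]) ` S"
  have "\<exists>A. quantum_algorithm n (2 * m + 1) A \<and>
      (\<forall>h. quantum_accept_prob (2 * m + 1) A h = (\<Sum>b | b \<in> ?B \<and> ?P b. (read_state m e h (2 * m + 1) b)\<^sup>2))"
    unfolding read_state_def
    by (rule ex_quantum_algorithm[OF _ _ _ symmetric_involution_read_kernel])
      (use e' in \<open>auto split: if_splits\<close>)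
  then obtain A where A: "quantum_algorithm n (2 * m + 1) A"
      "\<And>h. quantum_accept_prob (2 * m + 1) A h = (\<Sum>b | b \<in> ?B \<and> ?P b. (read_state m e h (2 * m + 1) b)\<^sup>2)"
    by blast
  have "quantum_accept_prob (2 * m + 1) A h = of_bool (\<exists>h'\<in>S. \<forall>p\<in>positions n. h p = -1 \<longleftrightarrow> h' p = -1)"
    if h: "\<forall>p\<in>positions n. h p = 1 \<or> h p = -1" for h
  proof -
    let ?d = "map (\<lambda>k. h (e k) = -1) [0..<m]"
    have "quantum_accept_prob (2 * m + 1) A h = (\<Sum>b | b \<in> ?B \<and> ?P b. if b = (?d, 0) then 1 else 0)"
      unfolding A(2)
    proof (intro sum.cong refl)
      fix b assume "b \<in> {b. b \<in> ?B \<and> ?P b}"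
      then obtain s a where b: "b = (s, a)" "s \<in> cube m" "a \<le> m" by auto
      have "read_state m e h (2 * m + 1) b = of_bool (a = 0 \<and> s = ?d)"
        unfolding b(1) using b h e' by (intro read_state_final) auto
      then show "(read_state m e h (2 * m + 1) b)\<^sup>2 = (if b = (?d, 0) then 1 else 0)"
        using b(1) by auto
    qed
    also have "\<dots> = of_bool (?P (?d, 0))"
    proof -
      have "finite {b. b \<in> ?B \<and> ?P b}" by (rule finite_subset[of _ ?B]) auto
      moreover have "?d \<in> cube m" by (simp add: cube_def)
      ultimately show ?thesis by (subst sum.delta) auto
    qed
    also have "?P (?d, 0) \<longleftrightarrow> (\<exists>h'\<in>S. \<forall>k<m. h (e k) = -1 \<longleftrightarrow> h' (e k) = -1)"
      by (auto simp: image_iff)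
    also have "\<dots> \<longleftrightarrow> (\<exists>h'\<in>S. \<forall>p\<in>e ` {0..<m}. h p = -1 \<longleftrightarrow> h' p = -1)"
      by (intro bex_cong refl) auto
    also have "e ` {0..<m} = positions n" using e by (simp add: bij_betw_def)
    finally show ?thesis .
  qed
  moreover have eq: "4 * 2 ^ n + 1 = 2 * m + 1" by (simp add: m_def)
  ultimately show ?thesis unfolding eq using A(1) by blast
qed

section \<open>The quantum upper bound\<close>

lemma Far_pairs_mono:
  assumes "\<epsilon>' \<le> \<epsilon>" "(g1, g2) \<in> Far_pairs n \<epsilon>"
  shows "(g1, g2) \<in> Far_pairs n \<epsilon>'"
proof -
  have "\<epsilon>' * 2 * 2 ^ n \<le> real (card {p \<in> positions n. case_sum g1 g2 p \<noteq> case_sum f1 f2 p})"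
    if "(f1, f2) \<in> Yes_pairs n" for f1 f2
  proof -
    have "\<epsilon> * 2 * 2 ^ n \<le> real (card {p \<in> positions n. case_sum g1 g2 p \<noteq> case_sum f1 f2 p})"
      using assms(2) that by (auto simp: Far_pairs_def)
    moreover have "\<epsilon>' * 2 * 2 ^ n \<le> \<epsilon> * 2 * 2 ^ n" using assms(1) by simp
    ultimately show ?thesis by linarith
  qed
  then show ?thesis using assms(2) by (auto simp: Far_pairs_def)
qed

lemma Far_pairs_empty:
  assumes "\<epsilon> > 1" shows "Far_pairs n \<epsilon> = {}"
proof (rule equals0I)
  fix x assume "x \<in> Far_pairs n \<epsilon>"
  then obtain g1 g2 where far: "(g1, g2) \<in> Far_pairs n \<epsilon>" by (cases x) auto
  obtain f1 f2 where yes: "(f1, f2) \<in> Yes_pairs n" using Yes_pairs_nonempty[of n] by auto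
  have "\<epsilon> * 2 * 2 ^ n \<le> real (card {p \<in> positions n. case_sum g1 g2 p \<noteq> case_sum f1 f2 p})"
    using far yes by (auto simp: Far_pairs_def)
  also have "\<dots> \<le> real (card (positions n))"
    by (intro of_nat_mono card_mono) auto
  finally show False using assms by simp
qed

text \<open>Above \<open>2 * \<epsilon> * 2 ^ n = 1\<close> amplitude estimation applies; below, N
  is at most 1/(2\<epsilon>), and the 4N + 1 queries that read the whole table are within the
  bound.\<close>

lemma quantum_upper_bound_small:
  assumes "\<epsilon> > 0" "\<epsilon> \<le> 1 / 2"
  shows "\<exists>T A. quantum_algorithm n T A \<and> real T \<le> 3202 / \<epsilon> \<and>
    tests_with_error n \<epsilon> (1 / 3) (quantum_accept_prob T A)"
proof (cases "1 < 2 * \<epsilon> * 2 ^ n")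
  case True
  \<comment> \<open>The threshold is midway between 1/100 and 1/100 + \<epsilon>/50, so the gap on
    either side is \<epsilon>/100. Then \<open>M * (\<epsilon> / 100) \<ge> 16\<close>, and the
    error is at most 80/256, less than 1/3.\<close>
  define M where "M = nat \<lceil>1600 / \<epsilon>\<rceil>"
  have big: "1600 / \<epsilon> \<ge> 3200" using assms by (simp add: field_simps)
  have M: "1600 / \<epsilon> \<le> real M" "real M \<le> 1600 / \<epsilon> + 1" using big unfolding M_def by linarith+
  then have M1: "M > 1" using big by linarith
  have "16 \<le> real M * (\<epsilon> / 100)" using M(1) assms by (simp add: field_simps)
  then have "16 * 16 \<le> (real M * (\<epsilon> / 100))\<^sup>2" unfolding power2_eq_square by (intro mult_mono) auto
  then have err: "80 / (real M * (\<epsilon> / 100))\<^sup>2 \<le> 1 / 3" by (simp add: field_simps)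
  obtain A where A: "quantum_algorithm n (2 * M) A"
    "\<And>f g \<delta>. f \<in> boolean_functions n \<Longrightarrow> g \<in> boolean_functions n \<Longrightarrow> \<delta> > 0 \<Longrightarrow> Phi n f g \<le> 1 / 100 + \<epsilon> / 100 - \<delta> \<Longrightarrow>
       1 - 80 / (real M * \<delta>)\<^sup>2 \<le> quantum_accept_prob (2 * M) A (case_sum f g)"
    "\<And>f g \<delta>. f \<in> boolean_functions n \<Longrightarrow> g \<in> boolean_functions n \<Longrightarrow> \<delta> > 0 \<Longrightarrow> 1 / 100 + \<epsilon> / 100 + \<delta> \<le> Phi n f g \<Longrightarrow>
       quantum_accept_prob (2 * M) A (case_sum f g) \<le> 80 / (real M * \<delta>)\<^sup>2"
    using quantum_Phi_threshold[OF M1, of n "1 / 100 + \<epsilon> / 100"] by blast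
  have "tests_with_error n \<epsilon> (1 / 3) (quantum_accept_prob (2 * M) A)"
    unfolding tests_with_error_def
  proof (intro conjI ballI; clarify)
    fix f g assume "(f, g) \<in> Yes_pairs n"
    then show "1 - 1 / 3 \<le> quantum_accept_prob (2 * M) A (case_sum f g)"
      using A(2)[of f g "\<epsilon> / 100"] err assms by (auto simp: Yes_pairs_def)
  next
    fix f g assume far: "(f, g) \<in> Far_pairs n \<epsilon>"
    then show "1 - 1 / 3 \<le> 1 - quantum_accept_prob (2 * M) A (case_sum f g)"
      using A(3)[of f g "\<epsilon> / 100"] Far_pairs_Phi[OF far True assms(2)] err assms by (auto simp: Far_pairs_def)
  qed
  moreover have "real (2 * M) \<le> 3202 / \<epsilon>"
    using M(2) assms by (simp add: field_simps)
  ultimately show ?thesis using A(1) by blast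
next
  case False
  obtain A where A: "quantum_algorithm n (4 * 2 ^ n + 1) A"
     "\<And>h. (\<forall>p\<in>positions n. h p = 1 \<or> h p = -1) \<Longrightarrow>
        quantum_accept_prob (4 * 2 ^ n + 1) A h =
        of_bool (\<exists>h'\<in>(\<lambda>(f, g). case_sum f g) ` Yes_pairs n. \<forall>p\<in>positions n. h p = -1 \<longleftrightarrow> h' p = -1)"
    using quantum_read_all[of n "(\<lambda>(f, g). case_sum f g) ` Yes_pairs n"] by blast
  have "tests_with_error n \<epsilon> (1 / 3) (quantum_accept_prob (4 * 2 ^ n + 1) A)"
    unfolding tests_with_error_def
  proof (intro conjI ballI; clarify)
    fix f g assume Y: "(f, g) \<in> Yes_pairs n"
    have "\<forall>p\<in>positions n. case_sum f g p = 1 \<or> case_sum f g p = -1"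
      using Y case_sum_boolean_functions(1)[of f n g] unfolding Yes_pairs_def by blast
    note acc = A(2)[OF this]
    have "\<exists>h'\<in>(\<lambda>(f, g). case_sum f g) ` Yes_pairs n. \<forall>p\<in>positions n. case_sum f g p = -1 \<longleftrightarrow> h' p = -1"
      by (rule bexI[of _ "case_sum f g"]) (use Y in \<open>auto intro!: image_eqI[of _ _ "(f, g)"]\<close>)
    then show "1 - 1 / 3 \<le> quantum_accept_prob (4 * 2 ^ n + 1) A (case_sum f g)"
      unfolding acc by simp
  next
    fix f g assume far: "(f, g) \<in> Far_pairs n \<epsilon>"
    then have bf: "f \<in> boolean_functions n" "g \<in> boolean_functions n" by (auto simp: Far_pairs_def)
    have "\<not> (\<exists>h'\<in>(\<lambda>(f, g). case_sum f g) ` Yes_pairs n. \<forall>p\<in>positions n. case_sum f g p = -1 \<longleftrightarrow> h' p = -1)"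
    proof
      assume "\<exists>h'\<in>(\<lambda>(f, g). case_sum f g) ` Yes_pairs n. \<forall>p\<in>positions n. case_sum f g p = -1 \<longleftrightarrow> h' p = -1"
      then obtain f' g' where Y: "(f', g') \<in> Yes_pairs n"
        and eq: "\<And>p. p \<in> positions n \<Longrightarrow> case_sum f g p = -1 \<longleftrightarrow> case_sum f' g' p = -1" by auto
      have bf': "f' \<in> boolean_functions n" "g' \<in> boolean_functions n" using Y by (auto simp: Yes_pairs_def)
      have "case_sum f g p = case_sum f' g' p" if "p \<in> positions n" for p
        using case_sum_boolean_functions(1)[OF bf that] case_sum_boolean_functions(1)[OF bf' that] eq[OF that] by auto
      then have empty: "{p \<in> positions n. case_sum f g p \<noteq> case_sum f' g' p} = {}" by blast
      have "\<epsilon> * 2 * 2 ^ n \<le> real (card {p \<in> positions n. case_sum f g p \<noteq> case_sum f' g' p})"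
        using far Y by (auto simp: Far_pairs_def)
      moreover have "0 < \<epsilon> * 2 * 2 ^ n" using assms(1) by simp
      ultimately show False unfolding empty by simp
    qed
    moreover have "\<forall>p\<in>positions n. case_sum f g p = 1 \<or> case_sum f g p = -1"
      using case_sum_boolean_functions(1)[OF bf] by blast
    note acc = A(2)[OF this]
    ultimately show "1 - 1 / 3 \<le> 1 - quantum_accept_prob (4 * 2 ^ n + 1) A (case_sum f g)"
      unfolding acc by simp
  qed
  moreover have "real (4 * 2 ^ n + 1) \<le> 3202 / \<epsilon>"
  proof -
    have "real (4 * 2 ^ n + 1) * \<epsilon> = 2 * (2 * \<epsilon> * 2 ^ n) + \<epsilon>" by (simp add: algebra_simps)
    also have "\<dots> \<le> 3202" using False assms(2) by linarith
    finally show ?thesis using assms(1) by (simp only: pos_le_divide_eq)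
  qed
  ultimately show ?thesis using A(1) by blast
qed

text \<open>Distances are at most 2N, so beyond \<epsilon> = 1 nothing is far and a tester without
  queries may always accept. Between 1/2 and 1 the tester for 1/2 serves, at twice the
  constant.\<close>

lemma quantum_upper_bound:
  assumes "\<epsilon> > 0"
  shows "\<exists>T A. quantum_algorithm n T A \<and> real T \<le> 6404 / \<epsilon> \<and>
    tests_with_error n \<epsilon> (1 / 3) (quantum_accept_prob T A)"
proof -
  consider "\<epsilon> \<le> 1 / 2" | "1 / 2 < \<epsilon>" "\<epsilon> \<le> 1" | "\<epsilon> > 1" by linarith
  then show ?thesis
  proof cases
    case 1
    obtain T A where *: "quantum_algorithm n T A" "real T \<le> 3202 / \<epsilon>"
        "tests_with_error n \<epsilon> (1 / 3) (quantum_accept_prob T A)"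
      using quantum_upper_bound_small[OF assms 1] by blast
    moreover have "3202 / \<epsilon> \<le> 6404 / \<epsilon>" using assms by (intro divide_right_mono) auto
    ultimately show ?thesis by (meson order_trans)
  next
    case 2
    obtain T A where *: "quantum_algorithm n T A" "real T \<le> 3202 / (1 / 2)"
        "tests_with_error n (1 / 2) (1 / 3) (quantum_accept_prob T A)"
      using quantum_upper_bound_small[of "1 / 2" n] by auto
    have "tests_with_error n \<epsilon> (1 / 3) (quantum_accept_prob T A)"
      unfolding tests_with_error_def
    proof (intro conjI ballI; clarify)
      fix f g assume "(f, g) \<in> Far_pairs n \<epsilon>"
      with 2 have "(f, g) \<in> Far_pairs n (1 / 2)" using Far_pairs_mono[of "1 / 2" \<epsilon> f g n] by simp
      then show "1 - 1 / 3 \<le> 1 - quantum_accept_prob T A (case_sum f g)"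
        using *(3) unfolding tests_with_error_def by blast
    next
      fix f g assume "(f, g) \<in> Yes_pairs n"
      then show "1 - 1 / 3 \<le> quantum_accept_prob T A (case_sum f g)"
        using *(3) unfolding tests_with_error_def by blast
    qed
    moreover have "3202 / (1 / 2) \<le> 6404 / \<epsilon>" using 2 by (simp add: field_simps)
    ultimately show ?thesis using *(1,2) by (meson order_trans)
  next
    case 3
    have "\<exists>A. quantum_algorithm n 0 A \<and> (\<forall>h. quantum_accept_prob 0 A h =
        (\<Sum>b | b \<in> {()} \<and> True. (kernel_state {()} (\<lambda>_. None) (\<lambda>_ _ _. 1) () h 0 b)\<^sup>2))"
      by (rule ex_quantum_algorithm) (simp_all add: symmetric_involution_def)
    then obtain A where A: "quantum_algorithm n 0 A" "\<And>h. quantum_accept_prob 0 A h = 1"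
      by auto
    then have "tests_with_error n \<epsilon> (1 / 3) (quantum_accept_prob 0 A)"
      by (auto simp: tests_with_error_def Far_pairs_empty[OF 3])
    with A(1) show ?thesis using assms by (intro exI[of _ 0] exI[of _ A]) simp
  qed
qed

section \<open>Gaussian vectors\<close>

lemma prob_space_std_normal: "prob_space std_normal_distribution"
  using real_dist_normal_dist by (simp add: real_distribution_def)

lemma integrable_std_normal_mult_power:
  assumes "g \<in> borel_measurable borel" "\<And>x. \<bar>g x\<bar> \<le> B"
  shows "integrable std_normal_distribution (\<lambda>x. g x * x ^ j :: real)"
proof (rule Bochner_Integration.integrable_bound[of _ "\<lambda>x. B * x ^ j"])
  show "integrable std_normal_distribution (\<lambda>x. B * x ^ j)"
    using integrable_std_normal_distribution_moment by simp
  show "AE x in std_normal_distribution. norm (g x * x ^ j) \<le> norm (B * x ^ j)"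
    using assms(2) by (auto simp: abs_mult intro!: mult_right_mono order_trans[OF assms(2)] AE_I2)
qed (use assms(1) in simp)

lemma integral_std_normal_odd:
  fixes f :: "real \<Rightarrow> real"
  assumes [measurable]: "f \<in> borel_measurable borel" and odd: "\<And>x. f (- x) = - f x"
  shows "integral\<^sup>L std_normal_distribution f = 0"
proof -
  let ?g = "\<lambda>x. std_normal_density x * f x"
  have even: "std_normal_density (- x) = std_normal_density x" for x
    by (simp add: normal_density_def)
  have "integral\<^sup>L std_normal_distribution f = (\<integral>x. ?g x \<partial>lborel)"
    by (subst integral_density) auto
  also have "\<dots> = (\<integral>x. ?g (- x) \<partial>lborel)"
    using lborel_integral_real_affine[of "-1" ?g 0] by simp
  also have "\<dots> = - (\<integral>x. ?g x \<partial>lborel)"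
    by (simp add: even odd)
  also have "(\<integral>x. ?g x \<partial>lborel) = integral\<^sup>L std_normal_distribution f"
    by (subst integral_density) auto
  finally show ?thesis by simp
qed

lemma integral_std_normal_square: "(\<integral>x. x\<^sup>2 \<partial>std_normal_distribution) = 1"
  using std_normal_distribution_even_moments(1)[of 1] by simp

definition gauss :: "'q set \<Rightarrow> ('q \<Rightarrow> real) measure" where
  "gauss K = Pi\<^sub>M K (\<lambda>_. std_normal_distribution)"

lemma product_sigma_finite_std_normal: "product_sigma_finite (\<lambda>_. std_normal_distribution)"
  unfolding product_sigma_finite_def
  using prob_space_std_normal prob_space_imp_sigma_finite by blast

lemma prob_space_gauss: "prob_space (gauss K)"
  unfolding gauss_def by (intro prob_space_PiM prob_space_std_normal)

lemma
  fixes f :: "'q \<Rightarrow> real \<Rightarrow> _::{real_normed_field,banach,second_countable_topology}"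
  assumes "finite K" "\<And>k. k \<in> K \<Longrightarrow> integrable std_normal_distribution (f k)"
  shows integrable_gauss_prod: "integrable (gauss K) (\<lambda>v. \<Prod>k\<in>K. f k (v k))"
    and integral_gauss_prod:
      "(\<integral>v. (\<Prod>k\<in>K. f k (v k)) \<partial>gauss K) = (\<Prod>k\<in>K. integral\<^sup>L std_normal_distribution (f k))"
  unfolding gauss_def
  using product_sigma_finite.product_integrable_prod[OF product_sigma_finite_std_normal assms]
    product_sigma_finite.product_integral_prod[OF product_sigma_finite_std_normal assms] by auto

lemma measurable_gauss_component [measurable]:
  "k \<in> K \<Longrightarrow> (\<lambda>v. v k) \<in> borel_measurable (gauss K)"
proof -
  assume "k \<in> K"
  then have "(\<lambda>v. v k) \<in> measurable (gauss K) std_normal_distribution"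
    unfolding gauss_def by (rule measurable_component_singleton)
  then show ?thesis by (simp add: measurable_density_eq2 cong: measurable_cong_sets)
qed

lemma measurable_gauss_sum [measurable]:
  "(\<lambda>v. \<Sum>k\<in>K. w k * v k) \<in> borel_measurable (gauss K)"
  by (intro borel_measurable_sum borel_measurable_times measurable_gauss_component) auto

lemma integral_gauss_iexp:
  assumes "finite K"
  shows "integrable (gauss K) (\<lambda>v. iexp (\<Sum>k\<in>K. w k * v k))" (is ?A)
    and "(CLINT v|gauss K. iexp (\<Sum>k\<in>K. w k * v k)) = complex_of_real (exp (- (\<Sum>k\<in>K. (w k)\<^sup>2) / 2))" (is ?B)
proof -
  interpret P: prob_space std_normal_distribution by (rule prob_space_std_normal)
  have eq: "iexp (\<Sum>k\<in>K. w k * v k) = (\<Prod>k\<in>K. iexp (w k * v k))" for v :: "_ \<Rightarrow> real"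
    by (simp add: exp_sum[OF assms] sum_distrib_left)
  have int: "integrable std_normal_distribution (\<lambda>x. iexp (t * x))" for t :: real
    by (intro P.integrable_iexp) auto
  show ?A unfolding eq by (intro integrable_gauss_prod assms int)
  have "(CLINT v|gauss K. iexp (\<Sum>k\<in>K. w k * v k)) = (\<Prod>k\<in>K. char std_normal_distribution (w k))"
    unfolding eq char_def by (intro integral_gauss_prod assms int)
  also have "\<dots> = complex_of_real (\<Prod>k\<in>K. exp (- (w k)\<^sup>2 / 2))"
    by (simp add: char_std_normal_distribution)
  also have "(\<Prod>k\<in>K. exp (- (w k)\<^sup>2 / 2)) = exp (- (\<Sum>k\<in>K. (w k)\<^sup>2) / 2)"
    by (simp add: exp_sum[OF assms, symmetric] sum_negf sum_divide_distrib)
  finally show ?B .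
qed

lemma integral_gauss_cos:
  assumes "finite K"
  shows "(\<integral>v. cos (\<Sum>k\<in>K. w k * v k) \<partial>gauss K) = exp (- (\<Sum>k\<in>K. (w k)\<^sup>2) / 2)"
proof -
  have "(\<integral>v. cos (\<Sum>k\<in>K. w k * v k) \<partial>gauss K) = (\<integral>v. Re (iexp (\<Sum>k\<in>K. w k * v k)) \<partial>gauss K)"
    by (simp add: Re_exp)
  also have "\<dots> = Re (CLINT v|gauss K. iexp (\<Sum>k\<in>K. w k * v k))"
    by (rule integral_Re) (rule integral_gauss_iexp[OF assms])
  finally show ?thesis by (simp only: integral_gauss_iexp(2)[OF assms] Re_complex_of_real)
qed

text \<open>Expanding the product into exponentials leaves only characteristic functions of linear
  forms, which are determined by the Gram matrix of the vectors \<open>c i\<close>.\<close>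

lemma integral_gauss_prod_sin:
  fixes c :: "'i \<Rightarrow> 'q \<Rightarrow> real"
  assumes K: "finite K" and I: "finite I"
  shows "complex_of_real (\<integral>v. (\<Prod>i\<in>I. 1 + \<theta> i * sin (\<Sum>k\<in>K. c i k * v k)) \<partial>gauss K) =
    (\<Sum>\<sigma>\<in>I \<rightarrow>\<^sub>E {-1, 0, 1::real}. (\<Prod>i\<in>I. if \<sigma> i = 0 then 1 else complex_of_real (\<sigma> i * \<theta> i) / (2 * \<i>)) *
       complex_of_real (exp (- (\<Sum>i\<in>I. \<Sum>j\<in>I. \<sigma> i * \<sigma> j * (\<Sum>k\<in>K. c i k * c j k)) / 2)))"
proof -
  define a where "a i s = (if s = 0 then 1 else complex_of_real (s * \<theta> i) / (2 * \<i>))" for i and s :: real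
  have expand: "complex_of_real (1 + \<theta> i * sin x) = (\<Sum>s\<in>{-1, 0, 1}. a i s * iexp (s * x))" for i and x :: real
    by (simp add: a_def sin_exp_eq complex_eq_iff Re_exp Im_exp divide_simps)
  have lin: "(\<Sum>i\<in>I. \<sigma> i * (\<Sum>k\<in>K. c i k * v k)) = (\<Sum>k\<in>K. (\<Sum>i\<in>I. \<sigma> i * c i k) * v k)"
    for \<sigma> and v :: "'q \<Rightarrow> real"
    by (simp add: sum_distrib_left sum_distrib_right mult_ac) (rule sum.swap)
  have gram: "(\<Sum>k\<in>K. (\<Sum>i\<in>I. \<sigma> i * c i k)\<^sup>2) = (\<Sum>i\<in>I. \<Sum>j\<in>I. \<sigma> i * \<sigma> j * (\<Sum>k\<in>K. c i k * c j k))" for \<sigma>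
  proof -
    have "(\<Sum>k\<in>K. (\<Sum>i\<in>I. \<sigma> i * c i k)\<^sup>2) = (\<Sum>k\<in>K. \<Sum>i\<in>I. \<Sum>j\<in>I. \<sigma> i * \<sigma> j * (c i k * c j k))"
      by (simp add: power2_eq_square sum_product mult_ac)
    also have "\<dots> = (\<Sum>i\<in>I. \<Sum>k\<in>K. \<Sum>j\<in>I. \<sigma> i * \<sigma> j * (c i k * c j k))"
      by (rule sum.swap)
    also have "\<dots> = (\<Sum>i\<in>I. \<Sum>j\<in>I. \<Sum>k\<in>K. \<sigma> i * \<sigma> j * (c i k * c j k))"
      by (intro sum.cong refl sum.swap)
    finally show ?thesis by (simp only: sum_distrib_left)
  qed
  have "complex_of_real (\<integral>v. (\<Prod>i\<in>I. 1 + \<theta> i * sin (\<Sum>k\<in>K. c i k * v k)) \<partial>gauss K) =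
      (CLINT v|gauss K. (\<Prod>i\<in>I. complex_of_real (1 + \<theta> i * sin (\<Sum>k\<in>K. c i k * v k))))"
    by (simp only: integral_complex_of_real[symmetric] of_real_prod)
  also have "\<dots> = (CLINT v|gauss K. (\<Sum>\<sigma>\<in>I \<rightarrow>\<^sub>E {-1, 0, 1}. (\<Prod>i\<in>I. a i (\<sigma> i)) * iexp (\<Sum>k\<in>K. (\<Sum>i\<in>I. \<sigma> i * c i k) * v k)))"
  proof (rule Bochner_Integration.integral_cong[OF refl])
    fix v
    have "(\<Prod>i\<in>I. complex_of_real (1 + \<theta> i * sin (\<Sum>k\<in>K. c i k * v k))) =
        (\<Sum>\<sigma>\<in>I \<rightarrow>\<^sub>E {-1, 0, 1}. \<Prod>i\<in>I. a i (\<sigma> i) * iexp (\<sigma> i * (\<Sum>k\<in>K. c i k * v k)))"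
      unfolding expand by (rule prod_sum_PiE) (use I in auto)
    also have "\<dots> = (\<Sum>\<sigma>\<in>I \<rightarrow>\<^sub>E {-1, 0, 1}. (\<Prod>i\<in>I. a i (\<sigma> i)) * iexp (\<Sum>i\<in>I. \<sigma> i * (\<Sum>k\<in>K. c i k * v k)))"
      by (simp only: prod.distrib of_real_sum sum_distrib_left exp_sum[OF I])
    finally show "(\<Prod>i\<in>I. complex_of_real (1 + \<theta> i * sin (\<Sum>k\<in>K. c i k * v k))) =
      (\<Sum>\<sigma>\<in>I \<rightarrow>\<^sub>E {-1, 0, 1}. (\<Prod>i\<in>I. a i (\<sigma> i)) * iexp (\<Sum>k\<in>K. (\<Sum>i\<in>I. \<sigma> i * c i k) * v k))"
      unfolding lin .
  qed
  also have "\<dots> = (\<Sum>\<sigma>\<in>I \<rightarrow>\<^sub>E {-1, 0, 1}. (\<Prod>i\<in>I. a i (\<sigma> i)) *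
      complex_of_real (exp (- (\<Sum>k\<in>K. (\<Sum>i\<in>I. \<sigma> i * c i k)\<^sup>2) / 2)))"
    by (subst Bochner_Integration.integral_sum)
      (auto simp del: of_real_sum of_real_mult simp: integral_gauss_iexp[OF K])
  finally show ?thesis unfolding gram a_def .
qed

text \<open>This takes the place of the rotation invariance of the Gaussian measure: systems with
  equal Gram matrices can be exchanged without constructing an isometry or changing
  variables.\<close>

lemma integral_gauss_prod_sin_cong:
  fixes c d :: "'i \<Rightarrow> 'q \<Rightarrow> real"
  assumes "finite K" "finite I"
    and "\<And>i j. i \<in> I \<Longrightarrow> j \<in> I \<Longrightarrow> (\<Sum>k\<in>K. c i k * c j k) = (\<Sum>k\<in>K. d i k * d j k)"
  shows "(\<integral>v. (\<Prod>i\<in>I. 1 + \<theta> i * sin (\<Sum>k\<in>K. c i k * v k)) \<partial>gauss K) =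
    (\<integral>v. (\<Prod>i\<in>I. 1 + \<theta> i * sin (\<Sum>k\<in>K. d i k * v k)) \<partial>gauss K)"
proof -
  have "(\<Sum>i\<in>I. \<Sum>j\<in>I. \<sigma> i * \<sigma> j * (\<Sum>k\<in>K. c i k * c j k)) =
      (\<Sum>i\<in>I. \<Sum>j\<in>I. \<sigma> i * \<sigma> j * (\<Sum>k\<in>K. d i k * d j k))" for \<sigma> :: "'i \<Rightarrow> real"
    using assms(3) by (simp cong: sum.cong)
  then have "complex_of_real (\<integral>v. (\<Prod>i\<in>I. 1 + \<theta> i * sin (\<Sum>k\<in>K. c i k * v k)) \<partial>gauss K) =
    complex_of_real (\<integral>v. (\<Prod>i\<in>I. 1 + \<theta> i * sin (\<Sum>k\<in>K. d i k * v k)) \<partial>gauss K)"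
    unfolding integral_gauss_prod_sin[OF assms(1,2)] by (simp only:)
  then show ?thesis by (simp only: of_real_eq_iff)
qed

text \<open>\<open>sin_moment\<close> and \<open>cos_mean\<close> are both equal to exp(-1/2); the
  estimates below rely on their absolute values being at most 1.\<close>

definition sin_moment :: real where
  "sin_moment = (\<integral>x. x * sin x \<partial>std_normal_distribution)"

definition cos_mean :: real where
  "cos_mean = (\<integral>x. cos x \<partial>std_normal_distribution)"

lemma abs_sin_moment_le_1: "\<bar>sin_moment\<bar> \<le> 1"
proof -
  have "\<bar>sin_moment\<bar> \<le> (\<integral>x. \<bar>x * sin x\<bar> \<partial>std_normal_distribution)"
    unfolding sin_moment_def by (rule integral_abs_bound)
  also have "\<dots> \<le> (\<integral>x. x\<^sup>2 \<partial>std_normal_distribution)"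
  proof (rule integral_mono)
    show "integrable std_normal_distribution (\<lambda>x. \<bar>x * sin x\<bar>)"
      using integrable_std_normal_mult_power[of sin 1 1] by (auto simp: mult.commute)
    show "\<bar>x * sin x\<bar> \<le> x\<^sup>2" for x :: real
      using mult_left_mono[OF abs_sin_x_le_abs_x[of x], of "\<bar>x\<bar>"] by (simp add: abs_mult power2_eq_square)
  qed (rule integrable_std_normal_distribution_moment)
  finally show ?thesis by (simp add: integral_std_normal_square)
qed

lemma abs_cos_mean_le_1: "\<bar>cos_mean\<bar> \<le> 1"
proof -
  interpret P: prob_space std_normal_distribution by (rule prob_space_std_normal)
  have "\<bar>cos_mean\<bar> \<le> (\<integral>x. \<bar>cos x\<bar> \<partial>std_normal_distribution)"
    unfolding cos_mean_def by (rule integral_abs_bound)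
  also have "\<dots> \<le> (\<integral>x. 1 \<partial>std_normal_distribution)"
    using integrable_std_normal_mult_power[of cos 1 0] by (intro integral_mono) auto
  finally show ?thesis using P.prob_space by simp
qed

lemma tilted_bound: "\<bar>1 + t * sin x\<bar> \<le> 1 + \<bar>t\<bar>" for t x :: real
proof -
  have "\<bar>t * sin x\<bar> \<le> \<bar>t\<bar>" by (simp add: abs_mult mult_left_le)
  then show ?thesis by linarith
qed

lemma integrable_tilted [simp]:
  fixes t :: real
  shows "integrable std_normal_distribution (\<lambda>x. 1 + t * sin x)"
    and "integrable std_normal_distribution (\<lambda>x. (1 + t * sin x) * x)"
    and "integrable std_normal_distribution (\<lambda>x. (1 + t * sin x) * x\<^sup>2)"
    and "integrable std_normal_distribution (\<lambda>x. t * cos x)"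
    and "integrable std_normal_distribution (\<lambda>x. t * cos x * x)"
    and "integrable std_normal_distribution (\<lambda>x. x :: real)"
    and "integrable std_normal_distribution (\<lambda>x. x\<^sup>2 :: real)"
  using integrable_std_normal_mult_power[of "\<lambda>x. 1 + t * sin x" "1 + \<bar>t\<bar>" 0]
    integrable_std_normal_mult_power[of "\<lambda>x. 1 + t * sin x" "1 + \<bar>t\<bar>" 1]
    integrable_std_normal_mult_power[of "\<lambda>x. 1 + t * sin x" "1 + \<bar>t\<bar>" 2]
    integrable_std_normal_mult_power[of "\<lambda>x. t * cos x" "\<bar>t\<bar>" 0]
    integrable_std_normal_mult_power[of "\<lambda>x. t * cos x" "\<bar>t\<bar>" 1]
    integrable_std_normal_distribution_moment[of 1] integrable_std_normal_distribution_moment[of 2]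
  by (auto simp: tilted_bound abs_mult mult_left_le simp del: integrable_mult_right_iff)

lemma integral_tilted:
  fixes t :: real
  shows "(\<integral>x. 1 + t * sin x \<partial>std_normal_distribution) = 1"
    and "(\<integral>x. (1 + t * sin x) * x \<partial>std_normal_distribution) = t * sin_moment"
    and "(\<integral>x. (1 + t * sin x) * x\<^sup>2 \<partial>std_normal_distribution) = 1"
    and "(\<integral>x. t * cos x \<partial>std_normal_distribution) = t * cos_mean"
    and "(\<integral>x. t * cos x * x \<partial>std_normal_distribution) = 0"
    and "(\<integral>x. x \<partial>std_normal_distribution) = (0 :: real)"
proof -
  interpret P: prob_space std_normal_distribution by (rule prob_space_std_normal)
  have int: "integrable std_normal_distribution (\<lambda>x. sin x * x ^ j)" for j
    by (rule integrable_std_normal_mult_power[of sin 1]) auto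
  have sin: "(\<integral>x. sin x \<partial>std_normal_distribution) = (0 :: real)"
    and sin2: "(\<integral>x. sin x * x\<^sup>2 \<partial>std_normal_distribution) = (0 :: real)"
    and x: "(\<integral>x. x \<partial>std_normal_distribution) = (0 :: real)"
    and "(\<integral>x. t * cos x * x \<partial>std_normal_distribution) = 0"
    by (rule integral_std_normal_odd; simp)+
  then show "(\<integral>x. x \<partial>std_normal_distribution) = (0 :: real)"
    "(\<integral>x. t * cos x * x \<partial>std_normal_distribution) = 0" by auto
  show "(\<integral>x. 1 + t * sin x \<partial>std_normal_distribution) = 1"
    using int[of 0] sin P.prob_space by (subst Bochner_Integration.integral_add) auto
  have "(\<integral>x. (1 + t * sin x) * x \<partial>std_normal_distribution) = (\<integral>x. x + t * (sin x * x) \<partial>std_normal_distribution)"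
    by (simp add: algebra_simps)
  also have "\<dots> = t * sin_moment"
    using int[of 1] x by (subst Bochner_Integration.integral_add) (auto simp: sin_moment_def mult.commute)
  finally show "(\<integral>x. (1 + t * sin x) * x \<partial>std_normal_distribution) = t * sin_moment" .
  have "(\<integral>x. (1 + t * sin x) * x\<^sup>2 \<partial>std_normal_distribution) = (\<integral>x. x\<^sup>2 + t * (sin x * x\<^sup>2) \<partial>std_normal_distribution)"
    by (simp add: algebra_simps)
  also have "\<dots> = 1"
    using int[of 2] sin2 by (subst Bochner_Integration.integral_add) (auto simp: integral_std_normal_square)
  finally show "(\<integral>x. (1 + t * sin x) * x\<^sup>2 \<partial>std_normal_distribution) = 1" .
qed (simp add: cos_mean_def)

text \<open>For \<open>\<bar>\<theta> p\<bar> \<le> 1\<close> a probability density with respect to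
  the Gaussian measure: the factors are independent and of mean 1, because the sine is odd. It is
  the likelihood integrand of an orthonormal system.\<close>

definition tilt :: "('q \<Rightarrow> real) \<Rightarrow> 'q set \<Rightarrow> ('q \<Rightarrow> real) \<Rightarrow> real" where
  "tilt \<theta> P v = (\<Prod>p\<in>P. 1 + \<theta> p * sin (v p))"

text \<open>For \<open>b \<in> P\<close> the partial derivative of \<open>tilt\<close> in coordinate
  \<open>b\<close>.\<close>

definition tilt_deriv :: "('q \<Rightarrow> real) \<Rightarrow> 'q set \<Rightarrow> 'q \<Rightarrow> ('q \<Rightarrow> real) \<Rightarrow> real" where
  "tilt_deriv \<theta> P b v = (\<Prod>p\<in>P. if p = b then \<theta> b * cos (v b) else 1 + \<theta> p * sin (v p))"

text \<open>The mean of coordinate \<open>q\<close> under the density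
  \<open>tilt \<theta> P\<close>.\<close>

definition tilt_mean :: "('q \<Rightarrow> real) \<Rightarrow> 'q set \<Rightarrow> 'q \<Rightarrow> real" where
  "tilt_mean \<theta> P q = (if q \<in> P then \<theta> q * sin_moment else 0)"

lemma prod_if_subset:
  "finite K \<Longrightarrow> P \<subseteq> K \<Longrightarrow> (\<Prod>k\<in>K. if k \<in> P then g k else 1) = (\<Prod>k\<in>P. g k)"
  by (simp add: prod.inter_restrict[symmetric] Int_absorb1)

lemma
  assumes K: "finite K" "P \<subseteq> K"
  shows integrable_tilt: "integrable (gauss K) (tilt \<theta> P)"
    and integral_tilt: "(\<integral>v. tilt \<theta> P v \<partial>gauss K) = 1"
proof -
  define f where "f k x = (if k \<in> P then 1 + \<theta> k * sin x else 1)" for k and x :: real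
  interpret P: prob_space std_normal_distribution by (rule prob_space_std_normal)
  have f: "tilt \<theta> P = (\<lambda>v. \<Prod>k\<in>K. f k (v k))"
    using K by (simp add: fun_eq_iff tilt_def f_def prod_if_subset)
  have int: "integrable std_normal_distribution (f k)" for k by (cases "k \<in> P") (auto simp: f_def[abs_def])
  show "integrable (gauss K) (tilt \<theta> P)"
    unfolding f by (intro integrable_gauss_prod K int)
  have "integral\<^sup>L std_normal_distribution (f k) = 1" for k
    using P.prob_space by (cases "k \<in> P") (simp_all add: f_def[abs_def] integral_tilted)
  then show "(\<integral>v. tilt \<theta> P v \<partial>gauss K) = 1"
    unfolding f by (subst integral_gauss_prod[OF K(1) int]) simp
qed

text \<open>The perturbation of each factor is odd, so it moves the mean of a coordinate but not its
  second moment; distinct coordinates remain independent.\<close>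

lemma
  assumes K: "finite K" "P \<subseteq> K" "q \<in> K" "r \<in> K"
  shows integrable_tilt_square: "integrable (gauss K) (\<lambda>v. tilt \<theta> P v * (v q * v r))"
    and integral_tilt_square: "(\<integral>v. tilt \<theta> P v * (v q * v r) \<partial>gauss K) =
      (if q = r then 1 else tilt_mean \<theta> P q * tilt_mean \<theta> P r)"
proof -
  define f where "f k x = (if k \<in> P then 1 + \<theta> k * sin x else 1) *
    ((if k = q then x else 1) * (if k = r then x else 1))" for k and x :: real
  interpret P: prob_space std_normal_distribution by (rule prob_space_std_normal)
  have f: "(\<lambda>v. tilt \<theta> P v * (v q * v r)) = (\<lambda>v. \<Prod>k\<in>K. f k (v k))"
    using K by (simp add: fun_eq_iff tilt_def f_def prod_if_subset prod.distrib)
  have int: "integrable std_normal_distribution (f k)" for k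
    by (cases "k \<in> P"; cases "k = q"; cases "k = r") (auto simp: f_def[abs_def] simp flip: power2_eq_square)
  show "integrable (gauss K) (\<lambda>v. tilt \<theta> P v * (v q * v r))"
    unfolding f by (intro integrable_gauss_prod K int)
  have E: "integral\<^sup>L std_normal_distribution (f k) =
      (if q = r then 1 else (if k = q then tilt_mean \<theta> P q else 1) * (if k = r then tilt_mean \<theta> P r else 1))" for k
    using P.prob_space
    by (cases "k \<in> P"; cases "k = q"; cases "k = r")
      (auto simp: f_def[abs_def] integral_tilted tilt_mean_def integral_std_normal_square simp flip: power2_eq_square)
  show "(\<integral>v. tilt \<theta> P v * (v q * v r) \<partial>gauss K) = (if q = r then 1 else tilt_mean \<theta> P q * tilt_mean \<theta> P r)"
    unfolding f using K by (subst integral_gauss_prod[OF K(1) int]) (simp add: E prod.distrib)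
qed

text \<open>\<open>x * cos x\<close> is odd, so coordinate \<open>b\<close> has no correlation with
  its own derivative. This is the origin of the diagonal correction in the bound for the
  likelihood.\<close>

lemma
  assumes K: "finite K" "P \<subseteq> K" "q \<in> K" "b \<in> P"
  shows integrable_tilt_deriv: "integrable (gauss K) (\<lambda>v. tilt_deriv \<theta> P b v * v q)"
    and integral_tilt_deriv: "(\<integral>v. tilt_deriv \<theta> P b v * v q \<partial>gauss K) =
      (if q = b then 0 else \<theta> b * cos_mean * tilt_mean \<theta> P q)"
proof -
  define f where "f k x = (if k \<in> P then if k = b then \<theta> b * cos x else 1 + \<theta> k * sin x else 1) *
    (if k = q then x else 1)" for k and x :: real
  interpret P: prob_space std_normal_distribution by (rule prob_space_std_normal)
  have "tilt_deriv \<theta> P b v = (\<Prod>k\<in>K. if k \<in> P then if k = b then \<theta> b * cos (v k) else 1 + \<theta> k * sin (v k) else 1)" for v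
    unfolding tilt_deriv_def using K by (subst prod_if_subset) (auto intro!: prod.cong)
  then have f: "(\<lambda>v. tilt_deriv \<theta> P b v * v q) = (\<lambda>v. \<Prod>k\<in>K. f k (v k))"
    using K by (simp add: fun_eq_iff f_def prod.distrib)
  have int: "integrable std_normal_distribution (f k)" for k
    using integrable_tilted(4)[of 1]
    by (cases "k \<in> P"; cases "k = q"; cases "k = b") (auto simp: f_def[abs_def] simp del: integrable_mult_right_iff)
  show "integrable (gauss K) (\<lambda>v. tilt_deriv \<theta> P b v * v q)"
    unfolding f by (intro integrable_gauss_prod K int)
  have E: "integral\<^sup>L std_normal_distribution (f k) =
      (if k = b then if q = b then 0 else \<theta> b * cos_mean else 1) * (if k = q then if q = b then 1 else tilt_mean \<theta> P q else 1)" for k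
    using P.prob_space K(4)
    by (cases "k \<in> P"; cases "k = q"; cases "k = b")
      (auto simp: f_def[abs_def] integral_tilted tilt_mean_def simp del: Bochner_Integration.integral_mult_right_zero)
  have "b \<in> K" using K by auto
  then show "(\<integral>v. tilt_deriv \<theta> P b v * v q \<partial>gauss K) = (if q = b then 0 else \<theta> b * cos_mean * tilt_mean \<theta> P q)"
    unfolding f using K by (subst integral_gauss_prod[OF K(1) int]) (simp add: E prod.distrib)
qed

text \<open>For \<open>\<bar>t\<bar> \<le> 1 / 2\<close> the second derivative of
  \<open>ln (1 + t * sin y)\<close> is at least -2, so adding \<open>y\<^sup>2\<close> gives a
  convex function. The claim is its tangent inequality at \<open>x\<close>, exponentiated.\<close>

lemma tilted_ge_exp:
  fixes t x u :: real
  assumes "\<bar>t\<bar> \<le> 1 / 2"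
  shows "(1 + t * sin x) * exp (u * (t * cos x / (1 + t * sin x)) - u\<^sup>2) \<le> 1 + t * sin (x + u)"
proof -
  have ts: "\<bar>t * sin y\<bar> \<le> 1 / 2" for y
    using mult_mono[OF assms abs_sin_le_one[of y]] by (simp add: abs_mult)
  have pos: "1 + t * sin y > 0" for y using ts[of y] by linarith
  define g where "g y = ln (1 + t * sin y) + y\<^sup>2" for y
  define g' where "g' y = t * cos y / (1 + t * sin y) + 2 * y" for y
  define g'' where "g'' y = (- (t * sin y) * (1 + t * sin y) - (t * cos y) * (t * cos y)) / (1 + t * sin y)\<^sup>2 + 2" for y
  have d1: "(g has_real_derivative g' y) (at y)" for y
    unfolding g_def g'_def using pos[of y] by (auto intro!: derivative_eq_intros)
  have d2: "(g' has_real_derivative g'' y) (at y)" for y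
    unfolding g'_def g''_def using pos[of y]
    by (auto intro!: derivative_eq_intros simp: power2_eq_square)
  have "g'' y \<ge> 0" for y
  proof -
    define z where "z = t * sin y"
    have z: "\<bar>z\<bar> \<le> 1 / 2" "1 + z > 0" using ts[of y] pos[of y] by (auto simp: z_def)
    have "t\<^sup>2 \<le> (1 / 2)\<^sup>2" using assms by (rule abs_le_square_iff[THEN iffD1, OF order_trans[OF _ abs_ge_self]])
    moreover have "(t * cos y) * (t * cos y) = t\<^sup>2 - z\<^sup>2"
      by (simp add: z_def power2_eq_square[symmetric] power_mult_distrib cos_squared_eq algebra_simps)
    moreover have "0 \<le> 2 * z\<^sup>2 + 3 * z + 7 / 4"
      using zero_le_power2[of "z + 3 / 4"] by (simp add: power2_eq_square algebra_simps)
    ultimately have "0 \<le> - z * (1 + z) - (t * cos y) * (t * cos y) + 2 * (1 + z)\<^sup>2"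
      by (simp add: power2_eq_square algebra_simps)
    moreover have "g'' y = (- z * (1 + z) - (t * cos y) * (t * cos y) + 2 * (1 + z)\<^sup>2) / (1 + z)\<^sup>2"
      using z(2) unfolding g''_def z_def by (simp add: add_divide_distrib)
    ultimately show ?thesis by simp
  qed
  then have "convex_on UNIV g"
    using d1 d2 by (intro f''_ge0_imp_convex) auto
  then have "g' x * ((x + u) - x) \<le> g (x + u) - g x"
    using d1[of x] by (intro convex_on_imp_above_tangent[of UNIV]) auto
  then have "u * (t * cos x / (1 + t * sin x)) - u\<^sup>2 \<le> ln (1 + t * sin (x + u)) - ln (1 + t * sin x)"
    unfolding g_def g'_def by (simp add: power2_eq_square algebra_simps)
  then have "exp (u * (t * cos x / (1 + t * sin x)) - u\<^sup>2) \<le> exp (ln (1 + t * sin (x + u)) - ln (1 + t * sin x))"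
    by simp
  also have "\<dots> = (1 + t * sin (x + u)) / (1 + t * sin x)"
    using pos by (simp add: exp_diff)
  finally show ?thesis using pos[of x] by (simp add: field_simps)
qed

text \<open>Multiplying the one-coordinate bounds and using \<open>1 + w \<le> exp w\<close> yields
  a lower bound that is quadratic in the shifts \<open>u\<close>; for shifts linear in
  \<open>v\<close> it can be integrated in closed form.\<close>

lemma prod_tilted_ge:
  assumes "finite P" "\<And>p. p \<in> P \<Longrightarrow> \<bar>\<theta> p\<bar> \<le> 1 / 2"
  shows "tilt \<theta> P v + (\<Sum>p\<in>P. u p * tilt_deriv \<theta> P p v) - (\<Sum>p\<in>P. (u p)\<^sup>2) * tilt \<theta> P v \<le>
    (\<Prod>p\<in>P. 1 + \<theta> p * sin (v p + u p))"
proof -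
  have pos: "1 + \<theta> p * sin (v p) > 0" if "p \<in> P" for p
  proof -
    have "\<bar>\<theta> p * sin (v p)\<bar> \<le> 1 / 2"
      using mult_mono[OF assms(2)[OF that] abs_sin_le_one[of "v p"]] by (simp add: abs_mult)
    then show ?thesis by linarith
  qed
  have deriv: "tilt_deriv \<theta> P p v = tilt \<theta> P v * (\<theta> p * cos (v p) / (1 + \<theta> p * sin (v p)))" if "p \<in> P" for p
  proof -
    have "tilt_deriv \<theta> P p v = \<theta> p * cos (v p) * (\<Prod>k\<in>P - {p}. 1 + \<theta> k * sin (v k))"
      unfolding tilt_deriv_def by (subst prod.remove[OF assms(1) that]) (auto intro!: prod.cong)
    moreover have "tilt \<theta> P v = (1 + \<theta> p * sin (v p)) * (\<Prod>k\<in>P - {p}. 1 + \<theta> k * sin (v k))"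
      unfolding tilt_def by (rule prod.remove[OF assms(1) that])
    ultimately show ?thesis using pos[OF that] by simp
  qed
  define w where "w p = u p * (\<theta> p * cos (v p) / (1 + \<theta> p * sin (v p))) - (u p)\<^sup>2" for p
  have "tilt \<theta> P v + (\<Sum>p\<in>P. u p * tilt_deriv \<theta> P p v) - (\<Sum>p\<in>P. (u p)\<^sup>2) * tilt \<theta> P v =
      tilt \<theta> P v * (1 + (\<Sum>p\<in>P. w p))"
    by (simp add: deriv w_def sum_subtractf sum_distrib_left algebra_simps)
  also have "\<dots> \<le> tilt \<theta> P v * exp (\<Sum>p\<in>P. w p)"
    unfolding tilt_def using pos by (intro mult_left_mono exp_ge_add_one_self prod_nonneg) (auto intro: less_imp_le)
  also have "\<dots> = (\<Prod>p\<in>P. (1 + \<theta> p * sin (v p)) * exp (w p))"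
    by (simp add: tilt_def exp_sum[OF assms(1)] prod.distrib)
  also have "\<dots> \<le> (\<Prod>p\<in>P. 1 + \<theta> p * sin (v p + u p))"
    unfolding w_def using pos by (intro prod_mono conjI tilted_ge_exp assms(2)) (auto intro: less_imp_le)
  finally show ?thesis .
qed

text \<open>A second-order expansion about the orthonormal system. The first-order term evaluates to
  a mean-field energy, and the loss is the second moment of the shifts under the tilted law.\<close>

lemma integral_prod_tilted_ge:
  fixes d :: "'q \<Rightarrow> 'q \<Rightarrow> real"
  assumes K: "finite K" "P \<subseteq> K" and \<theta>: "\<And>p. p \<in> P \<Longrightarrow> \<bar>\<theta> p\<bar> \<le> 1 / 2"
  defines "\<mu> \<equiv> tilt_mean \<theta> P"
  shows "1 + cos_mean * (\<Sum>p\<in>P. \<theta> p * ((\<Sum>q\<in>K. d p q * \<mu> q) - d p p * \<mu> p)) -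
     (\<Sum>p\<in>P. (\<Sum>q\<in>K. (d p q)\<^sup>2) + (\<Sum>q\<in>K. d p q * \<mu> q)\<^sup>2) \<le>
     (\<integral>v. (\<Prod>p\<in>P. 1 + \<theta> p * sin (v p + (\<Sum>q\<in>K. d p q * v q))) \<partial>gauss K)"
proof -
  interpret P: prob_space "gauss K" by (rule prob_space_gauss)
  have finP: "finite P" using K by (meson finite_subset)
  let ?u = "\<lambda>v p. \<Sum>q\<in>K. d p q * v q"
  let ?R = "\<lambda>v. tilt \<theta> P v + (\<Sum>p\<in>P. \<Sum>q\<in>K. d p q * (tilt_deriv \<theta> P p v * v q)) -
     (\<Sum>p\<in>P. \<Sum>q\<in>K. \<Sum>r\<in>K. d p q * d p r * (tilt \<theta> P v * (v q * v r)))"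
  have R: "?R v = tilt \<theta> P v + (\<Sum>p\<in>P. ?u v p * tilt_deriv \<theta> P p v) - (\<Sum>p\<in>P. (?u v p)\<^sup>2) * tilt \<theta> P v" for v
    by (simp add: power2_eq_square sum_product sum_distrib_left sum_distrib_right mult_ac)
  have int1: "integrable (gauss K) (\<lambda>v. \<Sum>p\<in>P. \<Sum>q\<in>K. d p q * (tilt_deriv \<theta> P p v * v q))"
    using K by (intro Bochner_Integration.integrable_sum integrable_mult_right integrable_tilt_deriv) auto
  have int2: "integrable (gauss K) (\<lambda>v. \<Sum>p\<in>P. \<Sum>q\<in>K. \<Sum>r\<in>K. d p q * d p r * (tilt \<theta> P v * (v q * v r)))"
    using K by (intro Bochner_Integration.integrable_sum integrable_mult_right integrable_tilt_square) auto
  have 1: "(\<integral>v. (\<Sum>p\<in>P. \<Sum>q\<in>K. d p q * (tilt_deriv \<theta> P p v * v q)) \<partial>gauss K) =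
      cos_mean * (\<Sum>p\<in>P. \<theta> p * ((\<Sum>q\<in>K. d p q * \<mu> q) - d p p * \<mu> p))"
  proof -
    have "(\<integral>v. (\<Sum>p\<in>P. \<Sum>q\<in>K. d p q * (tilt_deriv \<theta> P p v * v q)) \<partial>gauss K) =
        (\<Sum>p\<in>P. \<Sum>q\<in>K. d p q * (if q = p then 0 else \<theta> p * cos_mean * \<mu> q))"
      unfolding \<mu>_def using K
      by (simp add: Bochner_Integration.integral_sum integrable_tilt_deriv integral_tilt_deriv subset_eq)
    also have "\<dots> = (\<Sum>p\<in>P. cos_mean * (\<theta> p * ((\<Sum>q\<in>K. d p q * \<mu> q) - d p p * \<mu> p)))"
    proof (rule sum.cong[OF refl])
      fix p assume "p \<in> P"
      then have p: "p \<in> K" using K by auto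
      have "(\<Sum>q\<in>K. d p q * (if q = p then 0 else \<theta> p * cos_mean * \<mu> q)) =
          (\<Sum>q\<in>K. \<theta> p * cos_mean * (d p q * \<mu> q) - (if q = p then \<theta> p * cos_mean * (d p p * \<mu> p) else 0))"
        by (intro sum.cong) auto
      also have "\<dots> = \<theta> p * cos_mean * (\<Sum>q\<in>K. d p q * \<mu> q) - \<theta> p * cos_mean * (d p p * \<mu> p)"
        using p K(1) by (simp add: sum_subtractf sum_distrib_left)
      finally show "(\<Sum>q\<in>K. d p q * (if q = p then 0 else \<theta> p * cos_mean * \<mu> q)) =
          cos_mean * (\<theta> p * ((\<Sum>q\<in>K. d p q * \<mu> q) - d p p * \<mu> p))" by (simp add: algebra_simps)
    qed
    finally show ?thesis by (simp only: sum_distrib_left)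
  qed
  have 2: "(\<integral>v. (\<Sum>p\<in>P. \<Sum>q\<in>K. \<Sum>r\<in>K. d p q * d p r * (tilt \<theta> P v * (v q * v r))) \<partial>gauss K) \<le>
      (\<Sum>p\<in>P. (\<Sum>q\<in>K. (d p q)\<^sup>2) + (\<Sum>q\<in>K. d p q * \<mu> q)\<^sup>2)"
  proof -
    have "(\<integral>v. (\<Sum>p\<in>P. \<Sum>q\<in>K. \<Sum>r\<in>K. d p q * d p r * (tilt \<theta> P v * (v q * v r))) \<partial>gauss K) =
        (\<Sum>p\<in>P. \<Sum>q\<in>K. \<Sum>r\<in>K. d p q * d p r * (if q = r then 1 else \<mu> q * \<mu> r))"
      unfolding \<mu>_def using K
      by (simp add: Bochner_Integration.integral_sum integrable_tilt_square integral_tilt_square)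
    \<comment> \<open>The added diagonal terms are squares; they complete the double sum to the
      square of the mean shift.\<close>
    also have "\<dots> \<le> (\<Sum>p\<in>P. \<Sum>q\<in>K. \<Sum>r\<in>K. (if q = r then (d p q)\<^sup>2 else 0) + (d p q * \<mu> q) * (d p r * \<mu> r))"
    proof (intro sum_mono)
      fix p q r
      show "d p q * d p r * (if q = r then 1 else \<mu> q * \<mu> r) \<le>
          (if q = r then (d p q)\<^sup>2 else 0) + (d p q * \<mu> q) * (d p r * \<mu> r)"
        using zero_le_square[of "d p r * \<mu> r"] by (auto simp: power2_eq_square mult_ac)
    qed
    also have "\<dots> = (\<Sum>p\<in>P. (\<Sum>q\<in>K. (d p q)\<^sup>2) + (\<Sum>q\<in>K. d p q * \<mu> q)\<^sup>2)"
      using K by (simp add: sum.distrib power2_eq_square[of "\<Sum>q\<in>K. d _ q * \<mu> q"] sum_product)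
    finally show ?thesis .
  qed
  have "(\<integral>v. ?R v \<partial>gauss K) \<le> (\<integral>v. (\<Prod>p\<in>P. 1 + \<theta> p * sin (v p + ?u v p)) \<partial>gauss K)"
  proof (rule integral_mono)
    show "integrable (gauss K) ?R"
      by (intro Bochner_Integration.integrable_diff Bochner_Integration.integrable_add integrable_tilt K int1 int2)
    show "integrable (gauss K) (\<lambda>v. \<Prod>p\<in>P. 1 + \<theta> p * sin (v p + ?u v p))"
    proof (rule P.integrable_const_bound[of _ "\<Prod>p\<in>P. 1 + \<bar>\<theta> p\<bar>"])
      show "AE v in gauss K. norm (\<Prod>p\<in>P. 1 + \<theta> p * sin (v p + ?u v p)) \<le> (\<Prod>p\<in>P. 1 + \<bar>\<theta> p\<bar>)"
        by (auto simp: abs_prod intro!: prod_mono tilted_bound)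
      show "(\<lambda>v. \<Prod>p\<in>P. 1 + \<theta> p * sin (v p + ?u v p)) \<in> borel_measurable (gauss K)"
        using K by (intro borel_measurable_prod borel_measurable_add borel_measurable_times borel_measurable_const
            measurable_compose[OF _ borel_measurable_sin] measurable_gauss_component measurable_gauss_sum) auto
    qed
    show "?R v \<le> (\<Prod>p\<in>P. 1 + \<theta> p * sin (v p + ?u v p))" for v
      unfolding R by (rule prod_tilted_ge[OF finP \<theta>])
  qed
  moreover have "(\<integral>v. ?R v \<partial>gauss K) = 1 + cos_mean * (\<Sum>p\<in>P. \<theta> p * ((\<Sum>q\<in>K. d p q * \<mu> q) - d p p * \<mu> p)) -
      (\<integral>v. (\<Sum>p\<in>P. \<Sum>q\<in>K. \<Sum>r\<in>K. d p q * d p r * (tilt \<theta> P v * (v q * v r))) \<partial>gauss K)"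
    using integrable_tilt[OF K] integral_tilt[OF K] int1 int2 1
    by (subst Bochner_Integration.integral_diff) (simp_all add: Bochner_Integration.integral_add)
  ultimately show ?thesis using 2 by linarith
qed

section \<open>The likelihood of a partial assignment\<close>

text \<open>Coordinate \<open>Inr y\<close> of the Gaussian vector is the bias of \<open>g y\<close>; the bias of \<open>f x\<close> is
  its Hadamard transform.\<close>

fun forr_vec :: "nat \<Rightarrow> position \<Rightarrow> position \<Rightarrow> real" where
  "forr_vec n (Inr y) q = of_bool (q = Inr y)"
| "forr_vec n (Inl x) q = (case q of Inl _ \<Rightarrow> 0 | Inr y \<Rightarrow> hadamard n x y)"

definition bias :: "nat \<Rightarrow> (position \<Rightarrow> real) \<Rightarrow> position \<Rightarrow> real" where
  "bias n v p = sin (\<Sum>q\<in>positions n. forr_vec n p q * v q) / 2"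

text \<open>The probability of the values \<open>h\<close> on \<open>P\<close> under the biased
  distribution, divided by the uniform one: given \<open>v\<close>, the value \<open>h p\<close> has
  probability \<open>(1 + h p * bias n v p) / 2\<close>.\<close>

definition likelihood :: "nat \<Rightarrow> position set \<Rightarrow> (position \<Rightarrow> real) \<Rightarrow> real" where
  "likelihood n P h = (\<integral>v. (\<Prod>p\<in>P. 1 + h p * bias n v p) \<partial>gauss (positions n))"

definition local_field :: "nat \<Rightarrow> position set \<Rightarrow> (position \<Rightarrow> real) \<Rightarrow> position \<Rightarrow> real" where
  "local_field n P h p = (\<Sum>q\<in>P. hadamard_swap n p q * h q)"

text \<open>The Ising energy with couplings \<open>hadamard_swap\<close>; every pair occurs twice in
  the sum, hence the halving.\<close>

definition energy :: "nat \<Rightarrow> position set \<Rightarrow> (position \<Rightarrow> real) \<Rightarrow> real" where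
  "energy n P h = (\<Sum>p\<in>P. h p * local_field n P h p) / 2"

text \<open>The 2N forms live in N dimensions. Each side is orthonormal by itself, and all
  dependence sits in the entries of size \<open>1 / sqrt (2 ^ n)\<close> between the sides.\<close>

lemma forr_vec_inner:
  assumes "p \<in> positions n" "q \<in> positions n"
  shows "(\<Sum>r\<in>positions n. forr_vec n p r * forr_vec n q r) = of_bool (p = q) + hadamard_swap n p q"
proof -
  have R: "(\<Sum>r\<in>positions n. forr_vec n (Inr y) r * f r) = f (Inr y)" if "y \<in> cube n" for y f
  proof -
    have "forr_vec n (Inr y) r = of_bool (Inr y = r)" for r by auto
    then show ?thesis using sum_of_bool_eq_mult[OF finite_positions, of "Inr y" n f] that by simp
  qed
  have L: "(\<Sum>r\<in>positions n. f r * forr_vec n (Inr y) r) = f (Inr y)" if "y \<in> cube n" for y f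
    by (rule trans[OF sum.cong[OF refl mult.commute] R[OF that]])
  from assms show ?thesis
  proof (cases p; cases q)
    fix x z assume "p = Inl x" "q = Inl z"
    then show ?thesis using assms by (simp add: sum_positions sum_hadamard_hadamard)
  qed (use assms in \<open>simp_all only: R L positions_iff\<close>, use assms in auto)
qed

text \<open>A second system of vectors with the same Gram matrix, in which the vectors of the queried
  positions are perturbations of an orthonormal system.\<close>

fun perturbation :: "nat \<Rightarrow> bool list set \<Rightarrow> position \<Rightarrow> position \<Rightarrow> real" where
  "perturbation n A (Inl a) q = 0"
| "perturbation n A (Inr b) (Inl a) = (if a \<in> A then hadamard n a b else 0)"
| "perturbation n A (Inr b) (Inr y) = - (\<Sum>a\<in>A. hadamard n a b * hadamard n a y)"

lemma sum_projection_mult: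
  assumes A: "A \<subseteq> cube n"
  shows "(\<Sum>y\<in>cube n. (\<Sum>a\<in>A. s a * hadamard n a y) * (\<Sum>a\<in>A. t a * hadamard n a y)) = (\<Sum>a\<in>A. s a * t a)"
proof -
  have "(\<Sum>y\<in>cube n. (\<Sum>a\<in>A. s a * hadamard n a y) * (\<Sum>a\<in>A. t a * hadamard n a y)) =
      (\<Sum>y\<in>cube n. \<Sum>a\<in>A. \<Sum>c\<in>A. s a * t c * (hadamard n a y * hadamard n c y))"
    by (simp add: sum_product mult_ac)
  also have "\<dots> = (\<Sum>a\<in>A. \<Sum>y\<in>cube n. \<Sum>c\<in>A. s a * t c * (hadamard n a y * hadamard n c y))"
    by (rule sum.swap)
  also have "\<dots> = (\<Sum>a\<in>A. \<Sum>c\<in>A. \<Sum>y\<in>cube n. s a * t c * (hadamard n a y * hadamard n c y))"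
    by (intro sum.cong refl sum.swap)
  also have "\<dots> = (\<Sum>a\<in>A. \<Sum>c\<in>A. if a = c then s a * t c else 0)"
  proof (intro sum.cong refl)
    fix a c assume "a \<in> A" "c \<in> A"
    then have "a \<in> cube n" "c \<in> cube n" using A by auto
    then show "(\<Sum>y\<in>cube n. s a * t c * (hadamard n a y * hadamard n c y)) = (if a = c then s a * t c else 0)"
      unfolding sum_distrib_left[symmetric] by (simp add: sum_hadamard_hadamard)
  qed
  also have "\<dots> = (\<Sum>a\<in>A. s a * t a)"
    using finite_subset[OF A] by simp
  finally show ?thesis .
qed

lemma sum_perturbation_square:
  assumes A: "A \<subseteq> cube n" and b: "b \<in> cube n"
  shows "(\<Sum>q\<in>positions n. (perturbation n A (Inr b) q)\<^sup>2) = 2 * real (card A) / 2 ^ n"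
proof -
  have "(\<Sum>y\<in>cube n. (perturbation n A (Inr b) (Inr y))\<^sup>2) = (\<Sum>a\<in>A. (hadamard n a b)\<^sup>2)"
    using sum_projection_mult[OF A, of "\<lambda>a. hadamard n a b" "\<lambda>a. hadamard n a b"]
    by (simp add: power2_eq_square)
  moreover have "(\<Sum>x\<in>cube n. (perturbation n A (Inr b) (Inl x))\<^sup>2) = (\<Sum>a\<in>A. (hadamard n a b)\<^sup>2)"
  proof -
    have "(\<Sum>x\<in>cube n. (perturbation n A (Inr b) (Inl x))\<^sup>2) = (\<Sum>x\<in>cube n. if x \<in> A then (hadamard n x b)\<^sup>2 else 0)"
      by (intro sum.cong) auto
    then show ?thesis using A by (simp add: sum.inter_restrict[symmetric] Int_absorb1)
  qed
  ultimately show ?thesis by (simp add: sum_positions hadamard_square)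
qed

text \<open>Behind the perturbed system is an isometry that sends row \<open>a\<close> of the
  Hadamard matrix, for \<open>a \<in> A\<close>, to the fresh basis vector \<open>Inl a\<close> and
  fixes the orthogonal complement of these rows. The image of basis vector \<open>b\<close> loses
  its projection onto the rows and gains the coefficients in the fresh directions.\<close>

lemma perturbation_gram:
  assumes A: "A \<subseteq> cube n" and "p \<in> A <+> cube n" "q \<in> A <+> cube n"
  shows "(\<Sum>r\<in>positions n. (of_bool (p = r) + perturbation n A p r) * (of_bool (q = r) + perturbation n A q r)) =
    of_bool (p = q) + hadamard_swap n p q"
proof -
  have expand: "(\<Sum>r\<in>positions n. (of_bool (p = r) + perturbation n A p r) * (of_bool (q = r) + perturbation n A q r)) =
      of_bool (p = q) + perturbation n A p q + perturbation n A q p +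
      (\<Sum>r\<in>positions n. perturbation n A p r * perturbation n A q r)"
  proof -
    have pq: "p \<in> positions n" "q \<in> positions n" using assms by (auto simp: positions_def)
    have "(\<Sum>r\<in>positions n. (of_bool (p = r) + perturbation n A p r) * (of_bool (q = r) + perturbation n A q r)) =
       (\<Sum>r\<in>positions n. of_bool (p = r) * of_bool (q = r)) + (\<Sum>r\<in>positions n. of_bool (p = r) * perturbation n A q r)
        + (\<Sum>r\<in>positions n. of_bool (q = r) * perturbation n A p r)
        + (\<Sum>r\<in>positions n. perturbation n A p r * perturbation n A q r)"
      unfolding sum.distrib[symmetric] by (intro sum.cong refl) (simp add: algebra_simps)
    then show ?thesis
      unfolding sum_of_bool_eq_mult[OF finite_positions pq(1)] sum_of_bool_eq_mult[OF finite_positions pq(2)]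
      by (cases "p = q") simp_all
  qed
  have comm: "(\<Sum>a\<in>A. hadamard n a b * hadamard n a c) = (\<Sum>a\<in>A. hadamard n a c * hadamard n a b)" for b c
    by (simp add: mult.commute)
  have RR: "(\<Sum>r\<in>positions n. perturbation n A (Inr b) r * perturbation n A (Inr c) r) =
      2 * (\<Sum>a\<in>A. hadamard n a b * hadamard n a c)" for b c
  proof -
    have "(\<Sum>x\<in>cube n. perturbation n A (Inr b) (Inl x) * perturbation n A (Inr c) (Inl x)) =
        (\<Sum>x\<in>cube n. if x \<in> A then hadamard n x b * hadamard n x c else 0)"
      by (intro sum.cong) auto
    also have "\<dots> = (\<Sum>a\<in>A. hadamard n a b * hadamard n a c)"
      using A by (simp add: sum.inter_restrict[symmetric] Int_absorb1)
    finally show ?thesis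
      using sum_projection_mult[OF A, of "\<lambda>a. hadamard n a b" "\<lambda>a. hadamard n a c"]
      by (simp add: sum_positions)
  qed
  show ?thesis
    unfolding expand
  proof (cases p; cases q)
    fix a c assume "p = Inl a" "q = Inl c"
    then show "of_bool (p = q) + perturbation n A p q + perturbation n A q p +
      (\<Sum>r\<in>positions n. perturbation n A p r * perturbation n A q r) = of_bool (p = q) + hadamard_swap n p q" by simp
  next
    fix a c assume "p = Inl a" "q = Inr c"
    then show "of_bool (p = q) + perturbation n A p q + perturbation n A q p +
      (\<Sum>r\<in>positions n. perturbation n A p r * perturbation n A q r) = of_bool (p = q) + hadamard_swap n p q"
      using assms(2) by auto
  next
    fix a c assume "p = Inr a" "q = Inl c"
    then show "of_bool (p = q) + perturbation n A p q + perturbation n A q p +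
      (\<Sum>r\<in>positions n. perturbation n A p r * perturbation n A q r) = of_bool (p = q) + hadamard_swap n p q"
      using assms(3) by auto
  next
    fix a c assume pq: "p = Inr a" "q = Inr c"
    show "of_bool (p = q) + perturbation n A p q + perturbation n A q p +
      (\<Sum>r\<in>positions n. perturbation n A p r * perturbation n A q r) = of_bool (p = q) + hadamard_swap n p q"
      unfolding pq RR using comm[of c a] by simp
  qed
qed

lemma likelihood_perturbation:
  assumes A: "A \<subseteq> cube n" and B: "B \<subseteq> cube n"
  shows "likelihood n (A <+> B) h = (\<integral>v. (\<Prod>p\<in>A <+> B. 1 + h p / 2 *
     sin (v p + (\<Sum>q\<in>positions n. perturbation n A p q * v q))) \<partial>gauss (positions n))"
proof -
  let ?P = "A <+> B"
  have fin: "finite ?P" using A B by (meson finite_Plus finite_subset finite_cube)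
  have sub: "p \<in> positions n" if "p \<in> ?P" for p using that A B by (auto simp: positions_def)
  have "likelihood n ?P h = (\<integral>v. (\<Prod>p\<in>?P. 1 + h p / 2 * sin (\<Sum>q\<in>positions n. forr_vec n p q * v q)) \<partial>gauss (positions n))"
    by (simp add: likelihood_def bias_def)
  also have "\<dots> = (\<integral>v. (\<Prod>p\<in>?P. 1 + h p / 2 *
      sin (\<Sum>q\<in>positions n. (of_bool (p = q) + perturbation n A p q) * v q)) \<partial>gauss (positions n))"
  proof (rule integral_gauss_prod_sin_cong[OF finite_positions fin])
    fix p q assume pq: "p \<in> ?P" "q \<in> ?P"
    then have "p \<in> A <+> cube n" "q \<in> A <+> cube n" using B by auto
    from perturbation_gram[OF A this] forr_vec_inner[OF sub[OF pq(1)] sub[OF pq(2)]]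
    show "(\<Sum>r\<in>positions n. forr_vec n p r * forr_vec n q r) =
      (\<Sum>r\<in>positions n. (of_bool (p = r) + perturbation n A p r) * (of_bool (q = r) + perturbation n A q r))"
      by (simp only:)
  qed
  also have "\<dots> = (\<integral>v. (\<Prod>p\<in>?P. 1 + h p / 2 *
      sin (v p + (\<Sum>q\<in>positions n. perturbation n A p q * v q))) \<partial>gauss (positions n))"
  proof -
    have "(\<Sum>q\<in>positions n. (of_bool (p = q) + perturbation n A p q) * v q) =
        v p + (\<Sum>q\<in>positions n. perturbation n A p q * v q)" if "p \<in> ?P" for p v
      using sum_of_bool_eq_mult[OF finite_positions sub[OF that], of v] by (simp add: distrib_right sum.distrib)
    then show ?thesis by (intro Bochner_Integration.integral_cong prod.cong refl) (simp cong: prod.cong)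
  qed
  finally show ?thesis .
qed

lemma sum_Plus_if_subset:
  assumes "finite K" "B \<subseteq> K"
  shows "(\<Sum>k\<in>K. if k \<in> B then f k else 0) = sum f B"
  using assms by (simp add: sum.inter_restrict[symmetric] Int_absorb1)

text \<open>The first-order term of \<open>integral_prod_tilted_ge\<close> is, up to a factor of
  absolute value at most 1, a quarter of the energy with corrections from the projection and the
  diagonal. The second-order term consists of squared local fields and of the squared norms
  \<open>2 * card A / 2 ^ n\<close> of the perturbations.\<close>

lemma likelihood_Plus_ge:
  assumes A: "A \<subseteq> cube n" and B: "B \<subseteq> cube n" and h: "\<And>p. p \<in> A <+> B \<Longrightarrow> \<bar>h p\<bar> = 1"
  defines "P \<equiv> A <+> B"
  shows "1 - likelihood n P h \<le> \<bar>energy n P h\<bar> + (\<Sum>p\<in>P. (local_field n P h p)\<^sup>2) + (real (card P))\<^sup>2 / 2 ^ n"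
proof -
  let ?H = "hadamard n" and ?N = "2 ^ n :: real"
  have fin: "finite A" "finite B" using A B by (auto intro: finite_subset)
  define \<theta> where "\<theta> p = h p / 2" for p
  \<comment> \<open>\<open>G\<close> and \<open>T\<close> are half the local fields on the two
    sides; \<open>R\<close> is \<open>T\<close> carried back to the other side by the projection
    part of the perturbation.\<close>
  define G where "G b = (\<Sum>a\<in>A. ?H a b * \<theta> (Inl a))" for b
  define T where "T a = (\<Sum>b\<in>B. ?H a b * \<theta> (Inr b))" for a
  define R where "R b = (\<Sum>a\<in>A. ?H a b * T a)" for b
  define \<mu> where "\<mu> = tilt_mean \<theta> P"
  have \<theta>2: "(\<theta> p)\<^sup>2 = 1 / 4" "\<bar>\<theta> p\<bar> \<le> 1 / 2" if "p \<in> P" for p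
  proof -
    have "\<bar>h p\<bar> = 1" using h that by (simp add: P_def)
    then have "h p = 1 \<or> h p = -1" by linarith
    then show "(\<theta> p)\<^sup>2 = 1 / 4" "\<bar>\<theta> p\<bar> \<le> 1 / 2" by (auto simp: \<theta>_def power_divide)
  qed
  have fieldl: "local_field n P h (Inl a) = 2 * T a" for a
    using fin by (simp add: local_field_def P_def sum.Plus T_def \<theta>_def sum_distrib_left)
  have fieldr: "local_field n P h (Inr b) = 2 * G b" for b
    using fin by (simp add: local_field_def P_def sum.Plus G_def \<theta>_def sum_distrib_left)
  have ET: "(\<Sum>a\<in>A. \<theta> (Inl a) * T a) = (\<Sum>b\<in>B. \<theta> (Inr b) * G b)"
    unfolding T_def G_def sum_distrib_left by (subst sum.swap) (simp add: mult_ac)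
  have E: "energy n P h = 4 * (\<Sum>b\<in>B. \<theta> (Inr b) * G b)"
  proof -
    have "energy n P h = 2 * (\<Sum>a\<in>A. \<theta> (Inl a) * T a) + 2 * (\<Sum>b\<in>B. \<theta> (Inr b) * G b)"
      unfolding energy_def using fin
      by (simp add: fieldl fieldr P_def[symmetric])
        (simp add: P_def sum.Plus fieldl[unfolded P_def] fieldr[unfolded P_def] \<theta>_def sum_distrib_left
          sum_divide_distrib add_divide_distrib mult_ac)
    then show ?thesis unfolding ET by simp
  qed
  have F: "(\<Sum>p\<in>P. (local_field n P h p)\<^sup>2) = 4 * (\<Sum>a\<in>A. (T a)\<^sup>2) + 4 * (\<Sum>b\<in>B. (G b)\<^sup>2)"
    using fin fieldl fieldr by (simp add: P_def sum.Plus power_mult_distrib sum_distrib_left)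
  have mean: "(\<Sum>q\<in>positions n. perturbation n A (Inr b) q * \<mu> q) = sin_moment * (G b - R b)" for b
  proof -
    have "(\<Sum>x\<in>cube n. perturbation n A (Inr b) (Inl x) * \<mu> (Inl x)) =
        (\<Sum>x\<in>cube n. if x \<in> A then sin_moment * (?H x b * \<theta> (Inl x)) else 0)"
      by (intro sum.cong) (auto simp: \<mu>_def tilt_mean_def P_def)
    also have "\<dots> = sin_moment * G b"
      using A by (subst sum_Plus_if_subset) (auto simp: G_def sum_distrib_left)
    finally have 1: "(\<Sum>x\<in>cube n. perturbation n A (Inr b) (Inl x) * \<mu> (Inl x)) = sin_moment * G b" .
    have "(\<Sum>y\<in>cube n. perturbation n A (Inr b) (Inr y) * \<mu> (Inr y)) =
        (\<Sum>y\<in>cube n. if y \<in> B then - sin_moment * (\<Sum>a\<in>A. ?H a b * (?H a y * \<theta> (Inr y))) else 0)"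
      by (intro sum.cong) (auto simp: \<mu>_def tilt_mean_def P_def sum_distrib_left sum_distrib_right sum_negf mult_ac)
    also have "\<dots> = - sin_moment * (\<Sum>y\<in>B. \<Sum>a\<in>A. ?H a b * (?H a y * \<theta> (Inr y)))"
      using B by (subst sum_Plus_if_subset) (auto simp: sum_distrib_left)
    also have "(\<Sum>y\<in>B. \<Sum>a\<in>A. ?H a b * (?H a y * \<theta> (Inr y))) = R b"
      unfolding R_def T_def by (subst sum.swap) (simp add: sum_distrib_left)
    finally show ?thesis using 1 by (simp add: sum_positions algebra_simps)
  qed
  have RT: "(\<Sum>b\<in>B. \<theta> (Inr b) * R b) = (\<Sum>a\<in>A. (T a)\<^sup>2)"
  proof -
    have "(\<Sum>b\<in>B. \<theta> (Inr b) * R b) = (\<Sum>a\<in>A. \<Sum>b\<in>B. T a * (?H a b * \<theta> (Inr b)))"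
      unfolding R_def sum_distrib_left by (subst sum.swap) (simp add: mult_ac)
    then show ?thesis by (simp add: power2_eq_square sum_distrib_left[symmetric] T_def[symmetric])
  qed
  \<comment> \<open>The rows in \<open>A\<close> are orthonormal, so \<open>R\<close> on the whole
    cube has the norm of \<open>T\<close>, and restricting it to \<open>B\<close> can only decrease
    it.\<close>
  have R2: "(\<Sum>b\<in>B. (R b)\<^sup>2) \<le> (\<Sum>a\<in>A. (T a)\<^sup>2)"
  proof -
    have "(\<Sum>b\<in>B. (R b)\<^sup>2) \<le> (\<Sum>b\<in>cube n. (R b)\<^sup>2)" using B by (intro sum_mono2) auto
    also have "\<dots> = (\<Sum>a\<in>A. (T a)\<^sup>2)"
      using sum_projection_mult[OF A, of T T] by (simp add: R_def power2_eq_square mult.commute)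
    finally show ?thesis .
  qed
  have diag: "perturbation n A (Inr b) (Inr b) = - (real (card A) / ?N)" for b
    by (simp add: power2_eq_square[symmetric] hadamard_square)
  have card: "real (card A) * real (card B) \<le> (real (card P))\<^sup>2 / 4"
    using zero_le_power2[of "real (card A) - real (card B)"] fin
    by (simp add: P_def card_Plus power2_eq_square algebra_simps)
  let ?D = "\<Sum>b\<in>B. \<theta> (Inr b) * (sin_moment * (G b - R b) - perturbation n A (Inr b) (Inr b) * \<mu> (Inr b))"
  let ?V = "\<Sum>b\<in>B. (\<Sum>q\<in>positions n. (perturbation n A (Inr b) q)\<^sup>2) + (sin_moment * (G b - R b))\<^sup>2"
  have "1 + cos_mean * ?D - ?V \<le> likelihood n P h"
  proof -
    have PK: "P \<subseteq> positions n" using A B by (auto simp: P_def positions_def)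
    have "1 + cos_mean * (\<Sum>p\<in>P. \<theta> p * ((\<Sum>q\<in>positions n. perturbation n A p q * \<mu> q) - perturbation n A p p * \<mu> p)) -
        (\<Sum>p\<in>P. (\<Sum>q\<in>positions n. (perturbation n A p q)\<^sup>2) + (\<Sum>q\<in>positions n. perturbation n A p q * \<mu> q)\<^sup>2)
        \<le> likelihood n P h"
      using integral_prod_tilted_ge[where \<theta> = \<theta> and d = "perturbation n A", OF finite_positions PK \<theta>2(2)]
      unfolding P_def \<mu>_def likelihood_perturbation[OF A B] \<theta>_def by (simp only:)
    also have "(\<Sum>p\<in>P. \<theta> p * ((\<Sum>q\<in>positions n. perturbation n A p q * \<mu> q) - perturbation n A p p * \<mu> p)) = ?D"
      using fin by (simp add: P_def sum.Plus mean del: perturbation.simps(3))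
    also have "(\<Sum>p\<in>P. (\<Sum>q\<in>positions n. (perturbation n A p q)\<^sup>2) + (\<Sum>q\<in>positions n. perturbation n A p q * \<mu> q)\<^sup>2) = ?V"
      using fin by (simp add: P_def sum.Plus mean del: perturbation.simps(2,3))
    finally show ?thesis .
  qed
  moreover have "\<bar>cos_mean * ?D\<bar> \<le> \<bar>energy n P h\<bar> / 4 + (\<Sum>a\<in>A. (T a)\<^sup>2) + (real (card P))\<^sup>2 / ?N / 16"
  proof -
    have "?D = sin_moment * ((\<Sum>b\<in>B. \<theta> (Inr b) * G b) - (\<Sum>b\<in>B. \<theta> (Inr b) * R b) + (\<Sum>b\<in>B. (\<theta> (Inr b))\<^sup>2 * (real (card A) / ?N)))"
      unfolding sum_subtractf[symmetric] sum.distrib[symmetric] sum_distrib_left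
    proof (intro sum.cong refl)
      fix b assume "b \<in> B"
      then have "\<mu> (Inr b) = \<theta> (Inr b) * sin_moment" by (auto simp: \<mu>_def tilt_mean_def P_def)
      then show "\<theta> (Inr b) * (sin_moment * (G b - R b) - perturbation n A (Inr b) (Inr b) * \<mu> (Inr b)) =
        sin_moment * (\<theta> (Inr b) * G b - \<theta> (Inr b) * R b + (\<theta> (Inr b))\<^sup>2 * (real (card A) / ?N))"
        unfolding diag by (simp add: power2_eq_square algebra_simps)
    qed
    also have "(\<Sum>b\<in>B. (\<theta> (Inr b))\<^sup>2 * (real (card A) / ?N)) = (\<Sum>b\<in>B. 1 / 4 * (real (card A) / ?N))"
    proof (intro sum.cong refl)
      fix b assume "b \<in> B"
      then have "Inr b \<in> P" by (auto simp: P_def)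
      then show "(\<theta> (Inr b))\<^sup>2 * (real (card A) / ?N) = 1 / 4 * (real (card A) / ?N)"
        by (simp only: \<theta>2(1))
    qed
    also have "\<dots> = real (card A) * real (card B) / 4 / ?N" by simp
    finally have D: "?D = sin_moment * (energy n P h / 4 - (\<Sum>a\<in>A. (T a)\<^sup>2) + real (card A) * real (card B) / 4 / ?N)"
      by (simp only: E RT) simp
    have "\<bar>a / 4 - b + c\<bar> \<le> \<bar>a\<bar> / 4 + b + d" if "c \<le> d" "0 \<le> c" "0 \<le> b" for a b c d :: real
      using that by linarith
    moreover have "real (card A) * real (card B) / 4 / ?N \<le> (real (card P))\<^sup>2 / ?N / 16"
      using divide_right_mono[OF card, of "4 * ?N"] by simp
    moreover have "0 \<le> real (card A) * real (card B) / 4 / ?N" "0 \<le> (\<Sum>a\<in>A. (T a)\<^sup>2)"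
      by (auto intro: sum_nonneg)
    ultimately have *: "\<bar>energy n P h / 4 - (\<Sum>a\<in>A. (T a)\<^sup>2) + real (card A) * real (card B) / 4 / ?N\<bar> \<le>
        \<bar>energy n P h\<bar> / 4 + (\<Sum>a\<in>A. (T a)\<^sup>2) + (real (card P))\<^sup>2 / ?N / 16"
      by blast
    have "\<bar>cos_mean\<bar> * \<bar>sin_moment\<bar> \<le> 1 * 1"
      by (intro mult_mono abs_cos_mean_le_1 abs_sin_moment_le_1) auto
    then have "(\<bar>cos_mean\<bar> * \<bar>sin_moment\<bar>) * \<bar>energy n P h / 4 - (\<Sum>a\<in>A. (T a)\<^sup>2) + real (card A) * real (card B) / 4 / ?N\<bar> \<le>
        1 * \<bar>energy n P h / 4 - (\<Sum>a\<in>A. (T a)\<^sup>2) + real (card A) * real (card B) / 4 / ?N\<bar>"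
      by (intro mult_right_mono) auto
    with * show ?thesis unfolding D by (simp add: abs_mult mult.assoc)
  qed
  moreover have "?V \<le> (real (card P))\<^sup>2 / ?N / 2 + 2 * (\<Sum>b\<in>B. (G b)\<^sup>2) + 2 * (\<Sum>a\<in>A. (T a)\<^sup>2)"
  proof -
    have "?V \<le> (\<Sum>b\<in>B. 2 * real (card A) / ?N + (2 * (G b)\<^sup>2 + 2 * (R b)\<^sup>2))"
    proof (intro sum_mono add_mono)
      fix b assume "b \<in> B"
      then show "(\<Sum>q\<in>positions n. (perturbation n A (Inr b) q)\<^sup>2) \<le> 2 * real (card A) / ?N"
        using sum_perturbation_square[OF A, of b] B by auto
      have "sin_moment\<^sup>2 \<le> 1" using abs_sin_moment_le_1 by (simp add: abs_square_le_1)
      then have "(sin_moment * (G b - R b))\<^sup>2 \<le> 1 * (G b - R b)\<^sup>2"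
        unfolding power_mult_distrib by (intro mult_right_mono) auto
      also have "\<dots> \<le> 2 * (G b)\<^sup>2 + 2 * (R b)\<^sup>2"
        using zero_le_power2[of "G b + R b"] by (simp add: power2_eq_square algebra_simps)
      finally show "(sin_moment * (G b - R b))\<^sup>2 \<le> 2 * (G b)\<^sup>2 + 2 * (R b)\<^sup>2" .
    qed
    also have "\<dots> = 2 * (real (card A) * real (card B)) / ?N + 2 * (\<Sum>b\<in>B. (G b)\<^sup>2) + 2 * (\<Sum>b\<in>B. (R b)\<^sup>2)"
      by (simp add: sum.distrib sum_distrib_left)
    also have "2 * (real (card A) * real (card B)) / ?N \<le> 2 * ((real (card P))\<^sup>2 / 4) / ?N"
      using card by (intro divide_right_mono mult_left_mono) auto
    finally show ?thesis using R2 by simp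
  qed
  moreover have "0 \<le> (\<Sum>b\<in>B. (G b)\<^sup>2)" "0 \<le> (\<Sum>a\<in>A. (T a)\<^sup>2)" "0 \<le> (real (card P))\<^sup>2 / ?N"
    by (auto intro: sum_nonneg)
  moreover have "1 - L \<le> \<bar>e\<bar> + (4 * t + 4 * g) + z"
    if "1 + D - V \<le> L" "\<bar>D\<bar> \<le> \<bar>e\<bar> / 4 + t + z / 16" "V \<le> z / 2 + 2 * g + 2 * t" "0 \<le> g" "0 \<le> t" "0 \<le> z"
    for L e t g z D V :: real
    using that by linarith
  ultimately show ?thesis unfolding F by blast
qed

lemma likelihood_ge:
  assumes "P \<subseteq> positions n" "\<And>p. p \<in> P \<Longrightarrow> \<bar>h p\<bar> = 1"
  shows "1 - likelihood n P h \<le> \<bar>energy n P h\<bar> + (\<Sum>p\<in>P. (local_field n P h p)\<^sup>2) + (real (card P))\<^sup>2 / 2 ^ n"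
proof -
  have P: "P = (Inl -` P) <+> (Inr -` P)" by (auto simp: Plus_def image_iff) (metis sum.exhaust)
  have "Inl -` P \<subseteq> cube n" "Inr -` P \<subseteq> cube n" using assms(1) by (auto simp: subset_eq)
  from likelihood_Plus_ge[OF this, of h, folded P] assms(2) show ?thesis by blast
qed

section \<open>Averages along decision trees\<close>

definition signs :: "'q set \<Rightarrow> ('q \<Rightarrow> real) set" where
  "signs K = K \<rightarrow>\<^sub>E {-1, 1}"

definition avg :: "'q set \<Rightarrow> (('q \<Rightarrow> real) \<Rightarrow> real) \<Rightarrow> real" where
  "avg K F = (\<Sum>h\<in>signs K. F h) / 2 ^ card K"

lemma card_signs: "finite K \<Longrightarrow> card (signs K) = 2 ^ card K"
  by (simp add: signs_def card_PiE numeral_2_eq_2)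

lemma signs_cases: "h \<in> signs K \<Longrightarrow> p \<in> K \<Longrightarrow> h p = 1 \<or> h p = -1"
  by (auto simp: signs_def PiE_def Pi_def)

lemma avg_const [simp]: "finite K \<Longrightarrow> avg K (\<lambda>h. c) = c"
  by (simp add: avg_def card_signs)

lemma avg_add: "avg K (\<lambda>h. F h + G h) = avg K F + avg K G"
  by (simp add: avg_def sum.distrib add_divide_distrib)

lemma avg_diff: "avg K (\<lambda>h. F h - G h) = avg K F - avg K G"
  by (simp add: avg_def sum_subtractf diff_divide_distrib)

lemma avg_mult_left: "avg K (\<lambda>h. c * F h) = c * avg K F"
  by (simp add: avg_def sum_distrib_left[symmetric])

lemma avg_sum: "avg K (\<lambda>h. \<Sum>i\<in>I. F i h) = (\<Sum>i\<in>I. avg K (F i))"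
  unfolding avg_def by (subst sum.swap) (simp add: sum_divide_distrib)

lemma avg_mono: "(\<And>h. h \<in> signs K \<Longrightarrow> F h \<le> G h) \<Longrightarrow> avg K F \<le> avg K G"
  unfolding avg_def by (intro divide_right_mono sum_mono) auto

lemma avg_cong: "(\<And>h. h \<in> signs K \<Longrightarrow> F h = G h) \<Longrightarrow> avg K F = avg K G"
  unfolding avg_def by (intro arg_cong2[where f = "(/)"] sum.cong) auto

lemma avg_prod:
  assumes "finite K"
  shows "avg K (\<lambda>h. \<Prod>k\<in>K. f k (h k)) = (\<Prod>k\<in>K. (f k 1 + f k (-1)) / 2)"
proof -
  have "(\<Sum>h\<in>signs K. \<Prod>k\<in>K. f k (h k)) = (\<Prod>k\<in>K. \<Sum>s\<in>{-1, 1}. f k s)"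
    unfolding signs_def by (rule prod_sum_PiE[symmetric]) (use assms in auto)
  then show ?thesis
    by (simp add: avg_def prod_dividef add.commute)
qed

lemma avg_split:
  assumes "finite K" "p \<in> K"
  shows "avg K F = (avg K (\<lambda>h. F (h(p := 1))) + avg K (\<lambda>h. F (h(p := -1)))) / 2"
proof -
  define L where "L = K - {p}"
  have K: "K = insert p L" "p \<notin> L" using assms(2) by (auto simp: L_def)
  have split: "(\<Sum>h\<in>signs K. F h) = (\<Sum>s\<in>{-1, 1}. \<Sum>g\<in>L \<rightarrow>\<^sub>E {-1, 1}. F (g(p := s)))" for F :: "_ \<Rightarrow> real"
  proof -
    have "(\<Sum>h\<in>signs K. F h) = (\<Sum>(s, g)\<in>{-1, 1} \<times> (L \<rightarrow>\<^sub>E {-1, 1}). F (g(p := s)))"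
      unfolding signs_def K(1) PiE_insert_eq
      by (subst sum.reindex[OF inj_combinator[OF K(2)]]) (simp add: case_prod_unfold)
    then show ?thesis by (simp add: sum.cartesian_product)
  qed
  show ?thesis
    unfolding avg_def split[of F] split[of "\<lambda>h. F (h(p := 1))"] split[of "\<lambda>h. F (h(p := -1))"]
    by (simp add: field_simps)
qed

text \<open>A set, because a tree may query a position repeatedly while the likelihood counts each
  revealed value once.\<close>

primrec queried :: "('q \<Rightarrow> real) \<Rightarrow> 'q dtree \<Rightarrow> 'q set" where
  "queried h (Output b) = {}"
| "queried h (Query p t u) = insert p (if h p = 1 then queried h t else queried h u)"

lemma queried_subset: "queried h t \<subseteq> set_dtree t"
  by (induction t) auto

lemma finite_queried [simp]: "finite (queried h t)"
  by (induction t) auto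

lemma card_queried_le: "card (queried h t) \<le> depth t"
proof (induction t)
  case (Query p t u)
  have "card (queried h (Query p t u)) \<le> Suc (card (if h p = 1 then queried h t else queried h u))"
    by (simp add: card_insert_le_m1 card_insert_if)
  then show ?case using Query by (auto split: if_splits)
qed auto

text \<open>The values \<open>g\<close> on \<open>P\<close> are the answers already received, so
  that an average over \<open>h\<close> ranges over what is still unknown.\<close>

definition patch :: "'q set \<Rightarrow> ('q \<Rightarrow> real) \<Rightarrow> ('q \<Rightarrow> real) \<Rightarrow> 'q \<Rightarrow> real" where
  "patch P g h p = (if p \<in> P then g p else h p)"

lemma patch_empty [simp]: "patch {} g h = h"
  by (simp add: patch_def fun_eq_iff)

lemma patch_upd: "p \<notin> P \<Longrightarrow> patch P g (h(p := s)) = patch (insert p P) (g(p := s)) h"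
  by (auto simp: patch_def fun_eq_iff)

text \<open>Once the tree has stopped, every unread factor \<open>1 + h p * w p\<close> averages to
  1, so only the queried positions matter. The revealed prefix \<open>P\<close>, \<open>g\<close> is
  carried along because a subtree may query earlier positions again.\<close>

lemma avg_run_prod_patch:
  assumes "finite K" "set_dtree t \<subseteq> K" "P \<subseteq> K" "\<And>p. p \<in> P \<Longrightarrow> g p = 1 \<or> g p = -1"
  shows "avg K (\<lambda>h. of_bool (run_dtree (patch P g h) t) * (\<Prod>p\<in>K. 1 + patch P g h p * w p)) =
    avg K (\<lambda>h. of_bool (run_dtree (patch P g h) t) * (\<Prod>p\<in>P \<union> queried (patch P g h) t. 1 + patch P g h p * w p))"
  using assms(2-)
proof (induction t arbitrary: P g)
  case (Output b)
  have finP: "finite P" using Output assms(1) by (meson finite_subset)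
  have "avg K (\<lambda>h. \<Prod>p\<in>K. 1 + patch P g h p * w p) = (\<Prod>p\<in>K. if p \<in> P then 1 + g p * w p else 1)"
    using avg_prod[OF assms(1), of "\<lambda>p s. 1 + (if p \<in> P then g p else s) * w p"]
    by (simp add: patch_def) (auto intro!: prod.cong)
  also have "\<dots> = (\<Prod>p\<in>P. 1 + g p * w p)"
    by (rule prod_if_subset[OF assms(1) Output(2)])
  also have "\<dots> = avg K (\<lambda>h. \<Prod>p\<in>P. 1 + patch P g h p * w p)"
    using assms(1) by (simp add: patch_def)
  finally show ?case by (cases b) simp_all
next
  case (Query p t u)
  have sub: "set_dtree t \<subseteq> K" "set_dtree u \<subseteq> K" "p \<in> K" using Query.prems by auto
  show ?case
  proof (cases "p \<in> P")
    case True
    then have *: "patch P g h p = g p" "\<And>X. P \<union> insert p X = P \<union> X" for h by (auto simp: patch_def)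
    show ?thesis
    proof (cases "g p = 1")
      case True
      then show ?thesis using Query.IH(1)[OF sub(1) Query.prems(2,3)] * by simp
    next
      case False
      then show ?thesis using Query.IH(2)[OF sub(2) Query.prems(2,3)] * by simp
    qed
  next
    case False
    have val: "patch (insert p P) (g(p := s)) h p = s" for s h by (simp add: patch_def)
    have un: "P \<union> insert p X = insert p P \<union> X" for X by auto
    have IH1: "avg K (\<lambda>h. of_bool (run_dtree (patch (insert p P) (g(p := 1)) h) t) * (\<Prod>q\<in>K. 1 + patch (insert p P) (g(p := 1)) h q * w q)) =
      avg K (\<lambda>h. of_bool (run_dtree (patch (insert p P) (g(p := 1)) h) t) *
        (\<Prod>q\<in>insert p P \<union> queried (patch (insert p P) (g(p := 1)) h) t. 1 + patch (insert p P) (g(p := 1)) h q * w q))"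
      using Query.prems sub by (intro Query.IH(1)) auto
    have IH2: "avg K (\<lambda>h. of_bool (run_dtree (patch (insert p P) (g(p := -1)) h) u) * (\<Prod>q\<in>K. 1 + patch (insert p P) (g(p := -1)) h q * w q)) =
      avg K (\<lambda>h. of_bool (run_dtree (patch (insert p P) (g(p := -1)) h) u) *
        (\<Prod>q\<in>insert p P \<union> queried (patch (insert p P) (g(p := -1)) h) u. 1 + patch (insert p P) (g(p := -1)) h q * w q))"
      using Query.prems sub by (intro Query.IH(2)) auto
    show ?thesis
      by (subst (1 2) avg_split[OF assms(1) sub(3)])
        (simp only: patch_upd[OF False] run_dtree.simps queried.simps val un IH1 IH2 if_True; simp add: IH1 IH2 del: Un_insert_left)
  qed
qed

lemma avg_run_prod:
  assumes "finite K" "set_dtree t \<subseteq> K"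
  shows "avg K (\<lambda>h. of_bool (run_dtree h t) * (\<Prod>p\<in>K. 1 + h p * w p)) =
    avg K (\<lambda>h. of_bool (run_dtree h t) * (\<Prod>p\<in>queried h t. 1 + h p * w p))"
  using avg_run_prod_patch[OF assms, of "{}"] by simp

text \<open>The potential \<open>\<Psi> k P h\<close> is charged when \<open>k\<close> queries are left and the positions in \<open>P\<close>
  have been revealed.\<close>

lemma avg_potential_patch:
  fixes \<Psi> :: "nat \<Rightarrow> 'q set \<Rightarrow> ('q \<Rightarrow> real) \<Rightarrow> real"
  assumes K: "finite K"
    and dep: "\<And>k P h h'. (\<And>p. p \<in> P \<Longrightarrow> h p = h' p) \<Longrightarrow> \<Psi> k P h = \<Psi> k P h'"
    and mono: "\<And>k P h. P \<subseteq> K \<Longrightarrow> \<Psi> k P h \<le> \<Psi> (Suc k) P h"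
    and step: "\<And>k P h p. P \<subseteq> K \<Longrightarrow> p \<in> K - P \<Longrightarrow>
      (\<Psi> k (insert p P) (h(p := 1)) + \<Psi> k (insert p P) (h(p := -1))) / 2 \<le> \<Psi> (Suc k) P h"
    and "set_dtree t \<subseteq> K" "depth t \<le> k" "P \<subseteq> K"
  shows "avg K (\<lambda>h. \<Psi> 0 (P \<union> queried (patch P g h) t) (patch P g h)) \<le> \<Psi> k P g"
  using assms(5-)
proof (induction t arbitrary: P g k)
  case (Output b)
  have "\<Psi> 0 P (patch P g h) = \<Psi> 0 P g" for h by (rule dep) (simp add: patch_def)
  moreover have "\<Psi> 0 P g \<le> \<Psi> k P g"
    by (rule lift_Suc_mono_le[of "\<lambda>k. \<Psi> k P g"]) (use mono Output in auto)
  ultimately show ?case using K by simp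
next
  case (Query p t u)
  obtain k' where k: "k = Suc k'" "depth t \<le> k'" "depth u \<le> k'" using Query.prems by (cases k) auto
  have sub: "set_dtree t \<subseteq> K" "set_dtree u \<subseteq> K" "p \<in> K" using Query.prems by auto
  show ?case
  proof (cases "p \<in> P")
    \<comment> \<open>A repeated query reveals nothing and merely uses up a step, which is what
      \<open>mono\<close> pays for.\<close>
    case True
    then have *: "patch P g h p = g p" "\<And>X. P \<union> insert p X = P \<union> X" for h by (auto simp: patch_def)
    have "avg K (\<lambda>h. \<Psi> 0 (P \<union> queried (patch P g h) (Query p t u)) (patch P g h)) \<le> \<Psi> k' P g"
    proof (cases "g p = 1")
      case True
      then show ?thesis using Query.IH(1)[OF sub(1) k(2) Query.prems(3)] * by simp
    next
      case False
      then show ?thesis using Query.IH(2)[OF sub(2) k(3) Query.prems(3)] * by simp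
    qed
    also have "\<dots> \<le> \<Psi> k P g" unfolding k(1) by (rule mono) fact
    finally show ?thesis .
  next
    case False
    have val: "patch (insert p P) (g(p := s)) h p = s" for s h by (simp add: patch_def)
    have un: "P \<union> insert p X = insert p P \<union> X" for X by auto
    have IH1: "avg K (\<lambda>h. \<Psi> 0 (insert p P \<union> queried (patch (insert p P) (g(p := 1)) h) t) (patch (insert p P) (g(p := 1)) h))
        \<le> \<Psi> k' (insert p P) (g(p := 1))"
      using Query.prems sub k by (intro Query.IH(1)) auto
    have IH2: "avg K (\<lambda>h. \<Psi> 0 (insert p P \<union> queried (patch (insert p P) (g(p := -1)) h) u) (patch (insert p P) (g(p := -1)) h))
        \<le> \<Psi> k' (insert p P) (g(p := -1))"
      using Query.prems sub k by (intro Query.IH(2)) auto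
    have neg: "(-1 :: real) = 1 \<longleftrightarrow> False" by simp
    have "avg K (\<lambda>h. \<Psi> 0 (P \<union> queried (patch P g h) (Query p t u)) (patch P g h)) =
       (avg K (\<lambda>h. \<Psi> 0 (insert p P \<union> queried (patch (insert p P) (g(p := 1)) h) t) (patch (insert p P) (g(p := 1)) h)) +
        avg K (\<lambda>h. \<Psi> 0 (insert p P \<union> queried (patch (insert p P) (g(p := -1)) h) u) (patch (insert p P) (g(p := -1)) h))) / 2"
      by (subst avg_split[OF K sub(3)])
        (simp only: patch_upd[OF False] queried.simps val un simp_thms if_True if_False neg)
    also have "\<dots> \<le> (\<Psi> k' (insert p P) (g(p := 1)) + \<Psi> k' (insert p P) (g(p := -1))) / 2"
      using IH1 IH2 by simp
    also have "\<dots> \<le> \<Psi> k P g"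
      unfolding k(1) using sub False Query.prems by (intro step) auto
    finally show ?thesis .
  qed
qed

lemma avg_potential:
  fixes \<Psi> :: "nat \<Rightarrow> 'q set \<Rightarrow> ('q \<Rightarrow> real) \<Rightarrow> real"
  assumes "finite K"
    and "\<And>k P h h'. (\<And>p. p \<in> P \<Longrightarrow> h p = h' p) \<Longrightarrow> \<Psi> k P h = \<Psi> k P h'"
    and "\<And>k P h. P \<subseteq> K \<Longrightarrow> \<Psi> k P h \<le> \<Psi> (Suc k) P h"
    and "\<And>k P h p. P \<subseteq> K \<Longrightarrow> p \<in> K - P \<Longrightarrow>
      (\<Psi> k (insert p P) (h(p := 1)) + \<Psi> k (insert p P) (h(p := -1))) / 2 \<le> \<Psi> (Suc k) P h"
    and "set_dtree t \<subseteq> K" "depth t \<le> k"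
  shows "avg K (\<lambda>h. \<Psi> 0 (queried h t) h) \<le> \<Psi> k {} g"
  using avg_potential_patch[of K \<Psi> t k "{}" g, OF assms] by simp

section \<open>Few queries reveal little energy\<close>

lemma abs_bias_le: "\<bar>bias n v p\<bar> \<le> 1 / 2"
  using abs_sin_le_one by (simp add: bias_def)

lemma measurable_bias [measurable]: "(\<lambda>v. bias n v p) \<in> borel_measurable (gauss (positions n))"
  unfolding bias_def by measurable

lemma integrable_prod_bias:
  assumes "finite P"
  shows "integrable (gauss (positions n)) (\<lambda>v. \<Prod>p\<in>P. a p + b p * bias n v p)"
proof -
  interpret P: prob_space "gauss (positions n)" by (rule prob_space_gauss)
  have "norm (\<Prod>p\<in>P. a p + b p * bias n v p) \<le> (\<Prod>p\<in>P. \<bar>a p\<bar> + \<bar>b p\<bar>)" for v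
  proof -
    have "\<bar>b p\<bar> * \<bar>bias n v p\<bar> \<le> \<bar>b p\<bar> * 1" for p
      using abs_bias_le[of n v p] by (intro mult_left_mono) auto
    then have "\<bar>a p + b p * bias n v p\<bar> \<le> \<bar>a p\<bar> + \<bar>b p\<bar>" for p
      by (intro order_trans[OF abs_triangle_ineq] add_left_mono) (simp add: abs_mult)
    then show ?thesis by (simp add: abs_prod prod_mono)
  qed
  then show ?thesis by (intro P.integrable_const_bound[where B = "\<Prod>p\<in>P. \<bar>a p\<bar> + \<bar>b p\<bar>"]) auto
qed

lemma avg_likelihood:
  assumes "\<And>h. finite (P h)"
  shows "avg (positions n) (\<lambda>h. F h * likelihood n (P h) h) =
   (\<integral>v. avg (positions n) (\<lambda>h. F h * (\<Prod>p\<in>P h. 1 + h p * bias n v p)) \<partial>gauss (positions n))"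
proof -
  have "integrable (gauss (positions n)) (\<lambda>v. F h * (\<Prod>p\<in>P h. 1 + h p * bias n v p))" for h
    by (intro integrable_mult_right integrable_prod_bias assms)
  then show ?thesis
    unfolding avg_def likelihood_def by (simp add: Bochner_Integration.integral_sum)
qed

lemma avg_run_likelihood:
  assumes "set_dtree t \<subseteq> positions n"
  shows "avg (positions n) (\<lambda>h. of_bool (run_dtree h t) * likelihood n (positions n) h) =
    avg (positions n) (\<lambda>h. of_bool (run_dtree h t) * likelihood n (queried h t) h)"
  by (simp add: avg_likelihood avg_run_prod[OF finite_positions assms])

lemma likelihood_nonneg:
  assumes "h \<in> signs K" "P \<subseteq> K"
  shows "0 \<le> likelihood n P h"
proof -
  have "0 \<le> 1 + h p * bias n v p" if "p \<in> P" for v p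
  proof -
    have "\<bar>h p\<bar> = 1" using signs_cases[OF assms(1) subsetD[OF assms(2) that]] by auto
    then have "\<bar>h p * bias n v p\<bar> \<le> 1 / 2" using abs_bias_le[of n v p] by (simp add: abs_mult)
    then show ?thesis by linarith
  qed
  then have "0 \<le> (\<Prod>p\<in>P. 1 + h p * bias n v p)" for v by (rule prod_nonneg)
  then show ?thesis unfolding likelihood_def by (rule Bochner_Integration.integral_nonneg)
qed

text \<open>Given the Gaussian vector, the values are independent with means
  \<open>bias n v p\<close>; hence moments of the table are moments of the biases.\<close>

lemma avg_prod_likelihood:
  assumes "S \<subseteq> positions n"
  shows "avg (positions n) (\<lambda>h. (\<Prod>p\<in>S. h p) * likelihood n (positions n) h) =
    (\<integral>v. (\<Prod>p\<in>S. bias n v p) \<partial>gauss (positions n))"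
proof -
  have "avg (positions n) (\<lambda>h. (\<Prod>p\<in>S. h p) * (\<Prod>p\<in>positions n. 1 + h p * w p)) = (\<Prod>p\<in>S. w p)" for w
  proof -
    have "(\<lambda>h. (\<Prod>p\<in>S. h p) * (\<Prod>p\<in>positions n. 1 + h p * w p)) =
        (\<lambda>h. \<Prod>p\<in>positions n. (if p \<in> S then h p else 1) * (1 + h p * w p))"
      using assms by (simp add: prod.distrib prod_if_subset)
    moreover have "(\<Prod>p\<in>positions n. ((if p \<in> S then 1 else 1) * (1 + 1 * w p) +
         (if p \<in> S then -1 else 1) * (1 + -1 * w p)) / 2) = (\<Prod>p\<in>positions n. if p \<in> S then w p else 1)"
      by (intro prod.cong) auto
    ultimately show ?thesis
      using avg_prod[OF finite_positions, of n "\<lambda>p s. (if p \<in> S then s else 1) * (1 + s * w p)"] assms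
      by (simp add: prod_if_subset)
  qed
  then show ?thesis by (simp add: avg_likelihood)
qed

lemma hadamard_swap_commute: "p \<in> positions n \<Longrightarrow> q \<in> positions n \<Longrightarrow> hadamard_swap n p q = hadamard_swap n q p"
  by (rule symmetric_involution_commute[OF symmetric_involution_hadamard_swap])

lemma hadamard_swap_same [simp]: "hadamard_swap n p p = 0"
  by (cases p) auto

lemma abs_hadamard_swap_le: "\<bar>hadamard_swap n p q\<bar> \<le> 1 / sqrt (2 ^ n)"
  by (cases p; cases q) (auto simp: abs_hadamard)

lemma local_field_insert:
  assumes "finite P" "p \<notin> P"
  shows "local_field n (insert p P) (h(p := s)) q = local_field n P h q + hadamard_swap n q p * s"
  using assms by (auto simp: local_field_def intro!: sum.cong)

text \<open>The couplings vanish on the diagonal, so the energy changes by the new sign times the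
  local field. Along a tree on uniform signs it is thus a martingale whose increments are the local
  fields of the queried positions.\<close>

lemma energy_insert:
  assumes "P \<subseteq> positions n" "p \<in> positions n - P"
  shows "energy n (insert p P) (h(p := s)) = energy n P h + s * local_field n P h p"
proof -
  have fin: "finite P" using assms(1) by (rule finite_subset) simp
  have p: "p \<notin> P" using assms by auto
  have "(\<Sum>q\<in>P. (h(p := s)) q * local_field n (insert p P) (h(p := s)) q) =
      (\<Sum>q\<in>P. h q * local_field n P h q + s * (hadamard_swap n p q * h q))"
  proof (rule sum.cong[OF refl])
    fix q assume "q \<in> P"
    then have "hadamard_swap n q p = hadamard_swap n p q" "q \<noteq> p"
      using assms by (auto intro: hadamard_swap_commute)
    then show "(h(p := s)) q * local_field n (insert p P) (h(p := s)) q =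
        h q * local_field n P h q + s * (hadamard_swap n p q * h q)"
      by (simp add: local_field_insert[OF fin p] algebra_simps)
  qed
  also have "\<dots> = (\<Sum>q\<in>P. h q * local_field n P h q) + s * local_field n P h p"
    unfolding sum.distrib local_field_def by (simp add: sum_distrib_left)
  finally show ?thesis
    unfolding energy_def using fin p by (simp add: local_field_insert[OF fin p])
qed

text \<open>A soft maximum of the local fields over all positions, revealed or not: an adaptive tree
  may next turn to whichever field is largest.\<close>

definition cosh_field :: "nat \<Rightarrow> real \<Rightarrow> position set \<Rightarrow> (position \<Rightarrow> real) \<Rightarrow> real" where
  "cosh_field n l P h = (\<Sum>q\<in>positions n. cosh (l * local_field n P h q))"

lemma cosh_field_nonneg: "0 \<le> cosh_field n l P h"
  by (simp add: cosh_field_def sum_nonneg)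

text \<open>Averaging over the new sign removes the odd part in the addition theorem for cosh, so
  each summand is multiplied by a cosh of one scaled coupling.\<close>

lemma cosh_field_step:
  assumes "P \<subseteq> positions n" "p \<in> positions n - P" "l \<ge> 0"
  shows "(cosh_field n l (insert p P) (h(p := 1)) + cosh_field n l (insert p P) (h(p := -1))) / 2 \<le>
    cosh (l / sqrt (2 ^ n)) * cosh_field n l P h"
proof -
  have fin: "finite P" using assms(1) by (rule finite_subset) simp
  have p: "p \<notin> P" using assms by auto
  have "(cosh_field n l (insert p P) (h(p := 1)) + cosh_field n l (insert p P) (h(p := -1))) / 2 =
      (\<Sum>q\<in>positions n. cosh (l * hadamard_swap n q p) * cosh (l * local_field n P h q))"
    unfolding cosh_field_def sum.distrib[symmetric] sum_divide_distrib local_field_insert[OF fin p]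
    by (intro sum.cong refl) (simp add: cosh_add cosh_diff distrib_left right_diff_distrib)
  also have "\<dots> \<le> (\<Sum>q\<in>positions n. cosh (l / sqrt (2 ^ n)) * cosh (l * local_field n P h q))"
  proof (intro sum_mono mult_right_mono)
    fix q
    have "\<bar>l * hadamard_swap n q p\<bar> \<le> l / sqrt (2 ^ n)"
      using mult_left_mono[OF abs_hadamard_swap_le assms(3), of n q p] assms(3) by (simp add: abs_mult)
    then have "cosh \<bar>l * hadamard_swap n q p\<bar> \<le> cosh (l / sqrt (2 ^ n))"
      using assms(3) by (subst cosh_real_nonneg_le_iff) auto
    then show "cosh (l * hadamard_swap n q p) \<le> cosh (l / sqrt (2 ^ n))" by simp
  qed simp
  finally show ?thesis by (simp add: cosh_field_def sum_distrib_left)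
qed

text \<open>Up to \<open>L\<close> the first term pays; beyond it, the excess
  \<open>y = \<bar>x\<bar> - L\<close> satisfies \<open>y\<^sup>2 / 2 \<le> exp y\<close>. For
  \<open>L\<close> of the order of the logarithm of the number of fields, the factor
  \<open>exp (- L)\<close> absorbs a sum over all of them.\<close>

lemma square_le_cosh:
  fixes L x :: real
  assumes "L \<ge> 0"
  shows "x\<^sup>2 \<le> 2 * L\<^sup>2 + 8 * exp (- L) * cosh x"
proof (cases "\<bar>x\<bar> \<le> L")
  case True
  then have "x\<^sup>2 \<le> L\<^sup>2" using assms by (simp add: abs_le_square_iff[symmetric])
  moreover have "0 \<le> 8 * exp (- L) * cosh x" "0 \<le> L\<^sup>2" by simp_all
  ultimately show ?thesis by linarith
next
  case False
  define y where "y = \<bar>x\<bar> - L"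
  have y: "y \<ge> 0" using False by (simp add: y_def)
  have "y\<^sup>2 / 2 \<le> exp y"
    using exp_lower_Taylor_quadratic[OF y] y by simp
  moreover have "exp y = exp (- L) * exp \<bar>x\<bar>" by (simp add: y_def exp_diff exp_minus field_simps)
  moreover have "exp \<bar>x\<bar> \<le> 2 * cosh \<bar>x\<bar>" by (simp add: cosh_def)
  then have "exp (- L) * exp \<bar>x\<bar> \<le> exp (- L) * (2 * cosh x)" by simp
  ultimately have "2 * y\<^sup>2 \<le> 8 * exp (- L) * cosh x" by linarith
  moreover have "x\<^sup>2 \<le> 2 * L\<^sup>2 + 2 * y\<^sup>2"
  proof -
    have "x\<^sup>2 = (L + y)\<^sup>2" by (simp add: y_def)
    also have "\<dots> \<le> 2 * L\<^sup>2 + 2 * y\<^sup>2" using zero_le_power2[of "L - y"] by (simp add: power2_eq_square algebra_simps)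
    finally show ?thesis .
  qed
  ultimately show ?thesis by linarith
qed

lemma field_square_le:
  assumes "p \<in> positions n" "l > 0" "L \<ge> 0"
  shows "(local_field n P h p)\<^sup>2 \<le> (2 * L\<^sup>2 + 8 * exp (- L) * cosh (l * local_field n P h p)) / l\<^sup>2"
  using square_le_cosh[OF assms(3), of "l * local_field n P h p"] assms(2)
  by (simp add: field_simps power_mult_distrib)

lemma avg_cosh_field:
  assumes "set_dtree t \<subseteq> positions n" "depth t \<le> T" "l \<ge> 0"
  shows "avg (positions n) (\<lambda>h. cosh_field n l (queried h t) h) \<le> cosh (l / sqrt (2 ^ n)) ^ T * (2 * 2 ^ n)"
proof -
  define \<rho> where "\<rho> = cosh (l / sqrt (2 ^ n))"
  have \<rho>: "\<rho> \<ge> 1" by (simp add: \<rho>_def cosh_real_ge_1)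
  have "avg (positions n) (\<lambda>h. \<rho> ^ 0 * cosh_field n l (queried h t) h) \<le> \<rho> ^ T * cosh_field n l {} (\<lambda>_. 0)"
  proof (rule avg_potential[OF finite_positions _ _ _ assms(1,2)])
    fix k P and h :: "position \<Rightarrow> real"
    show "\<rho> ^ k * cosh_field n l P h \<le> \<rho> ^ Suc k * cosh_field n l P h"
      using \<rho> by (intro mult_right_mono cosh_field_nonneg power_increasing) auto
    fix p assume *: "P \<subseteq> positions n" "p \<in> positions n - P"
    from mult_left_mono[OF cosh_field_step[OF * assms(3)], of "\<rho> ^ k" h] \<rho>
    show "(\<rho> ^ k * cosh_field n l (insert p P) (h(p := 1)) + \<rho> ^ k * cosh_field n l (insert p P) (h(p := -1))) / 2
       \<le> \<rho> ^ Suc k * cosh_field n l P h"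
      unfolding \<rho>_def[symmetric] by (simp add: algebra_simps)
  next
    fix k P and h h' :: "position \<Rightarrow> real" assume *: "\<And>p. p \<in> P \<Longrightarrow> h p = h' p"
    show "\<rho> ^ k * cosh_field n l P h = \<rho> ^ k * cosh_field n l P h'"
      by (simp add: cosh_field_def local_field_def * cong: sum.cong)
  qed
  then show ?thesis by (simp add: cosh_field_def local_field_def \<rho>_def)
qed

text \<open>The expected square of the energy grows by the squared local field of the queried
  position, which is at most a constant plus a multiple of \<open>cosh_field\<close>. The potential
  prepays both for the \<open>k\<close> queries left, with \<open>\<rho> ^ k\<close> covering the
  growth of \<open>cosh_field\<close>.\<close>

lemma avg_energy_square:
  assumes "set_dtree t \<subseteq> positions n" "depth t \<le> T" "l > 0" "L \<ge> 0"
  shows "avg (positions n) (\<lambda>h. (energy n (queried h t) h)\<^sup>2) \<le>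
    real T * (2 * L\<^sup>2 + 8 * exp (- L) * (cosh (l / sqrt (2 ^ n)) ^ T * (2 * 2 ^ n))) / l\<^sup>2"
proof -
  define \<rho> where "\<rho> = cosh (l / sqrt (2 ^ n))"
  have \<rho>: "\<rho> \<ge> 1" by (simp add: \<rho>_def cosh_real_ge_1)
  define a where "a = 2 * L\<^sup>2 / l\<^sup>2"
  define b where "b = 8 * exp (- L) / l\<^sup>2"
  have ab: "a \<ge> 0" "b \<ge> 0" by (auto simp: a_def b_def)
  define \<Psi> where "\<Psi> k P h = (energy n P h)\<^sup>2 + real k * a + real k * b * \<rho> ^ k * cosh_field n l P h" for k P h
  have "avg (positions n) (\<lambda>h. \<Psi> 0 (queried h t) h) \<le> \<Psi> T {} (\<lambda>_. 0)"
  proof (rule avg_potential[OF finite_positions _ _ _ assms(1,2)])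
    fix k P and h :: "position \<Rightarrow> real"
    have "real k * b * \<rho> ^ k * cosh_field n l P h \<le> real (Suc k) * b * \<rho> ^ Suc k * cosh_field n l P h"
      using \<rho> ab by (intro mult_right_mono mult_mono cosh_field_nonneg power_increasing) auto
    moreover have "real k * a \<le> real (Suc k) * a" using ab by (intro mult_right_mono) auto
    ultimately show "\<Psi> k P h \<le> \<Psi> (Suc k) P h" unfolding \<Psi>_def by linarith
    fix p assume *: "P \<subseteq> positions n" "p \<in> positions n - P"
    let ?E = "energy n P h" and ?S = "local_field n P h p" and ?C = "cosh_field n l P h"
    let ?C1 = "cosh_field n l (insert p P) (h(p := 1))" and ?C2 = "cosh_field n l (insert p P) (h(p := -1))"
    have "?S\<^sup>2 \<le> a + b * cosh (l * ?S)"
      using field_square_le[of p n l L P h] * assms(3,4) by (simp add: a_def b_def add_divide_distrib)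
    also have "cosh (l * ?S) \<le> ?C"
      unfolding cosh_field_def using * by (intro member_le_sum) auto
    finally have S: "?S\<^sup>2 \<le> a + b * ?C" using ab by (simp add: mult_left_mono)
    have "(\<Psi> k (insert p P) (h(p := 1)) + \<Psi> k (insert p P) (h(p := -1))) / 2 =
        ?E\<^sup>2 + ?S\<^sup>2 + real k * a + real k * b * \<rho> ^ k * ((?C1 + ?C2) / 2)"
      unfolding \<Psi>_def energy_insert[OF *] by (simp add: power2_eq_square field_simps)
    also have "\<dots> \<le> ?E\<^sup>2 + (a + b * ?C) + real k * a + real k * b * \<rho> ^ k * (\<rho> * ?C)"
      using S \<rho> ab cosh_field_step[OF *, of l h] assms(3) unfolding \<rho>_def[symmetric]
      by (intro add_mono mult_left_mono) auto
    also have "b * ?C \<le> b * \<rho> ^ Suc k * ?C"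
      using \<rho> ab mult_left_mono[OF one_le_power[OF \<rho>, of "Suc k"] ab(2)] by (intro mult_right_mono cosh_field_nonneg) simp
    finally show "(\<Psi> k (insert p P) (h(p := 1)) + \<Psi> k (insert p P) (h(p := -1))) / 2 \<le> \<Psi> (Suc k) P h"
      unfolding \<Psi>_def by (simp add: algebra_simps)
  next
    fix k P and h h' :: "position \<Rightarrow> real" assume *: "\<And>p. p \<in> P \<Longrightarrow> h p = h' p"
    show "\<Psi> k P h = \<Psi> k P h'"
      by (simp add: \<Psi>_def energy_def cosh_field_def local_field_def * cong: sum.cong)
  qed
  also have "\<Psi> T {} (\<lambda>_. 0) = real T * a + real T * b * \<rho> ^ T * (2 * 2 ^ n)"
    by (simp add: \<Psi>_def energy_def cosh_field_def local_field_def)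
  finally show ?thesis
    unfolding \<rho>_def[symmetric] by (simp add: \<Psi>_def a_def b_def add_divide_distrib algebra_simps)
qed

lemma sum_field_square_le:
  assumes "P \<subseteq> positions n" "l > 0" "L \<ge> 0"
  shows "(\<Sum>p\<in>P. (local_field n P h p)\<^sup>2) \<le> (2 * L\<^sup>2 * real (card P) + 8 * exp (- L) * cosh_field n l P h) / l\<^sup>2"
proof -
  have "(\<Sum>p\<in>P. (local_field n P h p)\<^sup>2) \<le>
      (\<Sum>p\<in>P. (2 * L\<^sup>2 + 8 * exp (- L) * cosh (l * local_field n P h p)) / l\<^sup>2)"
    using assms by (intro sum_mono field_square_le) auto
  also have "\<dots> = (2 * L\<^sup>2 * real (card P) + 8 * exp (- L) * (\<Sum>p\<in>P. cosh (l * local_field n P h p))) / l\<^sup>2"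
    by (simp add: sum_divide_distrib[symmetric] sum.distrib sum_distrib_left)
  also have "\<dots> \<le> (2 * L\<^sup>2 * real (card P) + 8 * exp (- L) * cosh_field n l P h) / l\<^sup>2"
    unfolding cosh_field_def using assms
    by (intro divide_right_mono add_left_mono mult_left_mono sum_mono2) auto
  finally show ?thesis .
qed

lemma cosh_le_1_plus_square:
  fixes x :: real
  assumes "0 \<le> x" "x \<le> 1"
  shows "cosh x \<le> 1 + x\<^sup>2"
proof -
  have "1 \<le> (1 - x + x\<^sup>2) * (1 + x)"
    using assms by (simp add: power2_eq_square algebra_simps)
  also have "\<dots> \<le> (1 - x + x\<^sup>2) * exp x"
    using assms by (intro mult_left_mono exp_ge_add_one_self) auto
  finally have "exp (- x) \<le> 1 - x + x\<^sup>2"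
    by (simp add: exp_minus field_simps)
  then show ?thesis using exp_bound[OF assms] by (simp add: cosh_def)
qed

lemma cosh_power_le:
  assumes "1 \<le> X" "real T \<le> X"
  shows "cosh (1 / sqrt X) ^ T \<le> 11 / 4"
proof -
  have "cosh (1 / sqrt X) \<le> 1 + 1 / X"
    using cosh_le_1_plus_square[of "1 / sqrt X"] assms by (simp add: power_divide)
  also have "\<dots> \<le> exp (1 / X)" by (rule exp_ge_add_one_self)
  finally have "cosh (1 / sqrt X) ^ T \<le> exp (1 / X) ^ T" by (intro power_mono) auto
  also have "\<dots> = exp (real T / X)" by (simp add: exp_of_nat_mult[symmetric])
  also have "\<dots> \<le> exp 1" using assms by simp
  also have "\<dots> \<le> 11 / 4" using e_less_272 by simp
  finally show ?thesis .
qed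

lemma avg_energy_fields_le:
  assumes t: "set_dtree t \<subseteq> positions n" "depth t \<le> T" and X: "1 \<le> X" "real T \<le> X"
  shows "avg (positions n) (\<lambda>h. (energy n (queried h t) h)\<^sup>2) \<le> X\<^sup>2 / 2 ^ n * (2 * (real n)\<^sup>2 + 44)"
    and "avg (positions n) (\<lambda>h. \<Sum>p\<in>queried h t. (local_field n (queried h t) h p)\<^sup>2) \<le>
      X\<^sup>2 / 2 ^ n * (2 * (real n)\<^sup>2 + 44)"
proof -
  \<comment> \<open>The bounds improve with \<open>l\<close>, but
    \<open>cosh (l / sqrt (2 ^ n)) ^ T\<close> has to stay bounded; for \<open>T \<le> X\<close>
    this choice keeps it below 11/4.\<close>
  define l where "l = sqrt (2 ^ n) / sqrt X"
  have l: "l > 0" "l\<^sup>2 = 2 ^ n / X" "l / sqrt (2 ^ n) = 1 / sqrt X"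
    using X by (auto simp: l_def power_divide)
  have "2 ^ n * exp (- real n) \<le> 1"
  proof -
    have "(2 :: real) ^ n \<le> exp 1 ^ n" using exp_ge_add_one_self[of 1] by (intro power_mono) auto
    then show ?thesis by (simp add: exp_minus exp_of_nat_mult[symmetric] field_simps)
  qed
  then have "2 ^ n * exp (- real n) * cosh (1 / sqrt X) ^ T \<le> 1 * (11 / 4)"
    using cosh_power_le[OF X] by (intro mult_mono) auto
  \<comment> \<open>The cut-off is \<open>L = n\<close>, so that \<open>exp (- n)\<close>
    compensates for the number \<open>2 * 2 ^ n\<close> of positions; 44 is 8 * 2 * 11/4.\<close>
  then have C: "8 * exp (- real n) * (cosh (l / sqrt (2 ^ n)) ^ T * (2 * 2 ^ n)) \<le> 44"
    unfolding l by (simp add: mult_ac)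
  have "avg (positions n) (\<lambda>h. (energy n (queried h t) h)\<^sup>2) \<le>
    real T * (2 * (real n)\<^sup>2 + 8 * exp (- real n) * (cosh (l / sqrt (2 ^ n)) ^ T * (2 * 2 ^ n))) / l\<^sup>2"
    by (rule avg_energy_square[OF t l(1)]) simp
  also have "\<dots> \<le> X * (2 * (real n)\<^sup>2 + 44) / l\<^sup>2"
    using C X by (intro divide_right_mono mult_mono) auto
  also have "\<dots> = X\<^sup>2 / 2 ^ n * (2 * (real n)\<^sup>2 + 44)"
    unfolding l(2) using X by (simp add: power2_eq_square[of X])
  finally show "avg (positions n) (\<lambda>h. (energy n (queried h t) h)\<^sup>2) \<le> X\<^sup>2 / 2 ^ n * (2 * (real n)\<^sup>2 + 44)" .
  have "avg (positions n) (\<lambda>h. \<Sum>p\<in>queried h t. (local_field n (queried h t) h p)\<^sup>2) \<le>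
      avg (positions n) (\<lambda>h. 2 * (real n)\<^sup>2 * X / l\<^sup>2 + 8 * exp (- real n) / l\<^sup>2 * cosh_field n l (queried h t) h)"
  proof (rule avg_mono)
    fix h
    have sub: "queried h t \<subseteq> positions n" using t(1) queried_subset[of h t] by auto
    have "(\<Sum>p\<in>queried h t. (local_field n (queried h t) h p)\<^sup>2) \<le>
       (2 * (real n)\<^sup>2 * real (card (queried h t)) + 8 * exp (- real n) * cosh_field n l (queried h t) h) / l\<^sup>2"
      by (rule sum_field_square_le[OF sub l(1)]) simp
    also have "\<dots> \<le> (2 * (real n)\<^sup>2 * X + 8 * exp (- real n) * cosh_field n l (queried h t) h) / l\<^sup>2"
      using card_queried_le[of h t] t(2) X(2) by (intro divide_right_mono add_right_mono mult_left_mono) auto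
    finally show "(\<Sum>p\<in>queried h t. (local_field n (queried h t) h p)\<^sup>2) \<le>
       2 * (real n)\<^sup>2 * X / l\<^sup>2 + 8 * exp (- real n) / l\<^sup>2 * cosh_field n l (queried h t) h"
      by (simp add: add_divide_distrib)
  qed
  also have "\<dots> = 2 * (real n)\<^sup>2 * X / l\<^sup>2 + 8 * exp (- real n) / l\<^sup>2 * avg (positions n) (\<lambda>h. cosh_field n l (queried h t) h)"
    by (simp only: avg_add avg_mult_left avg_const[OF finite_positions])
  also have "\<dots> \<le> 2 * (real n)\<^sup>2 * X / l\<^sup>2 + 8 * exp (- real n) / l\<^sup>2 * (cosh (l / sqrt (2 ^ n)) ^ T * (2 * 2 ^ n))"
    using l(1) by (intro add_left_mono mult_left_mono avg_cosh_field t) auto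
  also have "\<dots> = (2 * (real n)\<^sup>2 * X + 8 * exp (- real n) * (cosh (l / sqrt (2 ^ n)) ^ T * (2 * 2 ^ n))) / l\<^sup>2"
    by (simp add: add_divide_distrib)
  also have "\<dots> \<le> (2 * (real n)\<^sup>2 * X + 44 * X) / l\<^sup>2"
    using C X by (intro divide_right_mono add_left_mono) auto
  also have "\<dots> = X\<^sup>2 / 2 ^ n * (2 * (real n)\<^sup>2 + 44)"
    unfolding l(2) using X by (simp add: power2_eq_square[of X] algebra_simps add_divide_distrib)
  finally show "avg (positions n) (\<lambda>h. \<Sum>p\<in>queried h t. (local_field n (queried h t) h p)\<^sup>2) \<le>
      X\<^sup>2 / 2 ^ n * (2 * (real n)\<^sup>2 + 44)" .
qed

text \<open>Acceptance is a weight between 0 and 1, so an upper bound on 1 minus the likelihood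
  ratio suffices. The squared budget over \<open>2 ^ n\<close> is
  \<open>\<kappa>\<^sup>2 / (real n)\<^sup>2\<close>, which cancels the square of the cut-off: here
  the logarithm in the theorem is spent.\<close>

lemma avg_run_diff_le:
  assumes t: "set_dtree t \<subseteq> positions n" "depth t \<le> T"
    and \<kappa>: "0 < \<kappa>" "\<kappa> \<le> 1" and n: "n \<ge> 1"
    and X: "1 \<le> \<kappa> * sqrt (2 ^ n) / real n" "real T \<le> \<kappa> * sqrt (2 ^ n) / real n"
  shows "avg (positions n) (\<lambda>h. of_bool (run_dtree h t)) -
    avg (positions n) (\<lambda>h. of_bool (run_dtree h t) * likelihood n (positions n) h) \<le> 71 * \<kappa>"
proof -
  define X' where "X' = \<kappa> * sqrt (2 ^ n) / real n"
  let ?e = "\<lambda>h. energy n (queried h t) h" and ?s = "\<lambda>h. \<Sum>p\<in>queried h t. (local_field n (queried h t) h p)\<^sup>2"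
  have X'2: "X'\<^sup>2 / 2 ^ n = \<kappa>\<^sup>2 / (real n)\<^sup>2"
    by (simp add: X'_def power_mult_distrib power_divide)
  have "X'\<^sup>2 / 2 ^ n * (2 * (real n)\<^sup>2 + 44) \<le> 46 * \<kappa>\<^sup>2"
  proof -
    have "2 * (real n)\<^sup>2 + 44 \<le> 46 * (real n)\<^sup>2" using n one_le_power[of "real n" 2] by simp
    then have "\<kappa>\<^sup>2 / (real n)\<^sup>2 * (2 * (real n)\<^sup>2 + 44) \<le> \<kappa>\<^sup>2 / (real n)\<^sup>2 * (46 * (real n)\<^sup>2)"
      by (intro mult_left_mono) auto
    then show ?thesis unfolding X'2 using n by simp
  qed
  then have B: "avg (positions n) (\<lambda>h. (?e h)\<^sup>2) \<le> 46 * \<kappa>\<^sup>2" "avg (positions n) ?s \<le> 46 * \<kappa>\<^sup>2"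
    using avg_energy_fields_le[OF t X, folded X'_def] by (auto intro: order_trans)
  have "avg (positions n) (\<lambda>h. of_bool (run_dtree h t)) -
    avg (positions n) (\<lambda>h. of_bool (run_dtree h t) * likelihood n (positions n) h) =
    avg (positions n) (\<lambda>h. of_bool (run_dtree h t) * (1 - likelihood n (queried h t) h))"
    unfolding avg_run_likelihood[OF t(1)] avg_diff[symmetric] by (simp add: algebra_simps)
  also have "\<dots> \<le> avg (positions n) (\<lambda>h. (1 / (2 * \<kappa>)) * (?e h)\<^sup>2 + \<kappa> / 2 + ?s h + \<kappa>\<^sup>2)"
  proof (rule avg_mono)
    fix h assume h: "h \<in> signs (positions n)"
    have sub: "queried h t \<subseteq> positions n" using t(1) queried_subset[of h t] by auto
    have "1 - likelihood n (queried h t) h \<le> \<bar>?e h\<bar> + ?s h + (real (card (queried h t)))\<^sup>2 / 2 ^ n"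
      using signs_cases[OF h] sub by (intro likelihood_ge) fastforce+
    moreover have "(real (card (queried h t)))\<^sup>2 / 2 ^ n \<le> \<kappa>\<^sup>2"
    proof -
      have "real (card (queried h t)) \<le> X'"
        using card_queried_le[of h t] t(2) X(2) unfolding X'_def by linarith
      then have "(real (card (queried h t)))\<^sup>2 / 2 ^ n \<le> X'\<^sup>2 / 2 ^ n"
        by (intro divide_right_mono power_mono) auto
      also have "\<dots> = \<kappa>\<^sup>2 / (real n)\<^sup>2" by (rule X'2)
      also have "\<dots> \<le> \<kappa>\<^sup>2 / 1" using n by (intro divide_left_mono) auto
      finally show ?thesis by simp
    qed
    \<comment> \<open>A weighted arithmetic-geometric mean inequality in place of Jensen's: as the
      mean square of the energy is of order \<open>\<kappa>\<^sup>2\<close>, this weight keeps the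
      result linear in \<kappa>.\<close>
    moreover have "\<bar>?e h\<bar> \<le> (1 / (2 * \<kappa>)) * (?e h)\<^sup>2 + \<kappa> / 2"
    proof -
      have "2 * \<kappa> * \<bar>?e h\<bar> \<le> (?e h)\<^sup>2 + \<kappa>\<^sup>2"
        using zero_le_power2[of "\<bar>?e h\<bar> - \<kappa>"] by (simp add: power2_diff algebra_simps)
      then have "2 * \<kappa> * \<bar>?e h\<bar> / (2 * \<kappa>) \<le> ((?e h)\<^sup>2 + \<kappa>\<^sup>2) / (2 * \<kappa>)"
        using \<kappa> by (intro divide_right_mono) auto
      then show ?thesis using \<kappa> by (simp add: add_divide_distrib power2_eq_square)
    qed
    moreover have "0 \<le> ?s h" by (intro sum_nonneg) auto
    moreover have "0 \<le> \<bar>?e h\<bar>" "0 \<le> \<kappa>\<^sup>2" by auto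
    ultimately have "1 - likelihood n (queried h t) h \<le> (1 / (2 * \<kappa>)) * (?e h)\<^sup>2 + \<kappa> / 2 + ?s h + \<kappa>\<^sup>2"
      "0 \<le> (1 / (2 * \<kappa>)) * (?e h)\<^sup>2 + \<kappa> / 2 + ?s h + \<kappa>\<^sup>2" by linarith+
    then show "of_bool (run_dtree h t) * (1 - likelihood n (queried h t) h) \<le>
        (1 / (2 * \<kappa>)) * (?e h)\<^sup>2 + \<kappa> / 2 + ?s h + \<kappa>\<^sup>2"
      by (cases "run_dtree h t") (simp_all only: of_bool_eq mult_1 mult_zero_left)
  qed
  also have "\<dots> = (1 / (2 * \<kappa>)) * avg (positions n) (\<lambda>h. (?e h)\<^sup>2) + \<kappa> / 2 + avg (positions n) ?s + \<kappa>\<^sup>2"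
    by (simp only: avg_add avg_mult_left avg_const[OF finite_positions])
  also have "\<dots> \<le> (1 / (2 * \<kappa>)) * (46 * \<kappa>\<^sup>2) + \<kappa> / 2 + 46 * \<kappa>\<^sup>2 + \<kappa>\<^sup>2"
    using B \<kappa> by (intro add_mono mult_left_mono) auto
  also have "\<dots> = 47 / 2 * \<kappa> + 47 * \<kappa>\<^sup>2" using \<kappa> by (simp add: power2_eq_square field_simps)
  also have "\<kappa>\<^sup>2 \<le> \<kappa>" using \<kappa> by (simp add: power2_eq_square mult_left_le)
  finally show ?thesis using \<kappa>(1) by linarith
qed

section \<open>Moments of Phi\<close>

lemma sum_linear_combination:
  fixes c d v :: "'q \<Rightarrow> real"
  shows "(\<Sum>k\<in>K. c k * v k) + (\<Sum>k\<in>K. d k * v k) = (\<Sum>k\<in>K. (c k + d k) * v k)"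
    and "(\<Sum>k\<in>K. c k * v k) - (\<Sum>k\<in>K. d k * v k) = (\<Sum>k\<in>K. (c k - d k) * v k)"
  by (simp_all add: sum.distrib sum_subtractf algebra_simps)

lemma sum_square_combination:
  fixes c d :: "'q \<Rightarrow> real"
  shows "(\<Sum>k\<in>K. (c k + d k)\<^sup>2) = (\<Sum>k\<in>K. (c k)\<^sup>2) + (\<Sum>k\<in>K. (d k)\<^sup>2) + 2 * (\<Sum>k\<in>K. c k * d k)"
    and "(\<Sum>k\<in>K. (c k - d k)\<^sup>2) = (\<Sum>k\<in>K. (c k)\<^sup>2) + (\<Sum>k\<in>K. (d k)\<^sup>2) - 2 * (\<Sum>k\<in>K. c k * d k)"
  by (simp_all add: power2_eq_square algebra_simps sum.distrib sum_subtractf sum_distrib_left)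

lemma integrable_gauss_cos: "integrable (gauss K) (\<lambda>v. cos (\<Sum>k\<in>K. c k * v k))"
proof -
  interpret P: prob_space "gauss K" by (rule prob_space_gauss)
  show ?thesis by (rule P.integrable_const_bound[where B = 1]) auto
qed

lemma integrable_gauss_cos_cos:
  "integrable (gauss K) (\<lambda>v. cos (\<Sum>k\<in>K. c k * v k) * cos (\<Sum>k\<in>K. d k * v k))"
  unfolding cos_times_cos sum_linear_combination
  by (intro integrable_divide Bochner_Integration.integrable_add integrable_gauss_cos)

lemma exp_polarization:
  fixes C D P :: real
  shows "exp (- (C + D - 2 * P) / 2) = exp (- (C + D) / 2) * exp P"
    and "exp (- (C + D + 2 * P) / 2) = exp (- (C + D) / 2) * exp (- P)"
proof -
  have "- (C + D - 2 * P) / 2 = - (C + D) / 2 + P" "- (C + D + 2 * P) / 2 = - (C + D) / 2 + - P"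
    by (simp_all add: field_simps)
  then show "exp (- (C + D - 2 * P) / 2) = exp (- (C + D) / 2) * exp P"
    "exp (- (C + D + 2 * P) / 2) = exp (- (C + D) / 2) * exp (- P)"
    by (simp_all only: exp_add)
qed

lemma integral_gauss_cos_cos:
  assumes "finite K"
  shows "(\<integral>v. cos (\<Sum>k\<in>K. c k * v k) * cos (\<Sum>k\<in>K. d k * v k) \<partial>gauss K) =
    exp (- ((\<Sum>k\<in>K. (c k)\<^sup>2) + (\<Sum>k\<in>K. (d k)\<^sup>2)) / 2) * cosh (\<Sum>k\<in>K. c k * d k)"
  unfolding cos_times_cos sum_linear_combination integral_divide_zero
    Bochner_Integration.integral_add[OF integrable_gauss_cos integrable_gauss_cos]
    integral_gauss_cos[OF assms] sum_square_combination exp_polarization cosh_def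
  by (simp add: algebra_simps)

lemma integral_gauss_sin_sin:
  assumes "finite K"
  shows "(\<integral>v. sin (\<Sum>k\<in>K. c k * v k) * sin (\<Sum>k\<in>K. d k * v k) \<partial>gauss K) =
    exp (- ((\<Sum>k\<in>K. (c k)\<^sup>2) + (\<Sum>k\<in>K. (d k)\<^sup>2)) / 2) * sinh (\<Sum>k\<in>K. c k * d k)"
  unfolding sin_times_sin sum_linear_combination integral_divide_zero
    Bochner_Integration.integral_diff[OF integrable_gauss_cos integrable_gauss_cos]
    integral_gauss_cos[OF assms] sum_square_combination exp_polarization sinh_def
  by (simp add: algebra_simps add_divide_distrib diff_divide_distrib)

text \<open>Both forms have unit variance, which gives the damping exp(-1); the halves in the two
  biases give 1/4.\<close>

lemma integral_bias_bias:
  assumes "p \<in> positions n" "q \<in> positions n" "p \<noteq> q"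
  shows "(\<integral>v. bias n v p * bias n v q \<partial>gauss (positions n)) = exp (-1) * sinh (hadamard_swap n p q) / 4"
proof -
  have "(\<integral>v. bias n v p * bias n v q \<partial>gauss (positions n)) =
     (\<integral>v. sin (\<Sum>r\<in>positions n. forr_vec n p r * v r) * sin (\<Sum>r\<in>positions n. forr_vec n q r * v r) / 4 \<partial>gauss (positions n))"
    by (simp add: bias_def)
  also have "\<dots> = exp (-1) * sinh (hadamard_swap n p q) / 4"
    using forr_vec_inner[OF assms(1,1)] forr_vec_inner[OF assms(2,2)] forr_vec_inner[OF assms(1,2)] assms(3)
    by (simp add: integral_gauss_sin_sin power2_eq_square)
  finally show ?thesis .
qed

text \<open>Product-to-sum formulas on each side turn four sines into products of two cosines. Forms
  on the same side are orthogonal, so their sums and differences have squared norm 2, whence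
  exp(-2); 1/64 is 1/16 from the biases times 1/4 from the two formulas.\<close>

lemma integral_bias_quadruple:
  assumes "x \<in> cube n" "x' \<in> cube n" "x \<noteq> x'" "y \<in> cube n" "y' \<in> cube n" "y \<noteq> y'"
  defines "H \<equiv> hadamard n"
  shows "(\<integral>v. bias n v (Inl x) * bias n v (Inl x') * (bias n v (Inr y) * bias n v (Inr y')) \<partial>gauss (positions n)) =
    exp (-2) / 64 * (cosh (H x y - H x y' - H x' y + H x' y') - cosh (H x y + H x y' - H x' y - H x' y')
       - cosh (H x y - H x y' + H x' y - H x' y') + cosh (H x y + H x y' + H x' y + H x' y'))"
proof -
  let ?K = "positions n" and ?c = "forr_vec n"
  have in_K: "Inl x \<in> ?K" "Inl x' \<in> ?K" "Inr y \<in> ?K" "Inr y' \<in> ?K" using assms by auto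
  define I where "I c d v = cos (\<Sum>r\<in>?K. c r * v r) * cos (\<Sum>r\<in>?K. d r * v r)" for c d v :: "position \<Rightarrow> real"
  have int: "integrable (gauss ?K) (I c d)" for c d
    unfolding I_def by (rule integrable_gauss_cos_cos)
  let ?am = "\<lambda>r. ?c (Inl x) r - ?c (Inl x') r" and ?ap = "\<lambda>r. ?c (Inl x) r + ?c (Inl x') r"
  let ?bm = "\<lambda>r. ?c (Inr y) r - ?c (Inr y') r" and ?bp = "\<lambda>r. ?c (Inr y) r + ?c (Inr y') r"
  have sines: "bias n v (Inl x) * bias n v (Inl x') * (bias n v (Inr y) * bias n v (Inr y')) =
      (I ?am ?bm v - I ?am ?bp v - I ?ap ?bm v + I ?ap ?bp v) / 64" for v
  proof -
    have "bias n v p * bias n v q = (cos (\<Sum>r\<in>?K. (?c p r - ?c q r) * v r) - cos (\<Sum>r\<in>?K. (?c p r + ?c q r) * v r)) / 8" for p q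
      by (simp add: bias_def sin_times_sin sum_linear_combination)
    moreover have "((a - b) / 8) * ((c - d) / 8) = (a * c - a * d - b * c + b * d) / 64" for a b c d :: real
      by (simp add: algebra_simps)
    ultimately show ?thesis unfolding I_def by (simp only:)
  qed
  have inner: "(\<Sum>r\<in>?K. ?c p r * ?c q r) = of_bool (p = q) + hadamard_swap n p q"
    if "p \<in> ?K" "q \<in> ?K" for p q using forr_vec_inner[OF that] .
  have sq: "(\<Sum>r\<in>?K. (?am r)\<^sup>2) = 2" "(\<Sum>r\<in>?K. (?ap r)\<^sup>2) = 2" "(\<Sum>r\<in>?K. (?bm r)\<^sup>2) = 2" "(\<Sum>r\<in>?K. (?bp r)\<^sup>2) = 2"
    unfolding sum_square_combination unfolding power2_eq_square
    using in_K assms(3,6) by (simp_all add: inner del: forr_vec.simps)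
  have I: "(\<integral>v. I c d v \<partial>gauss ?K) = exp (-2) * cosh (\<Sum>r\<in>?K. c r * d r)"
    if "(\<Sum>r\<in>?K. (c r)\<^sup>2) = 2" "(\<Sum>r\<in>?K. (d r)\<^sup>2) = 2" for c d
    unfolding I_def integral_gauss_cos_cos[OF finite_positions] that by simp
  have cross: "(\<Sum>r\<in>?K. ?am r * ?bm r) = H x y - H x y' - H x' y + H x' y'"
     "(\<Sum>r\<in>?K. ?am r * ?bp r) = H x y + H x y' - H x' y - H x' y'"
     "(\<Sum>r\<in>?K. ?ap r * ?bm r) = H x y - H x y' + H x' y - H x' y'"
     "(\<Sum>r\<in>?K. ?ap r * ?bp r) = H x y + H x y' + H x' y + H x' y'"
    using in_K by (simp_all add: algebra_simps sum.distrib sum_subtractf inner H_def del: forr_vec.simps)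
  have "(\<integral>v. (I ?am ?bm v - I ?am ?bp v - I ?ap ?bm v + I ?ap ?bp v) / 64 \<partial>gauss ?K) =
    ((\<integral>v. I ?am ?bm v \<partial>gauss ?K) - (\<integral>v. I ?am ?bp v \<partial>gauss ?K) - (\<integral>v. I ?ap ?bm v \<partial>gauss ?K)
      + (\<integral>v. I ?ap ?bp v \<partial>gauss ?K)) / 64"
    by (simp add: int del: forr_vec.simps)
  then show ?thesis
    unfolding sines I[OF sq(1,3)] I[OF sq(1,4)] I[OF sq(2,3)] I[OF sq(2,4)] cross
    by (simp add: algebra_simps)
qed

text \<open>Up to signs, only the parity of the number of negative entries of the matrix matters.\<close>

lemma cosh_sign_matrix:
  fixes s :: real
  assumes "a \<in> {s, -s}" "b \<in> {s, -s}" "c \<in> {s, -s}" "d \<in> {s, -s}" "s \<noteq> 0"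
  shows "a * d * (cosh (a - b - c + d) - cosh (a + b - c - d) - cosh (a - b + c - d) + cosh (a + b + c + d)) =
    (cosh (4 * s) - 1) * (s\<^sup>2 + a * b * c * d / s\<^sup>2) / 2"
proof -
  have *: "s + s + s + s = 4 * s" "- s - s - s - s = - (4 * s)" "cosh (- (4 * s)) = cosh (4 * s)" by simp_all
  show ?thesis using assms by (auto simp: * power2_eq_square field_simps)
qed

lemma square_le_mult_sinh: "x\<^sup>2 \<le> x * sinh x" for x :: real
proof -
  have *: "y \<le> sinh y" if "y \<ge> 0" for y :: real
    using real_le_x_sinh[OF that] by (simp add: sinh_def exp_minus)
  show ?thesis
  proof (cases "x \<ge> 0")
    case True
    then show ?thesis using mult_left_mono[OF *[OF True] True] by (simp add: power2_eq_square)
  next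
    case False
    then show ?thesis using mult_left_mono[OF *[of "- x"], of "- x"] by (simp add: power2_eq_square)
  qed
qed

section \<open>First and second moments of Phi under both distributions\<close>

definition table_Phi :: "nat \<Rightarrow> (position \<Rightarrow> real) \<Rightarrow> real" where
  "table_Phi n h = Phi n (\<lambda>x. h (Inl x)) (\<lambda>y. h (Inr y))"

lemma table_Phi_eq:
  "table_Phi n h = (1 / 2 ^ n) * (\<Sum>x\<in>cube n. \<Sum>y\<in>cube n. hadamard n x y * (h (Inl x) * h (Inr y)))"
  by (simp add: table_Phi_def Phi_hadamard mult_ac)

lemma sum_sum_hadamard_square: "(\<Sum>x\<in>cube n. \<Sum>y\<in>cube n. (hadamard n x y)\<^sup>2) = 2 ^ n"
  by (simp add: hadamard_square)

text \<open>Each entry contributes with the right sign, as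
  \<open>x * sinh x \<ge> x\<^sup>2\<close>, and the squared entries of the Hadamard matrix sum to
  N.\<close>

lemma forr_mean_Phi:
  "exp (-1) / 4 \<le> avg (positions n) (\<lambda>h. table_Phi n h * likelihood n (positions n) h)"
proof -
  have E: "avg (positions n) (\<lambda>h. h (Inl x) * h (Inr y) * likelihood n (positions n) h) = exp (-1) * sinh (hadamard n x y) / 4"
    if "x \<in> cube n" "y \<in> cube n" for x y
    using avg_prod_likelihood[of "{Inl x, Inr y}" n] integral_bias_bias[of "Inl x" n "Inr y"] that by simp
  have "(\<Sum>x\<in>cube n. \<Sum>y\<in>cube n. hadamard n x y *
      avg (positions n) (\<lambda>h. h (Inl x) * h (Inr y) * likelihood n (positions n) h)) =
      exp (-1) / 4 * (\<Sum>x\<in>cube n. \<Sum>y\<in>cube n. hadamard n x y * sinh (hadamard n x y))"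
    unfolding sum_distrib_left by (intro sum.cong refl) (simp add: E)
  also have "\<dots> \<ge> exp (-1) / 4 * (\<Sum>x\<in>cube n. \<Sum>y\<in>cube n. (hadamard n x y)\<^sup>2)"
    by (intro mult_left_mono sum_mono square_le_mult_sinh) auto
  finally have S: "exp (-1) / 4 * 2 ^ n \<le> (\<Sum>x\<in>cube n. \<Sum>y\<in>cube n. hadamard n x y *
      avg (positions n) (\<lambda>h. h (Inl x) * h (Inr y) * likelihood n (positions n) h))"
    unfolding sum_sum_hadamard_square .
  moreover have "avg (positions n) (\<lambda>h. table_Phi n h * likelihood n (positions n) h) =
      (1 / 2 ^ n) * (\<Sum>x\<in>cube n. \<Sum>y\<in>cube n. hadamard n x y *
      avg (positions n) (\<lambda>h. h (Inl x) * h (Inr y) * likelihood n (positions n) h))"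
    unfolding table_Phi_eq mult.assoc sum_distrib_right avg_mult_left avg_sum ..
  ultimately show ?thesis using mult_left_mono[OF S, of "1 / 2 ^ n"] by simp
qed

text \<open>The positions that occur an odd number of times among the four factors of a term of the
  squared \<open>Phi\<close>; the others cancel, as signs square to 1.\<close>

definition odd_support :: "bool list \<Rightarrow> bool list \<Rightarrow> bool list \<Rightarrow> bool list \<Rightarrow> position set" where
  "odd_support x y x' y' =
     (if x = x' then {} else {Inl x, Inl x'}) \<union> (if y = y' then {} else {Inr y, Inr y'})"

lemma odd_support_empty_iff: "odd_support x y x' y' = {} \<longleftrightarrow> x = x' \<and> y = y'"
  by (simp add: odd_support_def)

lemma prod_odd_support:
  assumes "h \<in> signs (positions n)" "x \<in> cube n" "y \<in> cube n"
  shows "h (Inl x) * h (Inr y) * (h (Inl x') * h (Inr y')) = (\<Prod>p\<in>odd_support x y x' y'. h p)"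
proof -
  have "h (Inl x) * h (Inl x) = 1" "h (Inr y) * h (Inr y) = 1"
    using signs_cases[OF assms(1), of "Inl x"] signs_cases[OF assms(1), of "Inr y"] assms(2,3) by auto
  then show ?thesis by (auto simp: odd_support_def mult_ac)
qed

text \<open>The weight \<open>w\<close> is 1 for the uniform distribution and the likelihood ratio
  for the biased one.\<close>

lemma avg_Phi_square:
  "avg (positions n) (\<lambda>h. (table_Phi n h)\<^sup>2 * w h) = (1 / (2 ^ n)\<^sup>2) *
     (\<Sum>x\<in>cube n. \<Sum>y\<in>cube n. \<Sum>x'\<in>cube n. \<Sum>y'\<in>cube n. hadamard n x y * hadamard n x' y' *
        avg (positions n) (\<lambda>h. (\<Prod>p\<in>odd_support x y x' y'. h p) * w h))"
proof -
  have "avg (positions n) (\<lambda>h. (table_Phi n h)\<^sup>2 * w h) = avg (positions n) (\<lambda>h. (1 / (2 ^ n)\<^sup>2) *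
     (\<Sum>x\<in>cube n. \<Sum>y\<in>cube n. \<Sum>x'\<in>cube n. \<Sum>y'\<in>cube n. hadamard n x y * hadamard n x' y' *
        ((\<Prod>p\<in>odd_support x y x' y'. h p) * w h)))"
  proof (rule avg_cong)
    fix h assume h: "h \<in> signs (positions n)"
    let ?t = "\<lambda>x y. hadamard n x y * (h (Inl x) * h (Inr y))"
    have "(table_Phi n h)\<^sup>2 * w h = (1 / (2 ^ n)\<^sup>2) * ((\<Sum>x\<in>cube n. \<Sum>y\<in>cube n. ?t x y) * (\<Sum>x'\<in>cube n. \<Sum>y'\<in>cube n. ?t x' y') * w h)"
      by (simp add: table_Phi_eq power2_eq_square)
    also have "(\<Sum>x\<in>cube n. \<Sum>y\<in>cube n. ?t x y) * (\<Sum>x'\<in>cube n. \<Sum>y'\<in>cube n. ?t x' y') * w h =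
       (\<Sum>x\<in>cube n. \<Sum>y\<in>cube n. \<Sum>x'\<in>cube n. \<Sum>y'\<in>cube n. ?t x y * ?t x' y' * w h)"
      unfolding sum_distrib_right unfolding sum_distrib_left sum_distrib_right ..
    also have "\<dots> = (\<Sum>x\<in>cube n. \<Sum>y\<in>cube n. \<Sum>x'\<in>cube n. \<Sum>y'\<in>cube n. hadamard n x y * hadamard n x' y' *
        ((\<Prod>p\<in>odd_support x y x' y'. h p) * w h))"
      by (intro sum.cong refl) (simp add: prod_odd_support[OF h, symmetric] mult_ac)
    finally show "(table_Phi n h)\<^sup>2 * w h = (1 / (2 ^ n)\<^sup>2) *
     (\<Sum>x\<in>cube n. \<Sum>y\<in>cube n. \<Sum>x'\<in>cube n. \<Sum>y'\<in>cube n. hadamard n x y * hadamard n x' y' *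
        ((\<Prod>p\<in>odd_support x y x' y'. h p) * w h))" .
  qed
  then show ?thesis by (simp only: avg_mult_left avg_sum)
qed

lemma sum_hadamard_pairs:
  "(\<Sum>x\<in>cube n. \<Sum>y\<in>cube n. \<Sum>x'\<in>cube n. \<Sum>y'\<in>cube n. if x = x' \<and> y = y' then 1 / 2 ^ n else 0) = (2 ^ n :: real)"
proof -
  have "(\<Sum>x'\<in>cube n. \<Sum>y'\<in>cube n. if x = x' \<and> y = y' then 1 / 2 ^ n else 0) = (1 / 2 ^ n :: real)"
    if "x \<in> cube n" "y \<in> cube n" for x y
  proof -
    have "(\<Sum>x'\<in>cube n. \<Sum>y'\<in>cube n. if x = x' \<and> y = y' then 1 / 2 ^ n else 0) =
        (\<Sum>x'\<in>cube n. if x = x' then \<Sum>y'\<in>cube n. if y = y' then 1 / 2 ^ n else 0 else (0 :: real))"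
      by (intro sum.cong refl) auto
    then show ?thesis using that by simp
  qed
  then show ?thesis by (simp cong: sum.cong)
qed

lemma uniform_Phi_square: "avg (positions n) (\<lambda>h. (table_Phi n h)\<^sup>2) = 1 / 2 ^ n"
proof -
  have *: "avg (positions n) (\<lambda>h. \<Prod>p\<in>S. h p) = of_bool (S = {})" if "S \<subseteq> positions n" for S
  proof -
    have "avg (positions n) (\<lambda>h. \<Prod>p\<in>S. h p) = (\<Prod>k\<in>positions n. of_bool (k \<notin> S))"
      using avg_prod[OF finite_positions, of n "\<lambda>k s. if k \<in> S then s else 1"] that
      by (auto simp: prod_if_subset intro!: prod.cong elim!: trans)
    also have "\<dots> = of_bool (S = {})"
    proof (cases "S = {}")
      case False
      then show ?thesis using that by (auto intro!: prod_zero)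
    qed simp
    finally show ?thesis .
  qed
  have "(\<Sum>x\<in>cube n. \<Sum>y\<in>cube n. \<Sum>x'\<in>cube n. \<Sum>y'\<in>cube n. hadamard n x y * hadamard n x' y' *
        avg (positions n) (\<lambda>h. (\<Prod>p\<in>odd_support x y x' y'. h p) * 1)) =
     (\<Sum>x\<in>cube n. \<Sum>y\<in>cube n. \<Sum>x'\<in>cube n. \<Sum>y'\<in>cube n. if x = x' \<and> y = y' then 1 / 2 ^ n else 0)"
  proof (intro sum.cong refl)
    fix x y x' y' assume "x \<in> cube n" "y \<in> cube n" "x' \<in> cube n" "y' \<in> cube n"
    then have "odd_support x y x' y' \<subseteq> positions n" by (auto simp: odd_support_def)
    then show "hadamard n x y * hadamard n x' y' * avg (positions n) (\<lambda>h. (\<Prod>p\<in>odd_support x y x' y'. h p) * 1) =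
       (if x = x' \<and> y = y' then 1 / 2 ^ n else 0)"
      by (simp add: * odd_support_empty_iff hadamard_square flip: power2_eq_square)
  qed
  then show ?thesis
    using avg_Phi_square[of n "\<lambda>_. 1"] by (simp add: sum_hadamard_pairs power2_eq_square)
qed

text \<open>If exactly one coordinate is shared, two orthogonal forms of one side remain and the
  moment is 0; if none is, \<open>cosh_sign_matrix\<close> gives the last term exactly. That term is
  nonnegative, so it can be granted to every quadruple, which makes the later sums
  unrestricted.\<close>

lemma forr_quadruple_le:
  assumes cubes: "x \<in> cube n" "y \<in> cube n" "x' \<in> cube n" "y' \<in> cube n"
  defines "H \<equiv> hadamard n"
  shows "H x y * H x' y' * avg (positions n) (\<lambda>h. (\<Prod>p\<in>odd_support x y x' y'. h p) * likelihood n (positions n) h) \<le>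
    (if x = x' \<and> y = y' then 1 / 2 ^ n else 0) +
    exp (-2) / 128 * (cosh (4 / sqrt (2 ^ n)) - 1) * (1 / 2 ^ n + H x y * H x y' * H x' y * H x' y' * 2 ^ n)"
proof -
  let ?b = "bias n" and ?K = "positions n"
  define s where "s = 1 / sqrt (2 ^ n)"
  have s: "s \<noteq> 0" "s\<^sup>2 = 1 / 2 ^ n" "4 / sqrt (2 ^ n) = 4 * s" by (auto simp: s_def power_divide)
  have H: "H a b \<in> {s, - s}" for a b
    using abs_hadamard[of n a b] by (auto simp: H_def s_def abs_if split: if_splits)
  define R where "R = exp (-2) / 128 * (cosh (4 * s) - 1) * (1 / 2 ^ n + H x y * H x y' * H x' y * H x' y' * 2 ^ n)"
  have "0 \<le> 1 / 2 ^ n + H x y * H x y' * H x' y * H x' y' * 2 ^ n"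
  proof -
    have "H x y * H x y' * H x' y * H x' y' \<in> {s\<^sup>2 * s\<^sup>2, - (s\<^sup>2 * s\<^sup>2)}"
      using H[of x y] H[of x y'] H[of x' y] H[of x' y'] by (auto simp: power2_eq_square)
    then show ?thesis by (auto simp: s)
  qed
  then have R: "R \<ge> 0" unfolding R_def by (intro mult_nonneg_nonneg) (auto simp: cosh_real_ge_1)
  have sub: "odd_support x y x' y' \<subseteq> ?K" using cubes by (auto simp: odd_support_def)
  note E = avg_prod_likelihood[OF sub]
  consider "x = x'" "y = y'" | "x = x'" "y \<noteq> y'" | "x \<noteq> x'" "y = y'" | "x \<noteq> x'" "y \<noteq> y'" by blast
  then have "H x y * H x' y' * (\<integral>v. (\<Prod>p\<in>odd_support x y x' y'. ?b v p) \<partial>gauss ?K) \<le>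
      (if x = x' \<and> y = y' then 1 / 2 ^ n else 0) + R"
  proof cases
    case 1
    interpret P: prob_space "gauss ?K" by (rule prob_space_gauss)
    have "(\<integral>v. (\<Prod>p\<in>odd_support x y x' y'. ?b v p) \<partial>gauss ?K) = 1"
      using 1 P.prob_space by (simp add: odd_support_def)
    then show ?thesis using 1 R by (simp add: H_def hadamard_square flip: power2_eq_square)
  next
    case 2
    have "(\<integral>v. (\<Prod>p\<in>odd_support x y x' y'. ?b v p) \<partial>gauss ?K) = 0"
      using 2 cubes integral_bias_bias[of "Inr y" n "Inr y'"] by (simp add: odd_support_def)
    then show ?thesis using 2 R by simp
  next
    case 3
    have "(\<integral>v. (\<Prod>p\<in>odd_support x y x' y'. ?b v p) \<partial>gauss ?K) = 0"
      using 3 cubes integral_bias_bias[of "Inl x" n "Inl x'"] by (simp add: odd_support_def)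
    then show ?thesis using 3 R by simp
  next
    case 4
    have "(\<integral>v. (\<Prod>p\<in>odd_support x y x' y'. ?b v p) \<partial>gauss ?K) =
        (\<integral>v. ?b v (Inl x) * ?b v (Inl x') * (?b v (Inr y) * ?b v (Inr y')) \<partial>gauss ?K)"
      using 4 by (simp add: odd_support_def mult_ac)
    also have "\<dots> = exp (-2) / 64 * (cosh (H x y - H x y' - H x' y + H x' y') - cosh (H x y + H x y' - H x' y - H x' y')
       - cosh (H x y - H x y' + H x' y - H x' y') + cosh (H x y + H x y' + H x' y + H x' y'))"
      unfolding H_def using 4 cubes by (intro integral_bias_quadruple) auto
    finally have "H x y * H x' y' * (\<integral>v. (\<Prod>p\<in>odd_support x y x' y'. ?b v p) \<partial>gauss ?K) =
       exp (-2) / 64 * (H x y * H x' y' * (cosh (H x y - H x y' - H x' y + H x' y') - cosh (H x y + H x y' - H x' y - H x' y')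
       - cosh (H x y - H x y' + H x' y - H x' y') + cosh (H x y + H x y' + H x' y + H x' y')))"
      by (simp only: mult_ac)
    also have "\<dots> = R"
      unfolding cosh_sign_matrix[OF H H H H s(1)] by (simp add: R_def s)
    finally show ?thesis using 4 by simp
  qed
  then show ?thesis unfolding E R_def s(3) .
qed

text \<open>The squared Frobenius norm of the Gram matrix of the rows, which is the identity of size
  N.\<close>

lemma sum_quadruple_hadamard:
  "(\<Sum>x\<in>cube n. \<Sum>y\<in>cube n. \<Sum>x'\<in>cube n. \<Sum>y'\<in>cube n.
     hadamard n x y * hadamard n x y' * hadamard n x' y * hadamard n x' y') = 2 ^ n"
proof -
  let ?H = "hadamard n"
  have "(\<Sum>x\<in>cube n. \<Sum>y\<in>cube n. \<Sum>x'\<in>cube n. \<Sum>y'\<in>cube n. ?H x y * ?H x y' * ?H x' y * ?H x' y') =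
      (\<Sum>x\<in>cube n. \<Sum>x'\<in>cube n. \<Sum>y\<in>cube n. \<Sum>y'\<in>cube n. ?H x y * ?H x y' * ?H x' y * ?H x' y')"
    by (intro sum.cong refl sum.swap)
  also have "\<dots> = (\<Sum>x\<in>cube n. \<Sum>x'\<in>cube n. (\<Sum>y\<in>cube n. ?H x y * ?H x' y) * (\<Sum>y'\<in>cube n. ?H x y' * ?H x' y'))"
    unfolding sum_product by (intro sum.cong refl) (simp add: mult_ac)
  also have "\<dots> = (\<Sum>x\<in>cube n. \<Sum>x'\<in>cube n. if x = x' then 1 else 0)"
    by (intro sum.cong refl) (simp add: sum_hadamard_hadamard)
  finally show ?thesis by simp
qed

lemma forr_Phi_square:
  "avg (positions n) (\<lambda>h. (table_Phi n h)\<^sup>2 * likelihood n (positions n) h) \<le>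
    1 / 2 ^ n + exp (-2) / 128 * (cosh (4 / sqrt (2 ^ n)) - 1) * (2 ^ n + 1)"
proof -
  let ?H = "hadamard n" and ?N = "2 ^ n :: real"
  let ?c = "exp (-2) / 128 * (cosh (4 / sqrt (2 ^ n)) - 1) :: real"
  have "(\<Sum>x\<in>cube n. \<Sum>y\<in>cube n. \<Sum>x'\<in>cube n. \<Sum>y'\<in>cube n. hadamard n x y * hadamard n x' y' *
        avg (positions n) (\<lambda>h. (\<Prod>p\<in>odd_support x y x' y'. h p) * likelihood n (positions n) h)) \<le>
     (\<Sum>x\<in>cube n. \<Sum>y\<in>cube n. \<Sum>x'\<in>cube n. \<Sum>y'\<in>cube n. (if x = x' \<and> y = y' then 1 / ?N else 0) +
       ?c * (1 / ?N + ?H x y * ?H x y' * ?H x' y * ?H x' y' * ?N))"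
    by (intro sum_mono forr_quadruple_le)
  also have "\<dots> = ?N + ?c * (?N * (?N * (?N * (?N * (1 / ?N)))) + ?N * ?N)"
    unfolding sum.distrib sum_hadamard_pairs
    unfolding sum_distrib_left[symmetric] sum.distrib sum_distrib_right[symmetric] sum_quadruple_hadamard
    by simp
  also have "\<dots> = ?N\<^sup>2 * (1 / ?N + ?c * (?N + 1))"
    by (simp add: power2_eq_square field_simps)
  finally have "(1 / ?N\<^sup>2) * (\<Sum>x\<in>cube n. \<Sum>y\<in>cube n. \<Sum>x'\<in>cube n. \<Sum>y'\<in>cube n. hadamard n x y * hadamard n x' y' *
        avg (positions n) (\<lambda>h. (\<Prod>p\<in>odd_support x y x' y'. h p) * likelihood n (positions n) h)) \<le>
      (1 / ?N\<^sup>2) * (?N\<^sup>2 * (1 / ?N + ?c * (?N + 1)))"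
    by (intro mult_left_mono) auto
  then show ?thesis unfolding avg_Phi_square by simp
qed

text \<open>\<open>cosh (4 / sqrt N) - 1\<close> is asymptotically 8/N, so the bound on the second
  moment tends to exp(-2)/16, the square of the lower bound exp(-1)/4 on the mean; no variance is
  left in the limit.\<close>

lemma forr_variance_tendsto_0:
  "((\<lambda>n. 1 / 2 ^ n + exp (-2) / 128 * (cosh (4 / sqrt (2 ^ n)) - 1) * (2 ^ n + 1) - exp (-2) / 16) \<longlongrightarrow> (0 :: real)) sequentially"
proof -
  have "((\<lambda>N. 1 / N + exp (-2) / 128 * ((exp (4 / sqrt N) + exp (- (4 / sqrt N))) / 2 - 1) * (N + 1) - exp (-2) / 16) \<longlongrightarrow> (0 :: real)) at_top"
    by real_asymp
  then have "((\<lambda>N. 1 / N + exp (-2) / 128 * (cosh (4 / sqrt N) - 1) * (N + 1) - exp (-2) / 16) \<longlongrightarrow> (0 :: real)) at_top"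
    by (simp add: cosh_def)
  moreover have "filterlim (\<lambda>n. 2 ^ n :: real) at_top sequentially"
    by real_asymp
  ultimately show ?thesis by (rule filterlim_compose)
qed

section \<open>The classical lower bound\<close>

lemma sum_square_diff_boolean:
  assumes "f \<in> boolean_functions n" "f' \<in> boolean_functions n"
  shows "(\<Sum>x\<in>cube n. (f x - f' x)\<^sup>2) = 4 * real (card {x \<in> cube n. f x \<noteq> f' x})"
proof -
  have "(\<Sum>x\<in>cube n. (f x - f' x)\<^sup>2) = (\<Sum>x\<in>cube n. if f x \<noteq> f' x then 4 else 0)"
  proof (rule sum.cong[OF refl])
    fix x assume "x \<in> cube n"
    then have "f x \<in> {-1, 1}" "f' x \<in> {-1, 1}" using assms by (auto simp: boolean_functions_def PiE_def Pi_def)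
    then show "(f x - f' x)\<^sup>2 = (if f x \<noteq> f' x then 4 else 0)" by auto
  qed
  also have "\<dots> = (\<Sum>x\<in>{x \<in> cube n. f x \<noteq> f' x}. 4)"
    by (rule sum.inter_filter[symmetric]) simp
  finally show ?thesis by simp
qed

text \<open>Exchanging \<open>f\<close> and then \<open>g\<close>, each difference is a bilinear
  form in which one vector is a truth table, of squared norm N, and the other has squared norm four
  times the number of changed values.\<close>

lemma Phi_diff_le:
  assumes "f \<in> boolean_functions n" "g \<in> boolean_functions n" "f' \<in> boolean_functions n" "g' \<in> boolean_functions n"
  shows "(Phi n f g - Phi n f' g')\<^sup>2 * 2 ^ n \<le> 8 * real (card {p \<in> positions n. case_sum f g p \<noteq> case_sum f' g' p})"
proof -
  let ?N = "2 ^ n :: real" and ?H = "hadamard n"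
  define a where "a = card {x \<in> cube n. f x \<noteq> f' x}"
  define b where "b = card {y \<in> cube n. g y \<noteq> g' y}"
  have "{p \<in> positions n. case_sum f g p \<noteq> case_sum f' g' p} = {x \<in> cube n. f x \<noteq> f' x} <+> {y \<in> cube n. g y \<noteq> g' y}"
    by (auto simp: positions_def)
  then have card: "card {p \<in> positions n. case_sum f g p \<noteq> case_sum f' g' p} = a + b"
    by (simp add: a_def b_def card_Plus)
  have "(Phi n f g - Phi n f' g') * ?N =
      (\<Sum>x\<in>cube n. \<Sum>y\<in>cube n. (f x - f' x) * ?H x y * g y) + (\<Sum>x\<in>cube n. \<Sum>y\<in>cube n. f' x * ?H x y * (g y - g' y))"
    unfolding Phi_hadamard sum.distrib[symmetric] diff_divide_distrib[symmetric] sum_subtractf[symmetric]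
    by (simp add: algebra_simps)
  then have "\<bar>(Phi n f g - Phi n f' g') * ?N\<bar> \<le> sqrt (4 * real a) * sqrt ?N + sqrt ?N * sqrt (4 * real b)"
    using sum_hadamard_le[where n = n and f = "\<lambda>x. f x - f' x" and g = g]
      sum_hadamard_le[where n = n and f = f' and g = "\<lambda>y. g y - g' y"]
    unfolding sum_square_diff_boolean[OF assms(1,3)] sum_square_diff_boolean[OF assms(2,4)]
      sum_boolean_functions_square[OF assms(2)] sum_boolean_functions_square[OF assms(3)] a_def b_def
    by linarith
  also have "\<dots> = (2 * sqrt ?N) * (sqrt a + sqrt b)"
    by (simp add: real_sqrt_mult algebra_simps)
  finally have "((Phi n f g - Phi n f' g') * ?N)\<^sup>2 \<le> ((2 * sqrt ?N) * (sqrt a + sqrt b))\<^sup>2"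
    by (intro power2_le_iff_abs_le[THEN iffD2]) (auto simp: abs_mult)
  also have "\<dots> = 4 * ?N * (sqrt a + sqrt b)\<^sup>2" by (simp add: power_mult_distrib)
  also have "(sqrt a + sqrt b)\<^sup>2 \<le> 2 * (real a + real b)"
    using zero_le_power2[of "sqrt a - sqrt b"] by (simp add: power2_sum power2_diff)
  finally have "((Phi n f g - Phi n f' g')\<^sup>2 * ?N) * ?N \<le> (8 * real (a + b)) * ?N"
    by (simp add: power_mult_distrib power2_eq_square mult_ac)
  then show ?thesis unfolding card by (rule mult_right_le_imp_le) simp
qed

text \<open>The gap 1/20 - 1/100 = 1/25 forces at least N/5000 differing values, whence 1/10000. The
  value 1/20 leaves room both to 1/100 and to the mean 1/(4e), which exceeds 9/100.\<close>

lemma Far_pairs_of_Phi: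
  assumes "f \<in> boolean_functions n" "g \<in> boolean_functions n" "1 / 20 \<le> Phi n f g" "\<epsilon> \<le> 1 / 10000"
  shows "(f, g) \<in> Far_pairs n \<epsilon>"
proof -
  have "\<epsilon> * 2 * 2 ^ n \<le> real (card {p \<in> positions n. case_sum f g p \<noteq> case_sum f' g' p})"
    if "(f', g') \<in> Yes_pairs n" for f' g'
  proof -
    have Y: "f' \<in> boolean_functions n" "g' \<in> boolean_functions n" "Phi n f' g' \<le> 1 / 100"
      using that by (auto simp: Yes_pairs_def)
    have "(1 / 25)\<^sup>2 \<le> (Phi n f g - Phi n f' g')\<^sup>2"
      using Y(3) assms(3) by (intro power_mono) auto
    then have "(1 / 25)\<^sup>2 * 2 ^ n \<le> (Phi n f g - Phi n f' g')\<^sup>2 * 2 ^ n"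
      by (intro mult_right_mono) auto
    also note Phi_diff_le[OF assms(1,2) Y(1,2)]
    finally have "2 ^ n / 5000 \<le> real (card {p \<in> positions n. case_sum f g p \<noteq> case_sum f' g' p})"
      by (simp add: power2_eq_square)
    moreover have "\<epsilon> * 2 * 2 ^ n \<le> 1 / 10000 * 2 * 2 ^ n"
      using assms(4) by (intro mult_right_mono) auto
    ultimately show ?thesis by linarith
  qed
  with assms(1,2) show ?thesis by (auto simp: Far_pairs_def)
qed

section \<open>From decision trees to randomized testers\<close>

lemma run_dtree_cong:
  "(\<And>p. p \<in> set_dtree t \<Longrightarrow> h p = h' p) \<Longrightarrow> run_dtree h t = run_dtree h' t"
  by (induction t) auto

lemma rand_accept_prob_cong:
  assumes "randomized_algorithm n T R" "\<And>p. p \<in> positions n \<Longrightarrow> h p = h' p"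
  shows "rand_accept_prob R h = rand_accept_prob R h'"
  unfolding rand_accept_prob_def
proof (rule measure_prob_cong_0)
  fix t assume "t \<in> {t. run_dtree h t} - {t. run_dtree h' t}"
  then have "run_dtree h t \<noteq> run_dtree h' t" by simp
  then have "t \<notin> set_pmf R"
    using assms run_dtree_cong[of t h h'] by (auto simp: randomized_algorithm_def subset_eq)
  then show "pmf R t = 0" by (simp add: pmf_eq_0_set_pmf)
next
  fix t assume "t \<in> {t. run_dtree h' t} - {t. run_dtree h t}"
  then have "run_dtree h t \<noteq> run_dtree h' t" by simp
  then have "t \<notin> set_pmf R"
    using assms run_dtree_cong[of t h h'] by (auto simp: randomized_algorithm_def subset_eq)
  then show "pmf R t = 0" by (simp add: pmf_eq_0_set_pmf)
qed

lemma tests_on_signs: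
  assumes alg: "randomized_algorithm n T R" and test: "tests_with_error n \<epsilon> \<delta> (rand_accept_prob R)"
    and h: "h \<in> signs (positions n)"
  shows "table_Phi n h \<le> 1 / 100 \<Longrightarrow> 1 - \<delta> \<le> rand_accept_prob R h"
    and "1 / 20 \<le> table_Phi n h \<Longrightarrow> \<epsilon> \<le> 1 / 10000 \<Longrightarrow> rand_accept_prob R h \<le> \<delta>"
proof -
  define f where "f = (\<lambda>x\<in>cube n. h (Inl x))"
  define g where "g = (\<lambda>y\<in>cube n. h (Inr y))"
  have bf: "f \<in> boolean_functions n" "g \<in> boolean_functions n"
    using h by (auto simp: f_def g_def boolean_functions_def signs_def PiE_def Pi_def)
  have Phi: "Phi n f g = table_Phi n h"
    unfolding Phi_def table_Phi_def f_def g_def by (simp cong: sum.cong)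
  have acc: "rand_accept_prob R (case_sum f g) = rand_accept_prob R h"
    by (rule rand_accept_prob_cong[OF alg]) (auto simp: positions_def f_def g_def)
  show "1 - \<delta> \<le> rand_accept_prob R h" if "table_Phi n h \<le> 1 / 100"
  proof -
    have "(f, g) \<in> Yes_pairs n" using bf that Phi by (simp add: Yes_pairs_def)
    then show ?thesis using test acc by (auto simp: tests_with_error_def)
  qed
  show "rand_accept_prob R h \<le> \<delta>" if "1 / 20 \<le> table_Phi n h" "\<epsilon> \<le> 1 / 10000"
  proof -
    have "(f, g) \<in> Far_pairs n \<epsilon>" using bf that Phi by (intro Far_pairs_of_Phi) auto
    then show ?thesis using test acc by (auto simp: tests_with_error_def)
  qed
qed

lemma avg_rand_accept_prob:
  "avg K (\<lambda>h. rand_accept_prob R h * w h) =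
    measure_pmf.expectation R (\<lambda>t. avg K (\<lambda>h. of_bool (run_dtree h t) * w h))"
proof -
  have acc: "rand_accept_prob R h = measure_pmf.expectation R (\<lambda>t. of_bool (run_dtree h t))" for h
  proof -
    have "(\<lambda>t. of_bool (run_dtree h t) :: real) = indicator {t. run_dtree h t}"
      by (auto simp: indicator_def fun_eq_iff)
    then show ?thesis by (simp add: rand_accept_prob_def)
  qed
  have "integrable (measure_pmf R) (\<lambda>t. of_bool (run_dtree h t) * c :: real)" for h c
    by (rule measure_pmf.integrable_const_bound[where B = "\<bar>c\<bar>"]) auto
  then show ?thesis
    unfolding avg_def acc by (simp add: Bochner_Integration.integral_sum)
qed

lemma randomized_indistinguishable:
  assumes alg: "randomized_algorithm n T R"
    and \<kappa>: "0 < \<kappa>" "\<kappa> \<le> 1" and n: "n \<ge> 1"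
    and X: "1 \<le> \<kappa> * sqrt (2 ^ n) / real n" "real T \<le> \<kappa> * sqrt (2 ^ n) / real n"
  shows "avg (positions n) (rand_accept_prob R) -
    avg (positions n) (\<lambda>h. rand_accept_prob R h * likelihood n (positions n) h) \<le> 71 * \<kappa>"
proof -
  let ?a = "\<lambda>w t. avg (positions n) (\<lambda>h. of_bool (run_dtree h t) * w h)"
  have int: "integrable (measure_pmf R) (?a w)" for w
  proof -
    have "integrable (measure_pmf R) (\<lambda>t. of_bool (run_dtree h t) * c :: real)" for h c
      by (rule measure_pmf.integrable_const_bound[where B = "\<bar>c\<bar>"]) auto
    then show ?thesis unfolding avg_def by (intro integrable_divide Bochner_Integration.integrable_sum) auto
  qed
  have "avg (positions n) (\<lambda>h. rand_accept_prob R h * 1) -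
      avg (positions n) (\<lambda>h. rand_accept_prob R h * likelihood n (positions n) h) =
      measure_pmf.expectation R (\<lambda>t. ?a (\<lambda>_. 1) t - ?a (likelihood n (positions n)) t)"
    unfolding avg_rand_accept_prob by (rule Bochner_Integration.integral_diff[symmetric, OF int int])
  also have "\<dots> \<le> 71 * \<kappa>"
  proof (rule measure_pmf.integral_le_const)
    show "AE t in measure_pmf R. ?a (\<lambda>_. 1) t - ?a (likelihood n (positions n)) t \<le> 71 * \<kappa>"
    proof (rule AE_pmfI)
      fix t assume "t \<in> set_pmf R"
      then have "set_dtree t \<subseteq> positions n" "depth t \<le> T" using alg by (auto simp: randomized_algorithm_def)
      from avg_run_diff_le[OF this \<kappa> n X]
      show "?a (\<lambda>_. 1) t - ?a (likelihood n (positions n)) t \<le> 71 * \<kappa>" by simp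
    qed
  qed (intro Bochner_Integration.integrable_diff int)
  finally show ?thesis by simp
qed

text \<open>Chebyshev's inequality for both distributions, with the indicator functions of the bad
  events replaced by the quadratic functions that bound them.\<close>

lemma tester_distinguishes:
  assumes alg: "randomized_algorithm n T R" and test: "tests_with_error n \<epsilon> (1 / 2 - c) (rand_accept_prob R)"
    and "0 < c" "\<epsilon> \<le> 1 / 10000"
  defines "V \<equiv> 1 / 2 ^ n + exp (-2) / 128 * (cosh (4 / sqrt (2 ^ n)) - 1) * (2 ^ n + 1) - exp (-2) / 16"
  shows "2 * c - (1 / 2 + c) * (10000 / 2 ^ n + 625 * V) \<le> avg (positions n) (rand_accept_prob R) -
    avg (positions n) (\<lambda>h. rand_accept_prob R h * likelihood n (positions n) h)"
proof -
  let ?K = "positions n" and ?acc = "rand_accept_prob R" and ?L = "likelihood n (positions n)" and ?\<Phi> = "table_Phi n"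
  define a :: real where "a = exp (-1) / 4"
  have a: "a \<ge> 9 / 100"
  proof -
    have "exp 1 * (9 / 25) \<le> (1 :: real)" using e_less_272 by simp
    then show ?thesis by (simp add: a_def exp_minus field_simps)
  qed
  have a2: "a\<^sup>2 = exp (-2) / 16" by (simp add: a_def power_divide exp_double[symmetric])
  have acc01: "0 \<le> ?acc h" "?acc h \<le> 1" for h by (auto simp: rand_accept_prob_def)
  \<comment> \<open>If \<open>Phi\<close> exceeds 1/100, the quadratic term alone reaches
    \<open>1 / 2 + c\<close> and the minorant drops to 0 or below, a trivial bound for the
    acceptance probability; 10000 is the inverse square of 1/100.\<close>
  have "(1 / 2 + c) * (1 - 10000 / 2 ^ n) = avg ?K (\<lambda>h. (1 / 2 + c) - (1 / 2 + c) * 10000 * (?\<Phi> h)\<^sup>2)"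
    by (simp only: avg_diff avg_mult_left avg_const[OF finite_positions] uniform_Phi_square) (simp add: algebra_simps add_divide_distrib)
  also have "\<dots> \<le> avg ?K ?acc"
  proof (rule avg_mono)
    fix h assume h: "h \<in> signs ?K"
    show "(1 / 2 + c) - (1 / 2 + c) * 10000 * (?\<Phi> h)\<^sup>2 \<le> ?acc h"
    proof (cases "?\<Phi> h \<le> 1 / 100")
      case True
      have "0 \<le> (1 / 2 + c) * 10000 * (?\<Phi> h)\<^sup>2" using assms(3) by simp
      then show ?thesis using tests_on_signs(1)[OF alg test h True] by linarith
    next
      case False
      then have "(1 / 100)\<^sup>2 \<le> (?\<Phi> h)\<^sup>2" by (intro power_mono) auto
      then have "(1 / 2 + c) * 10000 * (1 / 100)\<^sup>2 \<le> (1 / 2 + c) * 10000 * (?\<Phi> h)\<^sup>2"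
        using assms(3) by (intro mult_left_mono) auto
      then show ?thesis using acc01(1)[of h] by (simp add: power2_eq_square)
    qed
  qed
  finally have U: "(1 / 2 + c) * (1 - 10000 / 2 ^ n) \<le> avg ?K ?acc" .
  have L1: "avg ?K ?L = 1"
  proof -
    interpret P: prob_space "gauss ?K" by (rule prob_space_gauss)
    show ?thesis using avg_prod_likelihood[of "{}" n] P.prob_space by simp
  qed
  have "avg ?K (\<lambda>h. ?acc h * ?L h) \<le>
      avg ?K (\<lambda>h. ((1 / 2 - c) + (1 / 2 + c) * 625 * (?\<Phi> h - a)\<^sup>2) * ?L h)"
  proof (rule avg_mono)
    fix h assume h: "h \<in> signs ?K"
    have sq: "0 \<le> (1 / 2 + c) * 625 * (?\<Phi> h - a)\<^sup>2" using assms(3) by simp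
    \<comment> \<open>Likewise 625 is the inverse square of 1/25 = 9/100 - 1/20; below 1/20 the
      penalty of at least \<open>1 / 2 + c\<close> lifts \<open>1 / 2 - c\<close> to the trivial
      bound 1.\<close>
    have "?acc h \<le> (1 / 2 - c) + (1 / 2 + c) * 625 * (?\<Phi> h - a)\<^sup>2"
    proof (cases "1 / 20 \<le> ?\<Phi> h")
      case True
      show ?thesis using tests_on_signs(2)[OF alg test h True assms(4)] sq by linarith
    next
      case False
      then have "(1 / 25)\<^sup>2 \<le> (a - ?\<Phi> h)\<^sup>2" using a by (intro power_mono) auto
      then have "(1 / 2 + c) * 625 * (1 / 25)\<^sup>2 \<le> (1 / 2 + c) * 625 * (?\<Phi> h - a)\<^sup>2"
        using assms(3) by (intro mult_left_mono) (auto simp: power2_commute)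
      then show ?thesis using acc01(2)[of h] by (simp add: power2_eq_square)
    qed
    then show "?acc h * ?L h \<le> ((1 / 2 - c) + (1 / 2 + c) * 625 * (?\<Phi> h - a)\<^sup>2) * ?L h"
      by (rule mult_right_mono) (rule likelihood_nonneg[OF h subset_refl])
  qed
  also have "\<dots> = avg ?K (\<lambda>h. (1 / 2 - c) * ?L h + (1 / 2 + c) * 625 *
      ((?\<Phi> h)\<^sup>2 * ?L h - 2 * a * (?\<Phi> h * ?L h) + a\<^sup>2 * ?L h))"
    by (simp add: power2_diff algebra_simps add_divide_distrib)
  also have "\<dots> = (1 / 2 - c) + (1 / 2 + c) * 625 *
      (avg ?K (\<lambda>h. (?\<Phi> h)\<^sup>2 * ?L h) - 2 * a * avg ?K (\<lambda>h. ?\<Phi> h * ?L h) + a\<^sup>2)"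
    by (simp only: avg_add avg_diff avg_mult_left L1) simp
  also have "\<dots> \<le> (1 / 2 - c) + (1 / 2 + c) * 625 * V"
  proof (intro add_left_mono mult_left_mono)
    \<comment> \<open>The mean enters the expanded square with a negative sign, so its lower bound
      is the side required.\<close>
    have "a * a \<le> a * avg ?K (\<lambda>h. ?\<Phi> h * ?L h)"
      using forr_mean_Phi[of n] a by (intro mult_left_mono) (auto simp: a_def)
    then show "avg ?K (\<lambda>h. (?\<Phi> h)\<^sup>2 * ?L h) - 2 * a * avg ?K (\<lambda>h. ?\<Phi> h * ?L h) + a\<^sup>2 \<le> V"
      using forr_Phi_square[of n] a2 unfolding V_def power2_eq_square[of a] by linarith
  qed (use assms(3) in auto)
  finally have "avg ?K (\<lambda>h. ?acc h * ?L h) \<le> (1 / 2 - c) + (1 / 2 + c) * 625 * V" .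
  with U show ?thesis by (simp add: algebra_simps)
qed

lemma classical_lower_bound:
  assumes "\<epsilon> \<le> 1 / 10000" "c > 0"
  shows "\<exists>K>0. \<exists>n0. \<forall>n\<ge>n0. \<forall>T R. randomized_algorithm n T R \<and>
     tests_with_error n \<epsilon> (1 / 2 - c) (rand_accept_prob R) \<longrightarrow>
     real T \<ge> K * (sqrt (2 ^ n) / log 2 (2 ^ n))"
proof -
  \<comment> \<open>With this choice the advantage of a tester is at most
    \<open>71 * \<kappa> \<le> c\<close>, while \<open>tester_distinguishes\<close> demands more
    than \<open>c\<close> as soon as its error term is below \<open>c\<close>.\<close>
  define \<kappa> where "\<kappa> = min 1 (c / 71)"
  have \<kappa>: "0 < \<kappa>" "\<kappa> \<le> 1" "71 * \<kappa> \<le> c" using assms(2) by (auto simp: \<kappa>_def)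
  define V where "V n = 1 / 2 ^ n + exp (-2) / 128 * (cosh (4 / sqrt (2 ^ n)) - 1) * (2 ^ n + 1) - exp (-2) / 16"
    for n :: nat
  have "(\<lambda>n. (1 / 2 + c) * (10000 / 2 ^ n + 625 * V n)) \<longlonglongrightarrow> (1 / 2 + c) * (0 + 625 * 0)"
    unfolding V_def by (intro tendsto_intros forr_variance_tendsto_0) real_asymp
  then have "\<forall>\<^sub>F n in sequentially. (1 / 2 + c) * (10000 / 2 ^ n + 625 * V n) < c"
    using assms(2) by (intro order_tendstoD(2)) auto
  \<comment> \<open>The query budget \<open>\<kappa> * sqrt (2 ^ n) / n\<close> has to be at least 1
    for the potential bounds to apply.\<close>
  moreover have "\<forall>\<^sub>F n in sequentially. 1 / \<kappa> \<le> sqrt (2 ^ n) / real n"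
  proof -
    have "filterlim (\<lambda>n. sqrt (2 ^ n) / real n) at_top sequentially" by real_asymp
    then show ?thesis by (simp add: filterlim_at_top)
  qed
  ultimately have "\<forall>\<^sub>F n in sequentially. n \<ge> 1 \<and> (1 / 2 + c) * (10000 / 2 ^ n + 625 * V n) < c \<and> 1 / \<kappa> \<le> sqrt (2 ^ n) / real n"
    using eventually_ge_at_top[of 1] by eventually_elim simp
  then obtain n0 where n0: "\<And>n. n \<ge> n0 \<Longrightarrow> n \<ge> 1 \<and> (1 / 2 + c) * (10000 / 2 ^ n + 625 * V n) < c \<and> 1 / \<kappa> \<le> sqrt (2 ^ n) / real n"
    by (auto simp: eventually_sequentially)
  have "real T \<ge> \<kappa> * (sqrt (2 ^ n) / log 2 (2 ^ n))"
    if n: "n \<ge> n0" and alg: "randomized_algorithm n T R"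
      and test: "tests_with_error n \<epsilon> (1 / 2 - c) (rand_accept_prob R)" for n T R
  proof (rule ccontr)
    assume "\<not> ?thesis"
    then have T: "real T \<le> \<kappa> * sqrt (2 ^ n) / real n" by (simp add: log_nat_power)
    have "1 \<le> \<kappa> * sqrt (2 ^ n) / real n"
      using n0[OF n] \<kappa>(1) by (simp add: field_simps)
    from randomized_indistinguishable[OF alg \<kappa>(1,2) _ this T] n0[OF n]
    have "avg (positions n) (rand_accept_prob R) -
      avg (positions n) (\<lambda>h. rand_accept_prob R h * likelihood n (positions n) h) \<le> 71 * \<kappa>" by simp
    moreover note tester_distinguishes[OF alg test assms(2,1), folded V_def]
    ultimately show False using n0[OF n] \<kappa>(3) by linarith
  qed
  with \<kappa>(1) show ?thesis by blast
qed

theorem mainTheorem10: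
  shows "(\<exists>C>0. \<forall>n::nat. \<forall>\<epsilon>::real. \<epsilon> > 0 \<longrightarrow>
            (\<exists>T A. quantum_algorithm n T A \<and> real T \<le> C / \<epsilon> \<and>
               tests_with_error n \<epsilon> (1 / 3) (quantum_accept_prob T A)))
       \<and> (\<exists>\<epsilon>0>0. \<forall>\<epsilon>::real. 0 < \<epsilon> \<and> \<epsilon> \<le> \<epsilon>0 \<longrightarrow>
            (\<forall>c>0. \<exists>K>0. \<exists>n0. \<forall>n\<ge>n0. \<forall>T R.
               randomized_algorithm n T R \<and>
               tests_with_error n \<epsilon> (1 / 2 - c) (rand_accept_prob R) \<longrightarrow>
               real T \<ge> K * (sqrt (2 ^ n) / log 2 (2 ^ n))))"
proof
  show "\<exists>C>0. \<forall>n::nat. \<forall>\<epsilon>::real. \<epsilon> > 0 \<longrightarrow>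
            (\<exists>T A. quantum_algorithm n T A \<and> real T \<le> C / \<epsilon> \<and>
               tests_with_error n \<epsilon> (1 / 3) (quantum_accept_prob T A))"
    using quantum_upper_bound by (intro exI[of _ 6404]) auto
  show "\<exists>\<epsilon>0>0. \<forall>\<epsilon>::real. 0 < \<epsilon> \<and> \<epsilon> \<le> \<epsilon>0 \<longrightarrow>
            (\<forall>c>0. \<exists>K>0. \<exists>n0. \<forall>n\<ge>n0. \<forall>T R.
               randomized_algorithm n T R \<and>
               tests_with_error n \<epsilon> (1 / 2 - c) (rand_accept_prob R) \<longrightarrow>
               real T \<ge> K * (sqrt (2 ^ n) / log 2 (2 ^ n)))"
    using classical_lower_bound by (intro exI[of _ "1 / 10000"]) auto
qed

end
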